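(* Let $n\in\{2,3\}$ and let $\Omega\subset\mathbb{R}^n$ be a bounded domain. Suppose $Q\in H^2(\Omega;\overline{\mathcal{Q}_{phy}})$ and $f(Q)\in H^1(\Omega)$. Then the contact set $$\mathcal{C}(Q)=\{x\in\Omega : f(Q(x))=\infty\}$$ satisfies: (i) if $n=2$, then $\mathcal{C}(Q)=\emptyset$; (ii) if $n=3$, then $\mathcal{C}(Q)$ has Hausdorff dimension at most $1$; more precisely, $\mathcal{H}^{1+\epsilon}(\mathcal{C}(Q))=0$ for every $\epsilon>0$.
   Context: Let $\mathcal{Q}=\{M\in\mathbb{R}^{3\times3}:\operatorname{tr}M=0,\ M=M^T\}$. For $M\in\mathcal{Q}$, $\lambda_1(M)\le\lambda_2(M)\le\lambda_3(M)$ are its eigenvalues; $\mathcal{Q}_{phy}=\{M\in\mathcal{Q}:-\tfrac13<\lambda_1(M)\le\lambda_2(M)\le\lambda_3(M)<\tfrac23\}$ and $\overline{\mathcal{Q}_{phy}}$ is its closure in $\mathcal{Q}$. Singular potential $f:\mathcal{Q}\to\mathbb{R}\cup\{+\infty\}$: for $Q\in\mathcal{Q}_{phy}$, $$f(Q)=\inf_{\rho\in\mathcal{A}_Q}\int_{\mathbb{S}^2}\rho(\mathbf{n})\ln\rho(\mathbf{n})\,d\mathbf{n},$$ where $\mathcal{A}_Q$ is the set of $\rho:\mathbb{S}^2\to\mathbb{R}_{\ge0}$ with $\|\rho\|_{L^1(\mathbb{S}^2)}=1$, $\rho(\mathbf{n})=\rho(-\mathbf{n})$ and $\int_{\mathbb{S}^2}(\mathbf{n}\mathbf{n}^T-\tfrac13\mathbb{I}_3)\rho(\mathbf{n})\,d\mathbf{n}=Q$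 (with $0\ln0=0$, $d\mathbf{n}$ the surface measure, $\mathbb{I}_3$ the identity matrix); $f(Q)=+\infty$ for $Q\in\mathcal{Q}\setminus\mathcal{Q}_{phy}$. Since $n\le3$, $Q\in H^2(\Omega)$ has a continuous representative in $\Omega$, and $Q(x)$ in the definition of $\mathcal{C}(Q)$ refers to this representative. $\mathcal{H}^s$ denotes $s$-dimensional Hausdorff measure. *)

theory Defs
  imports "HOL-Analysis.Analysis"
begin

section \<open>Sobolev spaces\<close>

text \<open>Functions on an open set \<open>\<Omega>\<close> are total functions whose values off \<open>\<Omega>\<close> are
  irrelevant, and every Sobolev-type notion below is invariant under changes on Lebesgue null
  sets.\<close>

definition bounded_domain :: "'a::euclidean_space set \<Rightarrow> bool" where
  "bounded_domain \<Omega> \<longleftrightarrow> open \<Omega> \<and> connected \<Omega> \<and> \<Omega> \<noteq> {} \<and> bounded \<Omega>"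

definition partial_deriv :: "'a::euclidean_space \<Rightarrow> ('a \<Rightarrow> real) \<Rightarrow> 'a \<Rightarrow> real" where
  "partial_deriv b \<phi> x = frechet_derivative \<phi> (at x) b"

primrec C_k :: "nat \<Rightarrow> ('a::euclidean_space \<Rightarrow> real) \<Rightarrow> bool" where
  "C_k 0 \<phi> \<longleftrightarrow> continuous_on UNIV \<phi>"
| "C_k (Suc k) \<phi> \<longleftrightarrow>
     (\<forall>x. \<phi> differentiable (at x)) \<and> (\<forall>b\<in>Basis. C_k k (partial_deriv b \<phi>))"

definition test_function :: "'a::euclidean_space set \<Rightarrow> ('a \<Rightarrow> real) \<Rightarrow> bool" where
  "test_function \<Omega> \<phi> \<longleftrightarrow> (\<forall>k. C_k k \<phi>) \<and>
     compact (closure {x. \<phi> x \<noteq> 0}) \<and> closure {x. \<phi> x \<noteq> 0} \<subseteq> \<Omega>"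

definition locally_integrable :: "'a::euclidean_space set \<Rightarrow> ('a \<Rightarrow> real) \<Rightarrow> bool" where
  "locally_integrable \<Omega> u \<longleftrightarrow> (\<forall>K. compact K \<and> K \<subseteq> \<Omega> \<longrightarrow> set_integrable lebesgue K u)"

definition weak_partial ::
    "'a::euclidean_space set \<Rightarrow> 'a \<Rightarrow> ('a \<Rightarrow> real) \<Rightarrow> ('a \<Rightarrow> real) \<Rightarrow> bool" where
  "weak_partial \<Omega> b u v \<longleftrightarrow> locally_integrable \<Omega> u \<and> locally_integrable \<Omega> v \<and>
     (\<forall>\<phi>. test_function \<Omega> \<phi> \<longrightarrow>
        (LINT x:\<Omega>|lebesgue. u x * partial_deriv b \<phi> x) = - (LINT x:\<Omega>|lebesgue. v x * \<phi> x))"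

definition L2_on :: "'a::euclidean_space set \<Rightarrow> ('a \<Rightarrow> real) \<Rightarrow> bool" where
  "L2_on \<Omega> u \<longleftrightarrow> set_borel_measurable lebesgue \<Omega> u \<and> set_integrable lebesgue \<Omega> (\<lambda>x. (u x)\<^sup>2)"

text \<open>\<open>sobolev_H k \<Omega> u\<close> says that \<open>u \<in> H\<^sup>k(\<Omega>)\<close>: all weak partial derivatives of order at
  most \<open>k\<close> exist and are square integrable.\<close>

primrec sobolev_H :: "nat \<Rightarrow> 'a::euclidean_space set \<Rightarrow> ('a \<Rightarrow> real) \<Rightarrow> bool" where
  "sobolev_H 0 \<Omega> u \<longleftrightarrow> L2_on \<Omega> u"
| "sobolev_H (Suc k) \<Omega> u \<longleftrightarrow>
     L2_on \<Omega> u \<and> (\<forall>b\<in>Basis. \<exists>v. weak_partial \<Omega> b u v \<and> sobolev_H k \<Omega> v)"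

definition sobolev_H_into ::
    "nat \<Rightarrow> 'a::euclidean_space set \<Rightarrow> (real^'m^'l) set \<Rightarrow> ('a \<Rightarrow> real^'m^'l) \<Rightarrow> bool" where
  "sobolev_H_into k \<Omega> S F \<longleftrightarrow>
     (\<forall>i j. sobolev_H k \<Omega> (\<lambda>x. F x $ i $ j)) \<and> (AE x in lebesgue. x \<in> \<Omega> \<longrightarrow> F x \<in> S)"

text \<open>An extended-real-valued function belongs to \<open>H\<^sup>k(\<Omega>)\<close> if it is finite almost everywhere
  and agrees almost everywhere with a real-valued element of \<open>H\<^sup>k(\<Omega>)\<close>.\<close>

definition sobolev_H_ereal :: "nat \<Rightarrow> 'a::euclidean_space set \<Rightarrow> ('a \<Rightarrow> ereal) \<Rightarrow> bool" where
  "sobolev_H_ereal k \<Omega> F \<longleftrightarrow>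
     (\<exists>u. sobolev_H k \<Omega> u \<and> (AE x in lebesgue. x \<in> \<Omega> \<longrightarrow> F x = ereal (u x)))"

text \<open>On an open set two continuous representatives coincide, so the choice below only fixes
  values off \<open>\<Omega>\<close>. It is meaningful only if a continuous representative exists, as it does for
  \<open>H\<^sup>2\<close> functions in dimension at most 3 by the Sobolev embedding.\<close>

definition continuous_representative ::
    "'a::euclidean_space set \<Rightarrow> ('a \<Rightarrow> 'b::topological_space) \<Rightarrow> 'a \<Rightarrow> 'b" where
  "continuous_representative \<Omega> F =
     (SOME G. continuous_on \<Omega> G \<and> (AE x in lebesgue. x \<in> \<Omega> \<longrightarrow> G x = F x))"

section \<open>Hausdorff measure and dimension\<close>

text \<open>Since \<^term>\<open>0 powr 0 = (0::real)\<close>, the exponent \<open>s = 0\<close> is treated separately, so that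
  nonempty sets get weight 1 and \<open>\<H>\<^sup>0\<close> is the counting measure. The covering sets must be
  required to be bounded because \<^const>\<open>diameter\<close> is unspecified on unbounded sets. For
  \<open>s = n\<close> the factor \<^term>\<open>unit_ball_vol s\<close> normalizes \<open>\<H>\<^sup>n\<close> to Lebesgue measure.\<close>

definition hausdorff_weight :: "real \<Rightarrow> 'a::metric_space set \<Rightarrow> real" where
  "hausdorff_weight s U =
     (if U = {} then 0 else if s = 0 then 1 else unit_ball_vol s * (diameter U / 2) powr s)"

definition hausdorff_pre :: "real \<Rightarrow> real \<Rightarrow> 'a::metric_space set \<Rightarrow> ennreal" where
  "hausdorff_pre s \<delta> A =
     (INF U \<in> {U :: nat \<Rightarrow> 'a set. A \<subseteq> (\<Union>i. U i) \<and> (\<forall>i. bounded (U i) \<and> diameter (U i) \<le> \<delta>)}.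
        \<Sum>i. ennreal (hausdorff_weight s (U i)))"

definition hausdorff_measure :: "real \<Rightarrow> 'a::metric_space set \<Rightarrow> ennreal" where
  "hausdorff_measure s A = (SUP \<delta>\<in>{0<..}. hausdorff_pre s \<delta> A)"

definition hausdorff_dim :: "'a::metric_space set \<Rightarrow> ereal" where
  "hausdorff_dim A = (INF s \<in> {s. 0 \<le> s \<and> hausdorff_measure s A = 0}. ereal s)"

section \<open>Q-tensors and the singular potential\<close>

definition Q_tensors :: "(real^3^3) set" where
  "Q_tensors = {M. trace M = 0 \<and> M = transpose M}"

text \<open>The eigenvalues in increasing order, repeated according to multiplicity, as the roots of the
  characteristic polynomial; here \<^term>\<open>mat x\<close> is \<open>x\<close> times the identity. A unique such list,
  of length 3, exists whenever all roots are real, in particular for symmetric matrices.\<close>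

definition eigenvalues :: "real^3^3 \<Rightarrow> real list" where
  "eigenvalues M = (THE ls. sorted ls \<and> (\<forall>x. det (mat x - M) = (\<Prod>l\<leftarrow>ls. x - l)))"

definition eigenvalue1 :: "real^3^3 \<Rightarrow> real" where "eigenvalue1 M = eigenvalues M ! 0"
definition eigenvalue2 :: "real^3^3 \<Rightarrow> real" where "eigenvalue2 M = eigenvalues M ! 1"
definition eigenvalue3 :: "real^3^3 \<Rightarrow> real" where "eigenvalue3 M = eigenvalues M ! 2"

definition Q_phy :: "(real^3^3) set" where
  "Q_phy = {M \<in> Q_tensors. - 1 / 3 < eigenvalue1 M \<and> eigenvalue1 M \<le> eigenvalue2 M \<and>
              eigenvalue2 M \<le> eigenvalue3 M \<and> eigenvalue3 M < 2 / 3}"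

definition Q_phy_closure :: "(real^3^3) set" where
  "Q_phy_closure = top_of_set Q_tensors closure_of Q_phy"

text \<open>The surface measure on the unit sphere, defined by polar coordinates: the measure of a Borel
  set \<open>A\<close> of the sphere is the dimension times the volume of the cone
  \<open>{t x | x \<in> A, 0 < t < 1}\<close> over it. In \<open>\<real>\<^sup>3\<close> the total mass is \<open>4 \<pi>\<close>.\<close>

definition sphere_measure :: "'a::euclidean_space measure" where
  "sphere_measure = scale_measure (of_nat DIM('a))
     (distr (restrict_space lborel (ball 0 1 - {0})) (restrict_space borel (sphere 0 1))
        (\<lambda>x. x /\<^sub>R norm x))"

definition admissible :: "real^3^3 \<Rightarrow> (real^3 \<Rightarrow> real) set" where
  "admissible Q = {\<rho>.
     (\<forall>n\<in>sphere 0 1. 0 \<le> \<rho> n \<and> \<rho> n = \<rho> (- n)) \<and>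
     integrable sphere_measure \<rho> \<and> (LINT n|sphere_measure. \<bar>\<rho> n\<bar>) = 1 \<and>
     (LINT n|sphere_measure. \<rho> n *\<^sub>R ((\<chi> i j. n $ i * n $ j) - (1 / 3) *\<^sub>R mat 1)) = Q}"

text \<open>The integral of \<open>\<rho> ln \<rho>\<close> for measurable \<open>\<rho> \<ge> 0\<close>, with values in \<open>\<real> \<union> {+\<infinity>}\<close>. As
  \<open>t ln t \<ge> - 1 / e\<close> and the sphere has finite measure, the negative part is always integrable,
  so a nonintegrable integrand has integral \<open>+\<infinity>\<close>. The library convention
  \<^prop>\<open>ln 0 = (0::real)\<close> yields \<open>0 ln 0 = 0\<close>.\<close>

definition entropy :: "(real^3 \<Rightarrow> real) \<Rightarrow> ereal" where
  "entropy \<rho> = (if integrable sphere_measure (\<lambda>n. \<rho> n * ln (\<rho> n))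
     then ereal (LINT n|sphere_measure. \<rho> n * ln (\<rho> n)) else \<infinity>)"

text \<open>The potential is only meant for arguments in \<^const>\<open>Q_tensors\<close>.\<close>

definition singular_potential :: "real^3^3 \<Rightarrow> ereal" where
  "singular_potential Q = (if Q \<in> Q_phy then INF \<rho>\<in>admissible Q. entropy \<rho> else \<infinity>)"

definition contact_set :: "'a::euclidean_space set \<Rightarrow> ('a \<Rightarrow> real^3^3) \<Rightarrow> 'a set" where
  "contact_set \<Omega> Q = {x \<in> \<Omega>. singular_potential (continuous_representative \<Omega> Q x) = \<infinity>}"

end

theory Submission
  imports Defs
begin

text \<open>Let \<open>U\<^sub>t(x) = \<integral> u(y) t\<^sup>-\<^sup>n \<kappa>((y - x)/t) dy\<close>. With \<open>z = (y - x)/t\<close>, the \<open>t\<close>-derivative of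
  the kernel is a divergence, so \<open>d/dt U\<^sub>t(x) = \<Sum>\<^sub>b \<integral> \<partial>\<^sub>bu(y) z\<^sub>b \<kappa>(z) t\<^sup>-\<^sup>n dy\<close>, which is again a mollification,
  now of the weak gradient; this replaces the Poincare inequality throughout. Applied twice to
  \<open>u \<in> H\<^sup>2\<close> with \<open>n \<le> 3\<close> it gives \<open>d/dt U\<^sub>t = O(t powr (-1/2))\<close> locally uniformly, hence a Hoelder
  continuous representative.

  At a contact point \<open>x0\<close> the smallest eigenvalue of \<open>Q(x0)\<close> is \<open>-1/3\<close>, and an entropy estimate shows
  that \<open>f(Q)\<close> is at least a multiple of \<open>ln (1/\<delta>)\<close> when \<open>e \<bullet> Q e + 1/3 \<le> \<delta>\<close>. By Hoelder continuity, the
  mollifications of \<open>u = f(Q)\<close> grow at least like \<open>c ln (1/t)\<close> at \<open>x0\<close>. For \<open>n = 2\<close> the Cauchy-Schwarz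
  inequality gives \<open>d/dt U\<^sub>t(x0) = o(1/t)\<close>, a contradiction. For \<open>n = 3\<close> unboundedness of \<open>U\<^sub>t(x0)\<close>
  forces the energy of \<open>u\<close> on small balls around \<open>x0\<close> to exceed any multiple of \<open>t powr (1 + \<epsilon>)\<close>, and
  the Vitali covering lemma shows that such points form a null set for \<open>\<H>\<close> of dimension \<open>1 + \<epsilon>\<close>.\<close>

section \<open>Smooth functions and a bump function\<close>

text \<open>The scale derivative is bounded by \<open>t powr (- n / 2)\<close> times the root of the
  gradient energy on \<open>cball x t\<close>, and this fixes the exponents. For
  \<open>n = 2\<close> the power just fails to be integrable at \<open>0\<close>, leaving room for
  logarithmic growth with an arbitrarily small factor; for \<open>n = 3\<close> an energy of order
  \<open>t powr s\<close> with \<open>s > 1\<close> restores integrability. Any logarithmic blow-up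
  of the potential therefore suffices, whatever its factor, and so does any positive Hoelder
  exponent. Two obstacles shape the rest. Contact is defined by the value \<open>\<infinity>\<close>
  and not by eigenvalues, and an infimum over no densities, or only over densities of infinite
  entropy, would be infinite too; hence finiteness on all of \<open>Q_phy\<close> has to be proved,
  by separating convex sets of moments of bounded densities. Moreover \<open>u\<close> is determined
  only up to null sets and cannot be evaluated at a contact point: lower bounds hold almost
  everywhere around it and are passed on to the mollifications, which are defined at that very point
  for every small scale.\<close>

lemma C_k_imp_continuous: "C_k k f \<Longrightarrow> continuous_on UNIV f"
  by (cases k) (auto intro!: continuous_at_imp_continuous_on differentiable_imp_continuous_within)

lemma C_k_Suc_imp: "C_k (Suc k) f \<Longrightarrow> C_k k f"
proof (induction k arbitrary: f)
  case 0
  then show ?case using C_k_imp_continuous by fastforce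
next
  case (Suc k)
  then show ?case by auto
qed

lemma partial_deriv_eqI: "(f has_derivative f') (at x) \<Longrightarrow> partial_deriv b f x = f' b"
  by (simp add: partial_deriv_def frechet_derivative_at [symmetric])

lemma C_k_SucI:
  assumes "\<And>x. (f has_derivative f' x) (at x)"
    and "\<And>b. b \<in> Basis \<Longrightarrow> C_k k (\<lambda>x. f' x b)"
  shows "C_k (Suc k) f"
proof -
  have "partial_deriv b f = (\<lambda>x. f' x b)" for b
    using assms(1) by (auto intro!: partial_deriv_eqI)
  moreover have "f differentiable (at x)" for x
    using assms(1) differentiable_def by blast
  ultimately show ?thesis using assms(2) by simp
qed

lemma C_k_SucD:
  assumes "C_k (Suc k) f"
  obtains f' where "\<And>x. (f has_derivative f' x) (at x)"
    and "\<And>b. b \<in> Basis \<Longrightarrow> C_k k (\<lambda>x. f' x b)"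
proof
  show 1: "(f has_derivative frechet_derivative f (at x)) (at x)" for x
    using assms frechet_derivative_works by auto
  show "C_k k (\<lambda>x. frechet_derivative f (at x) b)" if "b \<in> Basis" for b
    using assms that by (simp add: partial_deriv_def [abs_def])
qed

lemma C_k_const: "C_k k (\<lambda>x. c)"
proof (induction k arbitrary: c)
  case (Suc k)
  show ?case by (rule C_k_SucI [where f'="\<lambda>_ _. 0"]) (auto simp: Suc)
qed simp

lemma C_k_inner: "C_k k (\<lambda>x. x \<bullet> a)"
proof (cases k)
  case (Suc m)
  show ?thesis unfolding Suc
    by (rule C_k_SucI [where f'="\<lambda>_ h. h \<bullet> a"]) (auto intro!: derivative_eq_intros C_k_const)
qed (auto intro!: continuous_intros)

lemma C_k_add: "C_k k f \<Longrightarrow> C_k k g \<Longrightarrow> C_k k (\<lambda>x. f x + g x)"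
proof (induction k arbitrary: f g)
  case 0
  then show ?case by (auto intro!: continuous_intros)
next
  case (Suc k)
  obtain f' where f: "\<And>x. (f has_derivative f' x) (at x)"
    and f': "\<And>b. b \<in> Basis \<Longrightarrow> C_k k (\<lambda>x. f' x b)" using Suc.prems(1) by (rule C_k_SucD) blast
  obtain g' where g: "\<And>x. (g has_derivative g' x) (at x)"
    and g': "\<And>b. b \<in> Basis \<Longrightarrow> C_k k (\<lambda>x. g' x b)" using Suc.prems(2) by (rule C_k_SucD) blast
  show ?case
    by (rule C_k_SucI [OF has_derivative_add [OF f g]]) (intro Suc.IH f' g')
qed

lemma C_k_mult: "C_k k f \<Longrightarrow> C_k k g \<Longrightarrow> C_k k (\<lambda>x. f x * g x)"
proof (induction k arbitrary: f g)
  case 0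
  then show ?case by (auto intro!: continuous_intros)
next
  case (Suc k)
  obtain f' where f: "\<And>x. (f has_derivative f' x) (at x)"
    and f': "\<And>b. b \<in> Basis \<Longrightarrow> C_k k (\<lambda>x. f' x b)" using Suc.prems(1) by (rule C_k_SucD) blast
  obtain g' where g: "\<And>x. (g has_derivative g' x) (at x)"
    and g': "\<And>b. b \<in> Basis \<Longrightarrow> C_k k (\<lambda>x. g' x b)" using Suc.prems(2) by (rule C_k_SucD) blast
  show ?case
    by (rule C_k_SucI [OF has_derivative_mult [OF f g]])
      (intro C_k_add Suc.IH f' g' Suc.prems [THEN C_k_Suc_imp])
qed

lemma C_k_cmult: "C_k k f \<Longrightarrow> C_k k (\<lambda>x. c * f x)"
  by (rule C_k_mult [OF C_k_const])

lemma C_k_rescale: "C_k k f \<Longrightarrow> C_k k (\<lambda>y. f ((y - x) /\<^sub>R t))"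
proof (induction k arbitrary: f)
  case 0
  then show ?case
    by (auto intro!: continuous_intros continuous_on_compose2 [where g = f and t = UNIV])
next
  case (Suc k)
  obtain f' where f: "\<And>x. (f has_derivative f' x) (at x)"
    and f': "\<And>b. b \<in> Basis \<Longrightarrow> C_k k (\<lambda>x. f' x b)" using Suc.prems(1) by (rule C_k_SucD) blast
  have *: "((\<lambda>y. f ((y - x) /\<^sub>R t)) has_derivative (\<lambda>h. inverse t * f' ((y - x) /\<^sub>R t) h)) (at y)" for y
  proof -
    have "((\<lambda>y. (y - x) /\<^sub>R t) has_derivative (\<lambda>h. h /\<^sub>R t)) (at y)"
      by (auto intro!: derivative_eq_intros)
    from diff_chain_at [OF this f]
    show ?thesis
      using bounded_linear.linear [OF has_derivative_bounded_linear [OF f]]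
      by (simp add: o_def linear_cmul)
  qed
  show ?case
    by (rule C_k_SucI [OF *]) (intro C_k_cmult Suc.IH f')
qed

lemma test_function_continuous: "test_function S \<phi> \<Longrightarrow> continuous_on UNIV \<phi>"
  by (meson C_k_imp_continuous test_function_def)

lemma test_function_has_derivative:
  "test_function S \<phi> \<Longrightarrow> (\<phi> has_derivative frechet_derivative \<phi> (at x)) (at x)"
  using frechet_derivative_works test_function_def C_k.simps(2) by metis

lemma test_function_eq_0: "test_function S \<phi> \<Longrightarrow> x \<notin> S \<Longrightarrow> \<phi> x = 0"
  unfolding test_function_def using closure_subset [of "{x. \<phi> x \<noteq> 0}"] by blast

lemma test_function_mult:
  assumes "test_function S \<phi>" "\<And>k. C_k k q"
  shows "test_function S (\<lambda>x. q x * \<phi> x)"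
proof -
  have sub: "closure {x. q x * \<phi> x \<noteq> 0} \<subseteq> closure {x. \<phi> x \<noteq> 0}"
    by (intro closure_mono) auto
  moreover have "compact (closure {x. q x * \<phi> x \<noteq> 0})"
    using assms(1) sub unfolding test_function_def
    by (meson bounded_subset closed_closure compact_eq_bounded_closed)
  ultimately show ?thesis using assms C_k_mult unfolding test_function_def by blast
qed

lemma test_function_rescale:
  assumes "test_function (ball 0 1) \<kappa>" "cball x t \<subseteq> \<Omega>" "t > 0"
  shows "test_function \<Omega> (\<lambda>y. \<kappa> ((y - x) /\<^sub>R t))"
proof -
  have sub: "closure {y. \<kappa> ((y - x) /\<^sub>R t) \<noteq> 0} \<subseteq> cball x t"
  proof (rule closure_minimal)
    show "{y. \<kappa> ((y - x) /\<^sub>R t) \<noteq> 0} \<subseteq> cball x t"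
    proof
      fix y assume "y \<in> {y. \<kappa> ((y - x) /\<^sub>R t) \<noteq> 0}"
      then have "(y - x) /\<^sub>R t \<in> ball 0 1"
        using test_function_eq_0 [OF assms(1)] by blast
      then have "norm (y - x) / t < 1" using assms(3) by (simp add: divide_inverse_commute)
      then show "y \<in> cball x t"
        using assms(3) by (simp add: dist_norm norm_minus_commute)
    qed
  qed auto
  show ?thesis
    unfolding test_function_def
  proof (intro conjI allI)
    show "C_k k (\<lambda>y. \<kappa> ((y - x) /\<^sub>R t))" for k
      using assms(1) by (intro C_k_rescale) (simp add: test_function_def)
    show "compact (closure {y. \<kappa> ((y - x) /\<^sub>R t) \<noteq> 0})"
      using sub by (meson bounded_subset bounded_cball closed_closure compact_eq_bounded_closed)
  qed (use sub assms in auto)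
qed

text \<open>On the open complement of the closed support the function is locally zero, so its
  derivative vanishes there and the support cannot grow.\<close>

lemma test_function_partial_deriv:
  assumes "test_function S \<phi>" "b \<in> Basis"
  shows "test_function S (partial_deriv b \<phi>)"
proof -
  have sub: "closure {x. partial_deriv b \<phi> x \<noteq> 0} \<subseteq> closure {x. \<phi> x \<noteq> 0}"
  proof (rule closure_minimal)
    show "{x. partial_deriv b \<phi> x \<noteq> 0} \<subseteq> closure {x. \<phi> x \<noteq> 0}"
    proof (rule ccontr)
      assume "\<not> ?thesis"
      then obtain x where x: "partial_deriv b \<phi> x \<noteq> 0" "x \<in> - closure {x. \<phi> x \<noteq> 0}" by auto
      have "(\<phi> has_derivative (\<lambda>h. 0)) (at x)"
        by (rule has_derivative_transform_within_open [where s = "- closure {x. \<phi> x \<noteq> 0}"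
              and f = "\<lambda>_. 0"])
          (use x closure_subset [of "{x. \<phi> x \<noteq> 0}"] in auto)
      from partial_deriv_eqI [OF this] x show False by simp
    qed
  qed auto
  have "C_k k (partial_deriv b \<phi>)" for k
    using assms unfolding test_function_def by (metis C_k.simps(2))
  moreover have "compact (closure {x. partial_deriv b \<phi> x \<noteq> 0})"
    using assms(1) sub unfolding test_function_def
    by (meson bounded_subset closed_closure compact_eq_bounded_closed)
  ultimately show ?thesis using assms sub unfolding test_function_def by blast
qed

lemma test_function_bounded:
  assumes "test_function S \<phi>"
  obtains B where "B > 0" "\<And>x. \<bar>\<phi> x\<bar> \<le> B"
proof -
  let ?K = "closure {x. \<phi> x \<noteq> 0}"
  have "compact (\<phi> ` ?K)"
    using assms test_function_continuous [OF assms]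
    by (auto simp: test_function_def intro!: compact_continuous_image intro: continuous_on_subset)
  then obtain B where B: "B > 0" "\<And>x. x \<in> ?K \<Longrightarrow> \<bar>\<phi> x\<bar> \<le> B"
    using compact_imp_bounded [of "\<phi> ` ?K"] unfolding bounded_pos by auto
  then show thesis
    using that closure_subset [of "{x. \<phi> x \<noteq> 0}"]
    by (metis (mono_tags, lifting) abs_zero less_imp_le mem_Collect_eq subsetD)
qed

text \<open>The family \<open>p (1 / s) * exp (- 1 / s)\<close>, continued by \<open>0\<close> to
  \<open>s \<le> 0\<close>, is closed under differentiation. Letting \<open>p\<close> range over all
  polynomials is what allows a single induction to reach every order of smoothness.\<close>

definition flat_exp :: "real poly \<Rightarrow> real \<Rightarrow> real" where
  "flat_exp p s = (if s > 0 then poly p (1 / s) * exp (- (1 / s)) else 0)"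

lemma flat_exp_tendsto_0: "(flat_exp p \<longlongrightarrow> 0) (at 0)"
proof -
  have poly: "((\<lambda>x. poly p x * exp (- x)) \<longlongrightarrow> 0) at_top" for p :: "real poly"
  proof -
    have "((\<lambda>x. \<Sum>i\<le>degree p. coeff p i * (x ^ i / exp x)) \<longlongrightarrow> (\<Sum>i\<le>degree p. coeff p i * 0)) at_top"
      by (intro tendsto_intros tendsto_power_div_exp_0)
    then show ?thesis
      by (simp add: poly_altdef exp_minus sum_distrib_right divide_inverse mult.assoc)
  qed
  have "((\<lambda>s. poly p (1 / s) * exp (- (1 / s))) \<longlongrightarrow> 0) (at_right 0)"
    using filterlim_compose [OF poly filterlim_inverse_at_top_right]
    by (simp add: inverse_eq_divide)
  then have "(flat_exp p \<longlongrightarrow> 0) (at_right 0)"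
    by (rule Lim_transform_eventually)
      (auto simp: flat_exp_def intro: eventually_mono [OF eventually_at_right_less])
  moreover have "(flat_exp p \<longlongrightarrow> 0) (at_left 0)"
    by (rule Lim_transform_eventually [OF tendsto_const])
      (auto simp: flat_exp_def eventually_at_filter)
  ultimately show ?thesis by (simp add: filterlim_split_at)
qed

text \<open>For \<open>s > 0\<close> the polynomial \<open>[:0, 0, 1:]\<close> is the factor
  \<open>1 / s\<^sup>2\<close> from the inner derivative of \<open>1 / s\<close>; the exponential
  contributes \<open>p\<close> and the polynomial \<open>- pderiv p\<close>.\<close>

lemma flat_exp_has_derivative:
  "(flat_exp p has_real_derivative flat_exp ([:0, 0, 1:] * (p - pderiv p)) s) (at s)"
proof -
  consider "s > 0" | "s < 0" | "s = 0" by linarith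
  then show ?thesis
  proof cases
    case 1
    have "((\<lambda>s. poly p (1 / s) * exp (- (1 / s))) has_real_derivative
            flat_exp ([:0, 0, 1:] * (p - pderiv p)) s) (at s)"
      using 1 by (auto intro!: derivative_eq_intros DERIV_chain2 [OF poly_DERIV]
          simp: flat_exp_def field_simps power2_eq_square)
    then show ?thesis
      by (rule has_field_derivative_transform_within_open [where S = "{0<..}"])
        (use 1 in \<open>auto simp: flat_exp_def\<close>)
  next
    case 2
    have "((\<lambda>s. 0) has_real_derivative flat_exp ([:0, 0, 1:] * (p - pderiv p)) s) (at s)"
      using 2 by (simp add: flat_exp_def)
    then show ?thesis
      by (rule has_field_derivative_transform_within_open [where S = "{..<0}"])
        (use 2 in \<open>auto simp: flat_exp_def\<close>)
  next
    case 3
    \<comment> \<open>Division by \<open>h\<close> is multiplication by the variable of the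
      polynomial in \<open>1 / h\<close>, so the difference quotient at \<open>0\<close> stays in
      the family and tends to \<open>0\<close>.\<close>
    have "(\<lambda>h. flat_exp p h / h) = flat_exp (pCons 0 p)"
      by (auto simp: flat_exp_def fun_eq_iff)
    then have "(\<lambda>h. (flat_exp p (0 + h) - flat_exp p 0) / h) \<midarrow>0\<rightarrow> 0"
      using flat_exp_tendsto_0 [of "pCons 0 p"] by (simp add: flat_exp_def)
    then show ?thesis unfolding 3 by (simp add: DERIV_def flat_exp_def)
  qed
qed

lemma C_k_flat_exp: "C_k k (\<lambda>x. flat_exp p (1 / 4 - x \<bullet> x))"
proof (induction k arbitrary: p)
  case 0
  have "continuous_on UNIV (flat_exp p)"
    by (intro continuous_at_imp_continuous_on ballI DERIV_isCont [OF flat_exp_has_derivative])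
  then show ?case
    by (auto intro!: continuous_on_compose2 [where f = "\<lambda>x. 1 / 4 - x \<bullet> x" and t = UNIV] continuous_intros)
next
  case (Suc k)
  let ?p = "[:0, 0, 1:] * (p - pderiv p)"
  have *: "((\<lambda>x. flat_exp p (1 / 4 - x \<bullet> x)) has_derivative
         (\<lambda>h. flat_exp ?p (1 / 4 - x \<bullet> x) * (-2 * (x \<bullet> h)))) (at x)" for x :: 'a
    by (rule DERIV_compose_FDERIV [OF flat_exp_has_derivative, of "\<lambda>x. 1 / 4 - x \<bullet> x", THEN has_derivative_eq_rhs])
      (auto intro!: derivative_eq_intros simp: inner_commute)
  show ?case
    by (rule C_k_SucI [OF *]) (intro C_k_mult Suc C_k_const C_k_inner)
qed

text \<open>The constant \<open>1/4\<close> makes the support radius \<open>1/2\<close>, so that the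
  closed support lies strictly inside the open unit ball, as \<open>test_function (ball 0 1)\<close>
  demands.\<close>

definition bump :: "'a::euclidean_space \<Rightarrow> real" where
  "bump x = flat_exp [:1:] (1 / 4 - x \<bullet> x)"

lemma bump_nonneg: "bump x \<ge> 0"
  by (simp add: bump_def flat_exp_def)

lemma bump_pos: "norm x < 1 / 2 \<Longrightarrow> bump x > 0"
proof -
  assume "norm x < 1 / 2"
  then have "(norm x)\<^sup>2 < (1 / 2)\<^sup>2" by (intro power_strict_mono) auto
  then show ?thesis by (simp add: bump_def flat_exp_def dot_square_norm power2_eq_square)
qed

lemma test_function_bump: "test_function (ball 0 1) (bump :: 'a::euclidean_space \<Rightarrow> real)"
proof -
  have sub: "closure {x :: 'a. bump x \<noteq> 0} \<subseteq> cball 0 (1 / 2)"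
  proof (rule closure_minimal)
    show "{x :: 'a. bump x \<noteq> 0} \<subseteq> cball 0 (1 / 2)"
    proof
      fix x :: 'a assume "x \<in> {x. bump x \<noteq> 0}"
      then have "(norm x)\<^sup>2 \<le> (1 / 2)\<^sup>2"
        by (auto simp: bump_def flat_exp_def dot_square_norm power2_eq_square split: if_splits)
      then show "x \<in> cball 0 (1 / 2)" using power2_le_imp_le by fastforce
    qed
  qed auto
  moreover have "compact (closure {x :: 'a. bump x \<noteq> 0})"
    using sub by (meson bounded_subset bounded_cball closed_closure compact_eq_bounded_closed)
  moreover have "C_k k (bump :: 'a \<Rightarrow> real)" for k
    using C_k_flat_exp [of k "[:1:]", where 'a = 'a] by (simp add: bump_def [abs_def])
  ultimately show ?thesis by (fastforce simp: test_function_def)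
qed

section \<open>Mollification and weak derivatives\<close>

text \<open>The mean value theorem bounds the difference quotients by \<open>w\<close>, and
  dominated convergence applies along every sequence \<open>S\<close> of increments.\<close>

lemma has_real_derivative_integral:
  fixes f :: "real \<Rightarrow> 'b \<Rightarrow> real"
  assumes I: "t0 \<in> I" "open I" "convex I"
    and f: "\<And>t. t \<in> I \<Longrightarrow> integrable M (f t)"
    and f': "\<And>t y. t \<in> I \<Longrightarrow> ((\<lambda>t. f t y) has_real_derivative f' t y) (at t)"
    and bound: "\<And>t y. t \<in> I \<Longrightarrow> \<bar>f' t y\<bar> \<le> w y" "integrable M w"
    and meas: "f' t0 \<in> borel_measurable M"
  shows "((\<lambda>t. LINT y|M. f t y) has_real_derivative (LINT y|M. f' t0 y)) (at t0)"
  unfolding DERIV_def LIMSEQ_SEQ_conv [symmetric]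
proof (intro allI impI, elim conjE)
  fix S :: "nat \<Rightarrow> real" assume S: "\<forall>n. S n \<noteq> 0" "S \<longlonglongrightarrow> 0"
  have "(\<lambda>n. t0 + S n) \<longlonglongrightarrow> t0" using tendsto_add [OF tendsto_const S(2), of t0] by simp
  then obtain N where N: "\<And>n. n \<ge> N \<Longrightarrow> t0 + S n \<in> I"
    using topological_tendstoD [OF _ I(2,1)] by (fastforce simp: eventually_sequentially)
  have "(\<lambda>n. LINT y|M. (f (t0 + S (n + N)) y - f t0 y) / S (n + N)) \<longlonglongrightarrow> (LINT y|M. f' t0 y)"
  proof (rule integral_dominated_convergence [where w = w])
    show "AE y in M. (\<lambda>n. (f (t0 + S (n + N)) y - f t0 y) / S (n + N)) \<longlonglongrightarrow> f' t0 y"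
    proof (intro AE_I2)
      fix y
      have "(\<lambda>n. (f (t0 + S n) y - f t0 y) / S n) \<longlonglongrightarrow> f' t0 y"
        using f' [OF I(1), of y] S unfolding DERIV_def LIMSEQ_SEQ_conv [symmetric] by auto
      then show "(\<lambda>n. (f (t0 + S (n + N)) y - f t0 y) / S (n + N)) \<longlonglongrightarrow> f' t0 y"
        by (rule LIMSEQ_ignore_initial_segment)
    qed
    show "AE y in M. norm ((f (t0 + S (n + N)) y - f t0 y) / S (n + N)) \<le> w y" for n
    proof (intro AE_I2)
      fix y
      have "norm (f (t0 + S (n + N)) y - f t0 y) \<le> w y * norm (t0 + S (n + N) - t0)"
        using I N bound f' by (intro field_differentiable_bound [where S = I and f' = "\<lambda>t. f' t y"])
          (auto intro: has_field_derivative_at_within)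
      then show "norm ((f (t0 + S (n + N)) y - f t0 y) / S (n + N)) \<le> w y"
        using S(1) by (simp add: field_simps)
    qed
    show "(\<lambda>y. (f (t0 + S (n + N)) y - f t0 y) / S (n + N)) \<in> borel_measurable M" for n
      using f [OF I(1)] f [OF N [of "n + N"]]
      by (auto intro!: borel_measurable_divide borel_measurable_diff)
  qed (use meas bound in auto)
  also have "(\<lambda>n. LINT y|M. (f (t0 + S (n + N)) y - f t0 y) / S (n + N)) =
      (\<lambda>n. ((LINT y|M. f (t0 + S (n + N)) y) - (LINT y|M. f t0 y)) / S (n + N))"
    using f [OF I(1)] f [OF N] by (simp add: fun_eq_iff)
  finally show "(\<lambda>n. ((LINT y|M. f (t0 + S n) y) - (LINT y|M. f t0 y)) / S n) \<longlonglongrightarrow> (LINT y|M. f' t0 y)"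
    by (rule LIMSEQ_offset)
qed

lemma continuous_borel_measurable_lebesgue:
  fixes f :: "'a::euclidean_space \<Rightarrow> real"
  shows "continuous_on UNIV f \<Longrightarrow> f \<in> borel_measurable lebesgue"
  using borel_measurable_continuous_onI by (intro measurable_completion) simp

lemma integrable_mult_bounded:
  fixes f g :: "'a \<Rightarrow> real"
  assumes "integrable M f" "g \<in> borel_measurable M" "\<And>x. \<bar>g x\<bar> \<le> B"
  shows "integrable M (\<lambda>x. f x * g x)"
proof (rule Bochner_Integration.integrable_bound)
  show "integrable M (\<lambda>x. B * f x)" using assms(1) by simp
  have "\<bar>f x\<bar> * \<bar>g x\<bar> \<le> \<bar>f x\<bar> * B" for x by (intro mult_left_mono assms) auto
  moreover have "B \<ge> 0" using assms(3) [of undefined] by linarith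
  ultimately show "AE x in M. norm (f x * g x) \<le> norm (B * f x)"
    by (simp add: abs_mult mult.commute)
qed (use assms in auto)

lemma set_integrable_mult_test_function:
  assumes "locally_integrable \<Omega> u" "test_function \<Omega> \<phi>"
  shows "set_integrable lebesgue \<Omega> (\<lambda>y. u y * \<phi> y)"
proof -
  obtain B where B: "\<And>x. \<bar>\<phi> x\<bar> \<le> B" using test_function_bounded [OF assms(2)] by metis
  let ?K = "closure {x. \<phi> x \<noteq> 0}"
  have "integrable lebesgue (\<lambda>y. (indicator ?K y *\<^sub>R u y) * \<phi> y)"
    using assms test_function_continuous [OF assms(2)]
    by (intro integrable_mult_bounded [OF _ _ B] continuous_borel_measurable_lebesgue)
      (auto simp: locally_integrable_def set_integrable_def test_function_def)
  also have "(\<lambda>y. (indicator ?K y *\<^sub>R u y) * \<phi> y) = (\<lambda>y. indicator \<Omega> y *\<^sub>R (u y * \<phi> y))"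
    using assms(2) closure_subset [of "{x. \<phi> x \<noteq> 0}"]
    by (fastforce simp: fun_eq_iff indicator_def test_function_def)
  finally show ?thesis by (simp add: set_integrable_def)
qed

section \<open>The scaled kernel and its derivative in the scale\<close>

lemma frechet_derivative_eq_sum_partial_deriv:
  assumes "f differentiable (at x)"
  shows "frechet_derivative f (at x) w = (\<Sum>b\<in>Basis. (w \<bullet> b) * partial_deriv b f x)"
proof -
  have lin: "linear (frechet_derivative f (at x))"
    using assms linear_frechet_derivative by blast
  have "frechet_derivative f (at x) w = frechet_derivative f (at x) (\<Sum>b\<in>Basis. (w \<bullet> b) *\<^sub>R b)"
    by (simp add: euclidean_representation)
  also have "\<dots> = (\<Sum>b\<in>Basis. (w \<bullet> b) * partial_deriv b f x)"
    by (simp add: linear_sum [OF lin] linear_cmul [OF lin] partial_deriv_def)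
  finally show ?thesis .
qed

lemma rescale_notin_unit_ball:
  fixes x y :: "'a::euclidean_space"
  assumes "y \<notin> cball x R" "0 < s" "s \<le> R"
  shows "(y - x) /\<^sub>R s \<notin> ball 0 1"
proof -
  have "1 \<le> norm (y - x) / s" using assms by (simp add: dist_norm norm_minus_commute)
  then show ?thesis using assms(2) by (simp add: divide_inverse_commute)
qed

text \<open>The kernel is arbitrary, neither nonnegative nor of integral one, since differentiation
  in \<open>t\<close> turns \<open>\<kappa>\<close> into the kernels
  \<open>(z \<bullet> b) * \<kappa> z\<close>, which change sign even for nonnegative
  \<open>\<kappa>\<close>.\<close>

definition mollify ::
    "('a::euclidean_space \<Rightarrow> real) \<Rightarrow> 'a set \<Rightarrow> ('a \<Rightarrow> real) \<Rightarrow> real \<Rightarrow> 'a \<Rightarrow> real" where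
  "mollify \<kappa> \<Omega> u t x = (LINT y:\<Omega>|lebesgue. u y * (\<kappa> ((y - x) /\<^sub>R t) / t ^ DIM('a)))"

lemma test_function_kernel:
  fixes x :: "'a::euclidean_space"
  assumes "test_function (ball 0 1) \<kappa>" "cball x t \<subseteq> \<Omega>" "t > 0"
  shows "test_function \<Omega> (\<lambda>y. \<kappa> ((y - x) /\<^sub>R t) / t ^ DIM('a))"
  using test_function_mult [OF test_function_rescale [OF assms] C_k_const]
  by (simp add: mult.commute divide_inverse)

lemma set_integrable_kernel:
  fixes x :: "'a::euclidean_space"
  assumes "locally_integrable \<Omega> u" "test_function (ball 0 1) \<kappa>" "cball x t \<subseteq> \<Omega>" "t > 0"
  shows "set_integrable lebesgue \<Omega> (\<lambda>y. u y * (\<kappa> ((y - x) /\<^sub>R t) / t ^ DIM('a)))"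
  by (intro set_integrable_mult_test_function test_function_kernel assms)

text \<open>The divergence of the vector field that sends \<open>z\<close> to
  \<open>\<kappa> z *\<^sub>R z\<close>.\<close>

definition dilation_deriv :: "('a::euclidean_space \<Rightarrow> real) \<Rightarrow> 'a \<Rightarrow> real" where
  "dilation_deriv \<kappa> z = real DIM('a) * \<kappa> z + (\<Sum>b\<in>Basis. (z \<bullet> b) * partial_deriv b \<kappa> z)"

lemma has_derivative_kernel_scale:
  fixes x :: "'a::euclidean_space"
  assumes \<kappa>: "test_function S \<kappa>" and t: "t > 0"
  shows "((\<lambda>t. \<kappa> ((y - x) /\<^sub>R t) / t ^ DIM('a)) has_real_derivative
            - (dilation_deriv \<kappa> ((y - x) /\<^sub>R t) / t ^ (DIM('a) + 1))) (at t)"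
proof -
  define z where "z = (y - x) /\<^sub>R t"
  have d: "\<kappa> differentiable (at z)" using \<kappa> unfolding test_function_def by (metis C_k.simps(2))
  have "((\<lambda>t. (y - x) /\<^sub>R t) has_vector_derivative (- (1 / t)) *\<^sub>R z) (at t)"
    unfolding has_vector_derivative_def z_def using t
    by (auto intro!: derivative_eq_intros simp: fun_eq_iff field_simps power2_eq_square)
  then have "((\<lambda>t. \<kappa> ((y - x) /\<^sub>R t)) has_real_derivative
               frechet_derivative \<kappa> (at z) ((- (1 / t)) *\<^sub>R z)) (at t)"
    using vector_derivative_diff_chain_within [of "\<lambda>t. (y - x) /\<^sub>R t" _ t UNIV \<kappa>]
      test_function_has_derivative [OF \<kappa>, of z]
    by (auto simp: o_def z_def has_real_derivative_iff_has_vector_derivative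
        intro: has_derivative_at_withinI)
  also have "frechet_derivative \<kappa> (at z) ((- (1 / t)) *\<^sub>R z) =
      - (1 / t) * (\<Sum>b\<in>Basis. (z \<bullet> b) * partial_deriv b \<kappa> z)"
    unfolding frechet_derivative_eq_sum_partial_deriv [OF d] inner_scaleR_left sum_distrib_left
    by (simp only: mult.assoc)
  finally have 1: "((\<lambda>t. \<kappa> ((y - x) /\<^sub>R t)) has_real_derivative
      - (1 / t) * (\<Sum>b\<in>Basis. (z \<bullet> b) * partial_deriv b \<kappa> z)) (at t)" .
  have 2: "((\<lambda>t. t ^ DIM('a)) has_real_derivative real DIM('a) * t ^ DIM('a) / t) (at t)"
    using t by (auto intro!: derivative_eq_intros simp: power_diff)
  show ?thesis
    using t by (intro DERIV_cong [OF DERIV_divide [OF 1 2]])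
      (simp_all add: dilation_deriv_def z_def field_simps)
qed

text \<open>Each derivative in \<open>y\<close> costs a factor \<open>1 / t\<close>, and the
  \<open>n\<close> derivatives of the coordinates \<open>z \<bullet> b\<close> add up to
  \<open>n * \<kappa> z\<close>. Up to sign the result is the scale derivative of
  \<open>has_derivative_kernel_scale\<close>, which is thereby a divergence in
  \<open>y\<close>.\<close>

lemma sum_partial_deriv_kernel:
  fixes x :: "'a::euclidean_space"
  assumes \<kappa>: "test_function S \<kappa>" and t: "t > 0"
  shows "(\<Sum>b\<in>Basis. partial_deriv b (\<lambda>y. (((y - x) /\<^sub>R t) \<bullet> b) * \<kappa> ((y - x) /\<^sub>R t) / t ^ DIM('a)) y) =
           dilation_deriv \<kappa> ((y - x) /\<^sub>R t) / t ^ (DIM('a) + 1)"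
proof -
  define z where "z = (y - x) /\<^sub>R t"
  have "partial_deriv b (\<lambda>y. (((y - x) /\<^sub>R t) \<bullet> b) * \<kappa> ((y - x) /\<^sub>R t) / t ^ DIM('a)) y =
      (\<kappa> z + (z \<bullet> b) * partial_deriv b \<kappa> z) / t ^ (DIM('a) + 1)" if b: "b \<in> Basis" for b
  proof -
    have 1: "((\<lambda>y. (y - x) /\<^sub>R t) has_derivative (\<lambda>h. h /\<^sub>R t)) (at y)"
      by (auto intro!: derivative_eq_intros)
    have lin: "linear (frechet_derivative \<kappa> (at z))"
      by (rule bounded_linear.linear [OF has_derivative_bounded_linear [OF test_function_has_derivative [OF \<kappa>]]])
    have 2: "((\<lambda>y. \<kappa> ((y - x) /\<^sub>R t)) has_derivative (\<lambda>h. frechet_derivative \<kappa> (at z) h / t)) (at y)"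
      using diff_chain_at [OF 1 test_function_has_derivative [OF \<kappa>]]
      by (simp add: o_def z_def linear_cmul [OF lin [unfolded z_def]] divide_inverse mult.commute)
    have 3: "((\<lambda>y. (((y - x) /\<^sub>R t) \<bullet> b) * \<kappa> ((y - x) /\<^sub>R t) / t ^ DIM('a)) has_derivative
        (\<lambda>h. ((z \<bullet> b) * (frechet_derivative \<kappa> (at z) h / t) + (h \<bullet> b) / t * \<kappa> z) / t ^ DIM('a))) (at y)"
    proof -
      have "((\<lambda>y. ((y - x) /\<^sub>R t) \<bullet> b) has_derivative (\<lambda>h. (h /\<^sub>R t) \<bullet> b)) (at y)"
        by (rule has_derivative_inner_left [OF 1])
      from has_derivative_mult_left [OF has_derivative_mult [OF this 2], of "inverse (t ^ DIM('a))"]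
      show ?thesis by (simp add: z_def divide_inverse mult.commute)
    qed
    show ?thesis
      using b t unfolding partial_deriv_eqI [OF 3]
      by (simp add: partial_deriv_def field_simps)
  qed
  then show ?thesis
    by (simp add: dilation_deriv_def z_def sum.distrib sum_divide_distrib [symmetric])
qed

lemma mollify_has_derivative:
  fixes x :: "'a::euclidean_space"
  assumes u: "\<And>b. b \<in> Basis \<Longrightarrow> weak_partial \<Omega> b u (v b)"
    and \<kappa>: "test_function (ball 0 1) \<kappa>"
    and R: "cball x R \<subseteq> \<Omega>" "0 < t" "t < R"
  shows "((\<lambda>t. mollify \<kappa> \<Omega> u t x) has_real_derivative
            (\<Sum>b\<in>Basis. mollify (\<lambda>z. (z \<bullet> b) * \<kappa> z) \<Omega> (v b) t x)) (at t)"
proof -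
  obtain b0 :: 'a where "b0 \<in> Basis" using nonempty_Basis by blast
  then have li: "locally_integrable \<Omega> u" using u by (auto simp: weak_partial_def)
  \<comment> \<open>The lower end \<open>t / 2\<close> gives a common bound for the powers of
    \<open>1 / s\<close>; the upper end \<open>R\<close> keeps the support of every kernel in
    \<open>cball x R\<close>.\<close>
  define I where "I = {t / 2 <..< R}"
  have sub: "cball x s \<subseteq> \<Omega>" if "s \<le> R" for s using R that by auto
  define f where "f s y = indicator \<Omega> y * (u y * (\<kappa> ((y - x) /\<^sub>R s) / s ^ DIM('a)))" for s y
  define f' where "f' s y = indicator \<Omega> y * (u y * (- (dilation_deriv \<kappa> ((y - x) /\<^sub>R s) / s ^ (DIM('a) + 1))))" for s y
  define \<phi> where "\<phi> b y = (((y - x) /\<^sub>R t) \<bullet> b) * \<kappa> ((y - x) /\<^sub>R t) / t ^ DIM('a)" for b y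
  have tf: "test_function (ball 0 1) (\<lambda>z. (z \<bullet> b) * \<kappa> z)" for b
    by (intro test_function_mult \<kappa> C_k_inner)
  have \<phi>: "test_function \<Omega> (\<phi> b)" for b
    using test_function_kernel [OF tf, of x t \<Omega> b] R sub by (simp add: \<phi>_def [abs_def])
  \<comment> \<open>One minus sign comes from the kernel; the weak derivative identity brings a
    second one, so the final formula has none.\<close>
  have f'_\<phi>: "f' t y = - (\<Sum>b\<in>Basis. indicator \<Omega> y * (u y * partial_deriv b (\<phi> b) y))" for y
    using sum_partial_deriv_kernel [OF \<kappa>, of t x y] R
    by (simp add: \<phi>_def [abs_def] f'_def flip: sum_distrib_left)
  have int: "integrable lebesgue (\<lambda>y. indicator \<Omega> y * (u y * partial_deriv b (\<phi> b) y))" if "b \<in> Basis" for b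
    using set_integrable_mult_test_function [OF li test_function_partial_deriv [OF \<phi> that]]
    by (simp add: set_integrable_def)
  obtain B where B: "B > 0" "\<And>z. \<bar>dilation_deriv \<kappa> z\<bar> \<le> B"
  proof -
    obtain B0 where B0: "B0 > 0" "\<And>z. \<bar>\<kappa> z\<bar> \<le> B0" using test_function_bounded [OF \<kappa>] by blast
    have "\<exists>B. \<forall>z. \<bar>(z \<bullet> b) * partial_deriv b \<kappa> z\<bar> \<le> B" if "b \<in> Basis" for b
      using test_function_bounded [OF test_function_mult [OF test_function_partial_deriv [OF \<kappa> that] C_k_inner]]
      by metis
    then obtain Bb where Bb: "\<And>b z. b \<in> Basis \<Longrightarrow> \<bar>(z \<bullet> b) * partial_deriv b \<kappa> z\<bar> \<le> Bb b" by metis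
    show thesis
    proof (rule that)
      show "\<bar>dilation_deriv \<kappa> z\<bar> \<le> DIM('a) * B0 + (\<Sum>b\<in>Basis. \<bar>Bb b\<bar>)" for z
      proof -
        have "\<bar>\<Sum>b\<in>Basis. (z \<bullet> b) * partial_deriv b \<kappa> z\<bar> \<le> (\<Sum>b\<in>Basis. \<bar>Bb b\<bar>)"
          by (rule order_trans [OF sum_abs]) (intro sum_mono order_trans [OF Bb abs_ge_self])
        moreover have "\<bar>real DIM('a) * \<kappa> z\<bar> \<le> real DIM('a) * B0" using B0 by (simp add: abs_mult)
        ultimately show ?thesis unfolding dilation_deriv_def by linarith
      qed
      show "DIM('a) * B0 + (\<Sum>b\<in>Basis. \<bar>Bb b\<bar>) > 0"
        using B0 by (intro add_pos_nonneg) (auto intro: sum_nonneg)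
    qed
  qed
  have supp: "dilation_deriv \<kappa> ((y - x) /\<^sub>R s) = 0" if "y \<notin> cball x R" "s \<in> I" for y s
  proof -
    have z: "(y - x) /\<^sub>R s \<notin> ball 0 1"
      using that R by (intro rescale_notin_unit_ball) (auto simp: I_def)
    show ?thesis
      using test_function_eq_0 [OF \<kappa> z] test_function_eq_0 [OF test_function_partial_deriv [OF \<kappa>] z]
      by (simp add: dilation_deriv_def)
  qed
  have "((\<lambda>t. LINT y|lebesgue. f t y) has_real_derivative (LINT y|lebesgue. f' t y)) (at t)"
  proof (rule has_real_derivative_integral [where I = I and
        w = "\<lambda>y. \<bar>indicator (cball x R) y *\<^sub>R u y\<bar> * (B / (t / 2) ^ (DIM('a) + 1))"])
    show "t \<in> I" "open I" "convex I" using R by (auto simp: I_def)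
    show "integrable lebesgue (f s)" if "s \<in> I" for s
      using set_integrable_kernel [OF li \<kappa> sub, of s] that R
      by (simp add: set_integrable_def f_def [abs_def] I_def)
    show "((\<lambda>s. f s y) has_real_derivative f' s y) (at s)" if "s \<in> I" for s y
      unfolding f_def f'_def using that R
      by (intro DERIV_cmult has_derivative_kernel_scale [OF \<kappa>]) (auto simp: I_def)
    show "integrable lebesgue (\<lambda>y. \<bar>indicator (cball x R) y *\<^sub>R u y\<bar> * (B / (t / 2) ^ (DIM('a) + 1)))"
      using li R by (intro integrable_mult_left integrable_abs)
        (auto simp: locally_integrable_def set_integrable_def)
    show "\<bar>f' s y\<bar> \<le> \<bar>indicator (cball x R) y *\<^sub>R u y\<bar> * (B / (t / 2) ^ (DIM('a) + 1))" if "s \<in> I" for s y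
    proof (cases "y \<in> cball x R")
      case True
      then have "y \<in> \<Omega>" using R by auto
      have s: "s > 0" "t / 2 \<le> s" using that R by (auto simp: I_def)
      have "\<bar>dilation_deriv \<kappa> ((y - x) /\<^sub>R s)\<bar> / s ^ (DIM('a) + 1) \<le> B / (t / 2) ^ (DIM('a) + 1)"
        using B s R by (intro frac_le power_mono zero_less_power) (auto intro: less_imp_le)
      then have "\<bar>u y\<bar> * (\<bar>dilation_deriv \<kappa> ((y - x) /\<^sub>R s)\<bar> / s ^ (DIM('a) + 1)) \<le> \<bar>u y\<bar> * (B / (t / 2) ^ (DIM('a) + 1))"
        by (intro mult_left_mono) auto
      then show ?thesis using True \<open>y \<in> \<Omega>\<close> s by (simp add: f'_def abs_mult)
    next
      case False
      then show ?thesis using supp [OF False that] by (simp add: f'_def)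
    qed
    show "f' t \<in> borel_measurable lebesgue"
      unfolding f'_\<phi> [abs_def] using int by (intro borel_measurable_uminus borel_measurable_sum) auto
  qed
  moreover have "(LINT y|lebesgue. f' t y) = (\<Sum>b\<in>Basis. mollify (\<lambda>z. (z \<bullet> b) * \<kappa> z) \<Omega> (v b) t x)"
  proof -
    have "(LINT y|lebesgue. f' t y) = - (\<Sum>b\<in>Basis. LINT y|lebesgue. indicator \<Omega> y * (u y * partial_deriv b (\<phi> b) y))"
      unfolding f'_\<phi> by (simp only: integral_minus Bochner_Integration.integral_sum [OF int])
    also have "\<dots> = (\<Sum>b\<in>Basis. - (LINT y:\<Omega>|lebesgue. u y * partial_deriv b (\<phi> b) y))"
      by (simp add: sum_negf set_lebesgue_integral_def)
    also have "\<dots> = (\<Sum>b\<in>Basis. LINT y:\<Omega>|lebesgue. v b y * \<phi> b y)"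
      using u \<phi> by (intro sum.cong) (auto simp: weak_partial_def)
    also have "\<dots> = (\<Sum>b\<in>Basis. mollify (\<lambda>z. (z \<bullet> b) * \<kappa> z) \<Omega> (v b) t x)"
      by (simp add: mollify_def \<phi>_def)
    finally show ?thesis .
  qed
  ultimately show ?thesis
    by (simp add: f_def [abs_def] mollify_def [abs_def] set_lebesgue_integral_def)
qed

section \<open>Bounds by square integrals\<close>

abbreviation energy :: "'a::euclidean_space set \<Rightarrow> ('a \<Rightarrow> real) \<Rightarrow> real" where
  "energy S u \<equiv> LINT y:S|lebesgue. (u y)\<^sup>2"

lemma L2_on_integrable:
  assumes "L2_on \<Omega> u" "S \<subseteq> \<Omega>" "S \<in> lmeasurable"
  shows "set_integrable lebesgue S (\<lambda>x. (u x)\<^sup>2)" "set_integrable lebesgue S u"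
proof -
  have 1: "indicator S x *\<^sub>R (u x)\<^sup>2 = indicator S x *\<^sub>R (indicator \<Omega> x *\<^sub>R (u x)\<^sup>2)"
    "indicator S x *\<^sub>R u x = indicator S x *\<^sub>R (indicator \<Omega> x *\<^sub>R u x)" for x
    using assms(2) by (auto simp: indicator_def)
  have S: "S \<in> sets lebesgue" using assms(3) by blast
  show 2: "set_integrable lebesgue S (\<lambda>x. (u x)\<^sup>2)"
    unfolding set_integrable_def 1(1)
    by (rule integrable_mult_indicator [OF S]) (use assms(1) in \<open>simp add: L2_on_def set_integrable_def\<close>)
  show "set_integrable lebesgue S u"
    unfolding set_integrable_def
  proof (rule Bochner_Integration.integrable_bound)
    show "integrable lebesgue (\<lambda>x. indicator S x + indicator S x *\<^sub>R (u x)\<^sup>2)"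
      using 2 assms(3) by (intro Bochner_Integration.integrable_add)
        (auto simp: set_integrable_def fmeasurable_def)
    show "(\<lambda>x. indicator S x *\<^sub>R u x) \<in> borel_measurable lebesgue"
      unfolding 1(2) by (rule borel_measurable_scaleR)
        (use assms(1) S in \<open>simp_all add: L2_on_def set_borel_measurable_def\<close>)
    have "\<bar>a\<bar> \<le> 1 + a\<^sup>2" for a :: real
      using zero_le_power2 [of "\<bar>a\<bar> - 1"] by (simp add: power2_diff)
    then show "AE x in lebesgue. norm (indicator S x *\<^sub>R u x) \<le> norm (indicator S x + indicator S x *\<^sub>R (u x)\<^sup>2)"
      by (auto simp: indicator_def)
  qed
qed

text \<open>The discriminant argument: the integral of \<open>(\<bar>u x\<bar> - a)\<^sup>2\<close>
  over \<open>S\<close> is a nonnegative quadratic in \<open>a\<close>.\<close>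

lemma L2_on_Cauchy_Schwarz:
  assumes "L2_on \<Omega> u" "S \<subseteq> \<Omega>" "S \<in> lmeasurable"
  shows "(LINT x:S|lebesgue. \<bar>u x\<bar>) \<le> sqrt (measure lebesgue S * (energy S u))"
proof -
  define I where "I = (LINT x:S|lebesgue. \<bar>u x\<bar>)"
  define W where "W = (energy S u)"
  define m where "m = measure lebesgue S"
  have i1: "set_integrable lebesgue S (\<lambda>x. \<bar>u x\<bar>)"
    using L2_on_integrable(2) [OF assms] set_integrable_abs by blast
  note i2 = L2_on_integrable(1) [OF assms]
  have ic: "set_integrable lebesgue S (\<lambda>x. c)" for c :: real
  proof -
    have "integrable lebesgue (indicat_real S)"
      using assms(3) by (intro integrable_real_indicator) (auto simp: fmeasurable_def)
    then show ?thesis by (simp add: set_integrable_def)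
  qed
  have mc: "(LINT x:S|lebesgue. c) = c * m" for c :: real
    using assms(3) by (simp add: set_lebesgue_integral_def m_def fmeasurableD)
  have key: "0 \<le> W - 2 * a * I + a\<^sup>2 * m" for a
  proof -
    note d = set_integral_diff [OF i2 set_integrable_mult_right [OF i1, of "2 * a"]]
    have "0 \<le> (LINT x:S|lebesgue. (\<bar>u x\<bar> - a)\<^sup>2)"
      unfolding set_lebesgue_integral_def by (intro integral_nonneg_AE) auto
    also have "\<dots> = (LINT x:S|lebesgue. ((u x)\<^sup>2 - 2 * a * \<bar>u x\<bar>) + a\<^sup>2)"
      by (simp add: power2_diff algebra_simps)
    also have "\<dots> = W - 2 * a * I + a\<^sup>2 * m"
      using set_integral_add(2) [OF d(1) ic [of "a\<^sup>2"]] d(2) by (simp add: W_def I_def mc)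
    finally show ?thesis .
  qed
  have "I\<^sup>2 \<le> m * W"
  proof (cases "m = 0")
    case True
    have "I \<le> 0"
    proof (rule ccontr)
      assume "\<not> I \<le> 0"
      \<comment> \<open>For \<open>m = 0\<close> the quadratic is linear in \<open>a\<close>, and
        this \<open>a\<close> gives it the value \<open>- 1\<close>.\<close>
      then show False using key [of "(W + 1) / (2 * I)"] True by simp
    qed
    moreover have "I \<ge> 0"
      unfolding I_def set_lebesgue_integral_def by (intro integral_nonneg_AE) auto
    ultimately show ?thesis using True by simp
  next
    case False
    then have "m > 0" by (simp add: m_def order_less_le)
    \<comment> \<open>\<open>I / m\<close> is the minimizer of the quadratic.\<close>
    then show ?thesis using key [of "I / m"]
      by (simp add: power2_eq_square field_simps)
  qed
  then show ?thesis
    unfolding I_def [symmetric] W_def [symmetric] m_def [symmetric] by (rule real_le_rsqrt)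
qed

lemma mollify_abs_le:
  fixes x :: "'a::euclidean_space"
  assumes \<kappa>: "test_function (ball 0 1) \<kappa>" "\<And>z. \<bar>\<kappa> z\<bar> \<le> B"
    and u: "set_integrable lebesgue (cball x t) u" and x: "cball x t \<subseteq> \<Omega>" "t > 0"
  shows "\<bar>mollify \<kappa> \<Omega> u t x\<bar> \<le> B / t ^ DIM('a) * (LINT y:cball x t|lebesgue. \<bar>u y\<bar>)"
proof -
  have B0: "B \<ge> 0" using \<kappa>(2) [of 0] by linarith
  have "norm (mollify \<kappa> \<Omega> u t x) \<le>
      (LINT y|lebesgue. (B / t ^ DIM('a)) * (indicator (cball x t) y *\<^sub>R \<bar>u y\<bar>))"
    unfolding mollify_def set_lebesgue_integral_def
  proof (rule order_trans [OF integral_norm_bound integral_mono])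
    have *: "\<kappa> ((y - x) /\<^sub>R t) = 0" if "y \<notin> cball x t" for y
      by (intro test_function_eq_0 [OF \<kappa>(1)] rescale_notin_unit_ball [OF that x(2)]) simp
    show "integrable lebesgue (\<lambda>y. (B / t ^ DIM('a)) * (indicator (cball x t) y *\<^sub>R \<bar>u y\<bar>))"
      using set_integrable_abs [OF u] by (simp add: set_integrable_def)
    show "integrable lebesgue (\<lambda>y. norm (indicator \<Omega> y *\<^sub>R (u y * (\<kappa> ((y - x) /\<^sub>R t) / t ^ DIM('a)))))"
    proof (rule integrable_norm)
      have "integrable lebesgue (\<lambda>y. (indicator (cball x t) y *\<^sub>R u y) * (\<kappa> ((y - x) /\<^sub>R t) / t ^ DIM('a)))"
        using u \<kappa>(2) x
        by (intro integrable_mult_bounded [where B = "B / t ^ DIM('a)"] continuous_borel_measurable_lebesgue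
            test_function_continuous [OF test_function_kernel [OF \<kappa>(1) x]])
          (auto simp: set_integrable_def divide_right_mono)
      also have "(\<lambda>y. (indicator (cball x t) y *\<^sub>R u y) * (\<kappa> ((y - x) /\<^sub>R t) / t ^ DIM('a))) =
          (\<lambda>y. indicator \<Omega> y *\<^sub>R (u y * (\<kappa> ((y - x) /\<^sub>R t) / t ^ DIM('a))))"
        using * x(1) by (auto simp: fun_eq_iff indicator_def)
      finally show "integrable lebesgue (\<lambda>y. indicator \<Omega> y *\<^sub>R (u y * (\<kappa> ((y - x) /\<^sub>R t) / t ^ DIM('a))))" .
    qed
    show "norm (indicator \<Omega> y *\<^sub>R (u y * (\<kappa> ((y - x) /\<^sub>R t) / t ^ DIM('a)))) \<le>
        (B / t ^ DIM('a)) * (indicator (cball x t) y *\<^sub>R \<bar>u y\<bar>)" for y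
    proof (cases "y \<in> cball x t")
      case True
      then have "y \<in> \<Omega>" using x by auto
      have "\<bar>u y\<bar> * (\<bar>\<kappa> ((y - x) /\<^sub>R t)\<bar> / t ^ DIM('a)) \<le> \<bar>u y\<bar> * (B / t ^ DIM('a))"
        using x \<kappa>(2) by (intro mult_left_mono divide_right_mono) auto
      then show ?thesis using True \<open>y \<in> \<Omega>\<close> x by (simp add: abs_mult mult.commute)
    qed (use * in simp)
  qed
  then show ?thesis by (simp add: set_lebesgue_integral_def)
qed

text \<open>The kernel contributes \<open>1 / t ^ n\<close>, and Cauchy-Schwarz the root of the
  volume of the ball, of order \<open>t powr (n / 2)\<close>. The constant depends on
  \<open>\<kappa>\<close> alone.\<close>

lemma mollify_L2_bound:
  fixes \<kappa> :: "'a::euclidean_space \<Rightarrow> real"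
  assumes \<kappa>: "test_function (ball 0 1) \<kappa>"
  obtains C where "C > 0"
    "\<And>\<Omega> u t x. L2_on \<Omega> u \<Longrightarrow> cball x t \<subseteq> \<Omega> \<Longrightarrow> t > 0 \<Longrightarrow>
        \<bar>mollify \<kappa> \<Omega> u t x\<bar> \<le> C * t powr (- real DIM('a) / 2) * sqrt (energy (cball x t) u)"
proof -
  obtain B where B: "B > 0" "\<And>z. \<bar>\<kappa> z\<bar> \<le> B" using test_function_bounded [OF \<kappa>] by blast
  let ?V = "unit_ball_vol (real DIM('a))"
  show thesis
  proof
    show "B * sqrt ?V > 0" using B by simp
    fix \<Omega> u t and x :: 'a assume u: "L2_on \<Omega> u" and x: "cball x t \<subseteq> \<Omega>" "t > 0"
    let ?W = "energy (cball x t) u"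
    have m: "cball x t \<in> lmeasurable" by (simp add: lmeasurable_cball)
    have "\<bar>mollify \<kappa> \<Omega> u t x\<bar> \<le> B / t ^ DIM('a) * (LINT y:cball x t|lebesgue. \<bar>u y\<bar>)"
      by (rule mollify_abs_le [OF \<kappa> B(2) L2_on_integrable(2) [OF u x(1) m] x])
    also have "\<dots> \<le> B / t ^ DIM('a) * sqrt ((?V * t ^ DIM('a)) * ?W)"
      using L2_on_Cauchy_Schwarz [OF u x(1) m] x B
      by (intro mult_left_mono) (auto simp: content_cball)
    also have "\<dots> = B * sqrt ?V * t powr (- real DIM('a) / 2) * sqrt ?W"
    proof -
      have "t powr (- real DIM('a) / 2) = sqrt (t ^ DIM('a)) / t ^ DIM('a)"
        using x(2) by (simp add: powr_half_sqrt [symmetric] powr_realpow [symmetric] powr_powr powr_diff [symmetric])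
      then show ?thesis by (simp add: real_sqrt_mult)
    qed
    finally show "\<bar>mollify \<kappa> \<Omega> u t x\<bar> \<le> B * sqrt ?V * t powr (- real DIM('a) / 2) * sqrt ?W" .
  qed
qed

text \<open>Both \<open>g - f\<close> and \<open>g + f\<close> are nondecreasing. A derivative bound
  is thus integrated against an explicit antiderivative \<open>g\<close> without measuring or
  integrating \<open>f'\<close>.\<close>

lemma abs_diff_le_of_deriv_bound:
  fixes f g :: "real \<Rightarrow> real"
  assumes "s \<le> t"
    and f: "\<And>r. s \<le> r \<Longrightarrow> r \<le> t \<Longrightarrow> (f has_real_derivative f' r) (at r)"
    and g: "\<And>r. s \<le> r \<Longrightarrow> r \<le> t \<Longrightarrow> (g has_real_derivative g' r) (at r)"
    and le: "\<And>r. s \<le> r \<Longrightarrow> r \<le> t \<Longrightarrow> \<bar>f' r\<bar> \<le> g' r"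
  shows "\<bar>f t - f s\<bar> \<le> g t - g s"
proof -
  have "g s - f s \<le> g t - f t"
    by (rule DERIV_nonneg_imp_nondecreasing [OF assms(1)]) (use DERIV_diff [OF g f] le in fastforce)
  moreover have "g s + f s \<le> g t + f t"
    by (rule DERIV_nonneg_imp_nondecreasing [OF assms(1)]) (use DERIV_add [OF g f] le in fastforce)
  ultimately show ?thesis by linarith
qed

text \<open>The constant is chosen before the domain, the function, the centre and the radius, so
  that one \<open>C\<close> serves at all scales and uniformly in \<open>x\<close>. The gap
  \<open>t < R\<close> is the room in which the scale can vary.\<close>

definition derivative_bound :: "('a::euclidean_space \<Rightarrow> real) \<Rightarrow> real \<Rightarrow> bool" where
  "derivative_bound \<kappa> C \<longleftrightarrow> (\<forall>\<Omega> u v t x R.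
     (\<forall>b\<in>Basis. weak_partial \<Omega> b u (v b) \<and> L2_on \<Omega> (v b)) \<longrightarrow> cball x R \<subseteq> \<Omega> \<longrightarrow> 0 < t \<longrightarrow> t < R \<longrightarrow>
       (\<exists>D. ((\<lambda>t. mollify \<kappa> \<Omega> u t x) has_real_derivative D) (at t) \<and>
         \<bar>D\<bar> \<le> C * t powr (- real DIM('a) / 2) * sqrt (\<Sum>b\<in>Basis. energy (cball x t) (v b))))"

lemma derivative_boundD:
  fixes x :: "'a::euclidean_space"
  assumes "derivative_bound \<kappa> C" "\<And>b. b \<in> Basis \<Longrightarrow> weak_partial \<Omega> b u (v b)" "\<And>b. b \<in> Basis \<Longrightarrow> L2_on \<Omega> (v b)"
    "cball x R \<subseteq> \<Omega>" "0 < t" "t < R"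
  shows "\<exists>D. ((\<lambda>t. mollify \<kappa> \<Omega> u t x) has_real_derivative D) (at t) \<and>
           \<bar>D\<bar> \<le> C * t powr (- real DIM('a) / 2) * sqrt (\<Sum>b\<in>Basis. energy (cball x t) (v b))"
  using assms unfolding derivative_bound_def by blast

lemma derivative_bound_exists:
  fixes \<kappa> :: "'a::euclidean_space \<Rightarrow> real"
  assumes \<kappa>: "test_function (ball 0 1) \<kappa>"
  obtains C where "C > 0" "derivative_bound \<kappa> C"
proof -
  have tf: "test_function (ball 0 1) (\<lambda>z. (z \<bullet> b) * \<kappa> z)" for b
    by (intro test_function_mult \<kappa> C_k_inner)
  have "\<exists>C>0. \<forall>\<Omega> u t x. L2_on \<Omega> u \<longrightarrow> cball x t \<subseteq> \<Omega> \<longrightarrow> t > 0 \<longrightarrow>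
        \<bar>mollify (\<lambda>z. (z \<bullet> b) * \<kappa> z) \<Omega> u t x\<bar> \<le> C * t powr (- real DIM('a) / 2) * sqrt (energy (cball x t) u)" for b
    by (rule mollify_L2_bound [OF tf [of b]]) blast
  then have "\<exists>C. \<forall>b. C b > 0 \<and> (\<forall>\<Omega> u t x. L2_on \<Omega> u \<longrightarrow> cball x t \<subseteq> \<Omega> \<longrightarrow> t > 0 \<longrightarrow>
        \<bar>mollify (\<lambda>z. (z \<bullet> b) * \<kappa> z) \<Omega> u t x\<bar> \<le> C b * t powr (- real DIM('a) / 2) * sqrt (energy (cball x t) u))"
    by (intro choice allI)
  then obtain C where C: "\<And>b. C b > 0" "\<And>b \<Omega> u t x. L2_on \<Omega> u \<Longrightarrow> cball x t \<subseteq> \<Omega> \<Longrightarrow> t > 0 \<Longrightarrow>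
        \<bar>mollify (\<lambda>z. (z \<bullet> b) * \<kappa> z) \<Omega> u t x\<bar> \<le> C b * t powr (- real DIM('a) / 2) * sqrt (energy (cball x t) u)"
    by blast
  show thesis
  proof
    show "sum C Basis > 0" using C by (intro sum_pos) auto
    show "derivative_bound \<kappa> (sum C Basis)"
      unfolding derivative_bound_def
    proof (intro allI impI)
      fix \<Omega> u v t R and x :: 'a
      assume uv: "\<forall>b\<in>Basis. weak_partial \<Omega> b u (v b) \<and> L2_on \<Omega> (v b)" and R: "cball x R \<subseteq> \<Omega>" "0 < t" "t < R"
      then have u: "\<And>b. b \<in> Basis \<Longrightarrow> weak_partial \<Omega> b u (v b)" and v: "\<And>b. b \<in> Basis \<Longrightarrow> L2_on \<Omega> (v b)" by blast+
      let ?W = "\<lambda>b. energy (cball x t) (v b)"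
      have W0: "?W b \<ge> 0" for b
        unfolding set_lebesgue_integral_def by (intro integral_nonneg_AE) auto
      have sub: "cball x t \<subseteq> \<Omega>" using R by auto
      let ?D = "\<Sum>b\<in>Basis. mollify (\<lambda>z. (z \<bullet> b) * \<kappa> z) \<Omega> (v b) t x"
      have "\<bar>?D\<bar> \<le> (\<Sum>b\<in>Basis. C b * t powr (- real DIM('a) / 2) * sqrt (sum ?W Basis))"
      proof (rule order_trans [OF sum_abs sum_mono])
        fix b :: 'a assume b: "b \<in> Basis"
        have "\<bar>mollify (\<lambda>z. (z \<bullet> b) * \<kappa> z) \<Omega> (v b) t x\<bar> \<le> C b * t powr (- real DIM('a) / 2) * sqrt (?W b)"
          by (rule C(2) [OF v [OF b] sub R(2)])
        also have "\<dots> \<le> C b * t powr (- real DIM('a) / 2) * sqrt (sum ?W Basis)"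
          using C(1) [of b] b W0 by (intro mult_left_mono real_sqrt_le_mono member_le_sum) (auto intro: less_imp_le)
        finally show "\<bar>mollify (\<lambda>z. (z \<bullet> b) * \<kappa> z) \<Omega> (v b) t x\<bar> \<le>
            C b * t powr (- real DIM('a) / 2) * sqrt (sum ?W Basis)" .
      qed
      then show "\<exists>D. ((\<lambda>t. mollify \<kappa> \<Omega> u t x) has_real_derivative D) (at t) \<and>
              \<bar>D\<bar> \<le> sum C Basis * t powr (- real DIM('a) / 2) * sqrt (sum ?W Basis)"
        using mollify_has_derivative [OF u \<kappa> R] by (auto simp: sum_distrib_right)
    qed
  qed
qed

section \<open>Identification of the limit of mollifications\<close>

lemma AE_zero_of_box_integrals:
  fixes f :: "'a::euclidean_space \<Rightarrow> real"
  assumes f: "integrable lborel f" and box: "\<And>a b. (LINT x:box a b|lborel. f x) = 0"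
  shows "AE x in lborel. f x = 0"
proof (rule sigma_finite_measure.density_zero [OF lborel.sigma_finite_measure_axioms f])
  have si: "set_integrable lborel A f" if "A \<in> sets borel" for A
    unfolding set_integrable_def by (rule integrable_mult_indicator) (use that f in auto)
  \<comment> \<open>Sets with zero integral form a Dynkin system, and the open boxes are an
    intersection-stable generator of the Borel sets. Complements require the whole space to be such
    a set; it is exhausted by growing boxes.\<close>
  have UNIV0: "(LINT x|lborel. f x) = 0"
  proof -
    let ?B = "\<lambda>n::nat. box (- (real n *\<^sub>R One)) (real n *\<^sub>R One) :: 'a set"
    have "incseq ?B"
      unfolding incseq_def by (intro allI impI subset_box_imp ballI) simp
    then have "(\<lambda>n. LINT x:?B n|lborel. f x) \<longlonglongrightarrow> (LINT x:(\<Union>n. ?B n)|lborel. f x)"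
      by (intro set_integral_cont_up si) auto
    then have "(LINT x:(UNIV :: 'a set)|lborel. f x) = 0"
      unfolding box UN_box_eq_UNIV LIMSEQ_const_iff by simp
    then show ?thesis by (simp add: set_lebesgue_integral_def)
  qed
  have Int_stable: "Int_stable (range (\<lambda>(a, b). box a b :: 'a set))"
    by (auto simp: Int_stable_def box_Int_box)
  have sub: "range (\<lambda>(a, b). box a b :: 'a set) \<subseteq> Pow UNIV" by auto
  fix A :: "'a set" assume "A \<in> sets lborel"
  then have "A \<in> sigma_sets UNIV (range (\<lambda>(a, b). box a b))"
    by (simp add: borel_eq_box)
  then show "(LINT x:A|lborel. f x) = 0"
  proof (induction rule: sigma_sets_induct_disjoint [OF Int_stable sub, consumes 1, case_names basic empty compl union])
    case (basic A)
    then show ?case using box by auto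
  next
    case empty
    then show ?case by (simp add: set_lebesgue_integral_def)
  next
    case (compl A)
    then have A: "A \<in> sets borel" by (simp add: borel_eq_box)
    then have "(LINT x:A \<union> (UNIV - A)|lborel. f x) = (LINT x:A|lborel. f x) + (LINT x:UNIV - A|lborel. f x)"
      by (intro set_integral_Un si) auto
    moreover have "A \<union> (UNIV - A) = UNIV" by auto
    moreover have "(LINT x:(UNIV :: 'a set)|lborel. f x) = 0" using UNIV0 by (simp add: set_lebesgue_integral_def)
    ultimately show ?case using compl.IH by simp
  next
    case (union A)
    then have A: "A i \<in> sets borel" for i by (auto simp: borel_eq_box)
    have "(LINT x:(\<Union>i. A i)|lborel. f x) = (\<Sum>i. LINT x:A i|lborel. f x)"
      using A union(1) by (intro lebesgue_integral_countable_add si)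
        (auto simp: disjoint_family_on_def)
    then show ?case using union by simp
  qed
qed

text \<open>The substitution \<open>x = y - t *\<^sub>R z\<close>, whose Jacobian cancels the
  normalization of the kernel. The reflection arises because the integration is over the centre of
  the kernel.\<close>

lemma integral_reflect_rescale:
  fixes g h :: "'a::euclidean_space \<Rightarrow> real"
  assumes g: "g \<in> borel_measurable borel" and h: "h \<in> borel_measurable borel" and t: "t > 0"
  shows "(LINT x|lborel. g x * (h ((y - x) /\<^sub>R t) / t ^ DIM('a))) = (LINT z|lborel. g (y - t *\<^sub>R z) * h z)"
proof -
  have m: "(\<lambda>x. g x * (h ((y - x) /\<^sub>R t) / t ^ DIM('a))) \<in> borel_measurable borel"
    using g measurable_compose [OF _ h, of "\<lambda>x. (y - x) /\<^sub>R t"]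
    by (intro borel_measurable_times borel_measurable_divide) auto
  have "(LINT x|lborel. g x * (h ((y - x) /\<^sub>R t) / t ^ DIM('a))) =
     (LINT x|density (distr lborel borel (\<lambda>x. y + (- t) *\<^sub>R x)) (\<lambda>_. \<bar>- t\<bar> ^ DIM('a)).
        g x * (h ((y - x) /\<^sub>R t) / t ^ DIM('a)))"
    using t lborel_affine [of "- t" y] by simp
  also have "\<dots> = (LINT x|distr lborel borel (\<lambda>x. y + (- t) *\<^sub>R x).
        \<bar>- t\<bar> ^ DIM('a) *\<^sub>R (g x * (h ((y - x) /\<^sub>R t) / t ^ DIM('a))))"
  proof (rule integral_density)
    show "(\<lambda>x. g x * (h ((y - x) /\<^sub>R t) / t ^ DIM('a))) \<in> borel_measurable (distr lborel borel (\<lambda>x. y + (- t) *\<^sub>R x))"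
      using m by simp
  qed auto
  also have "\<dots> = (LINT z|lborel. \<bar>- t\<bar> ^ DIM('a) *\<^sub>R (g (y + (- t) *\<^sub>R z) *
        (h ((y - (y + (- t) *\<^sub>R z)) /\<^sub>R t) / t ^ DIM('a))))"
    using m by (intro integral_distr borel_measurable_scaleR) auto
  also have "\<dots> = (LINT z|lborel. g (y - t *\<^sub>R z) * h z)"
    using t by simp
  finally show ?thesis .
qed

definition mollifier :: "('a::euclidean_space \<Rightarrow> real) \<Rightarrow> bool" where
  "mollifier \<kappa> \<longleftrightarrow> test_function (ball 0 1) \<kappa> \<and> (\<forall>z. \<kappa> z \<ge> 0) \<and> (LINT z|lborel. \<kappa> z) = 1"

lemma integrable_test_function: "test_function (ball 0 1) \<kappa> \<Longrightarrow> integrable lborel \<kappa>"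
proof -
  assume \<kappa>: "test_function (ball 0 1) \<kappa>"
  have "integrable lborel (\<lambda>x. indicator (cball 0 1) x *\<^sub>R \<kappa> x)"
    using test_function_continuous [OF \<kappa>]
    by (intro borel_integrable_compact) (auto intro: continuous_on_subset)
  also have "(\<lambda>x. indicator (cball 0 1) x *\<^sub>R \<kappa> x) = \<kappa>"
    using test_function_eq_0 [OF \<kappa>] by (auto simp: indicator_def fun_eq_iff)
  finally show ?thesis .
qed

lemma mollifier_exists: obtains \<kappa> :: "'a::euclidean_space \<Rightarrow> real" where "mollifier \<kappa>"
proof -
  define m where "m = (LINT z|lborel. bump (z :: 'a))"
  have int: "integrable lborel (bump :: 'a \<Rightarrow> real)" by (rule integrable_test_function [OF test_function_bump])
  have "m \<noteq> 0"
  proof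
    assume "m = 0"
    then have "AE x in lborel. bump (x :: 'a) = 0"
      using integral_nonneg_eq_0_iff_AE [OF int] bump_nonneg by (auto simp: m_def)
    then have "AE x :: 'a in lborel. x \<notin> ball 0 (1 / 2)"
      by eventually_elim (use bump_pos in fastforce)
    then have "emeasure lborel (ball (0 :: 'a) (1 / 2)) = 0"
      by (subst (asm) AE_iff_measurable) auto
    then show False using content_ball_pos [of "1 / 2" "0 :: 'a"] by (simp add: measure_def)
  qed
  moreover have "m \<ge> 0" unfolding m_def by (intro integral_nonneg_AE) (auto simp: bump_nonneg)
  ultimately have "m > 0" by simp
  have "test_function (ball 0 1) (\<lambda>z :: 'a. (1 / m) * bump z)"
    by (intro test_function_mult test_function_bump C_k_const)
  then have "mollifier (\<lambda>z :: 'a. (1 / m) * bump z)"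
    using \<open>m > 0\<close> int unfolding mollifier_def by (auto simp: m_def [symmetric] bump_nonneg)
  then show thesis by (rule that)
qed

text \<open>Tested on a box, with \<open>D\<close> its intersection with the ball, Fubini moves the
  mollification from \<open>u\<close> to the indicator of \<open>D\<close>. The functions
  \<open>k j\<close> converge to this indicator off the frontier, a null set because
  \<open>D\<close> is convex. Hence \<open>G\<close> and \<open>u\<close> have equal integrals over
  every such \<open>D\<close>; the bound \<open>M\<close> supplies the domination on the side of
  \<open>G\<close>.\<close>

lemma mollify_limit_AE_eq:
  fixes u :: "'a::euclidean_space \<Rightarrow> real"
  assumes \<kappa>: "mollifier \<kappa>"
    and u: "locally_integrable \<Omega> u" and R: "cball x0 (2 * R) \<subseteq> \<Omega>" "R > 0"
    and s: "s \<longlonglongrightarrow> 0" "\<And>k. 0 < s k \<and> s k \<le> R"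
    and lim: "\<And>x. x \<in> cball x0 R \<Longrightarrow> (\<lambda>k. mollify \<kappa> \<Omega> u (s k) x) \<longlonglongrightarrow> G x"
    and bound: "\<And>x k. x \<in> cball x0 R \<Longrightarrow> \<bar>mollify \<kappa> \<Omega> u (s k) x\<bar> \<le> M"
  shows "AE x in lebesgue. x \<in> cball x0 R \<longrightarrow> G x = u x"
proof -
  let ?n = "DIM('a)"
  let ?P = "cball x0 R" and ?P2 = "cball x0 (2 * R)"
  have tf: "test_function (ball 0 1) \<kappa>" and \<kappa>0: "\<And>z. \<kappa> z \<ge> 0" and \<kappa>1: "(LINT z|lborel. \<kappa> z) = 1"
    using \<kappa> by (auto simp: mollifier_def)
  have int\<kappa>: "integrable lborel \<kappa>" by (rule integrable_test_function [OF tf])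
  have [measurable]: "\<kappa> \<in> borel_measurable borel"
    using test_function_continuous [OF tf] by (rule borel_measurable_continuous_onI)
  obtain B where B: "B > 0" "\<And>z. \<bar>\<kappa> z\<bar> \<le> B" using test_function_bounded [OF tf] by blast
  have intu: "integrable lebesgue (\<lambda>y. indicator ?P2 y *\<^sub>R u y)"
    using u R(1) by (auto simp: locally_integrable_def set_integrable_def)
  \<comment> \<open>A Borel representative, since Fubini is applied on products of
    \<open>lborel\<close>. The double ball contains the supports of all kernels with centre in
    \<open>?P\<close> and scale at most \<open>R\<close>.\<close>
  obtain g where g [measurable]: "g \<in> borel_measurable lborel"
    and gu: "AE y in lborel. indicator ?P2 y *\<^sub>R u y = g y"
    using completion_ex_borel_measurable_real [OF borel_measurable_integrable [OF intu]] by blast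
  have gu': "AE y in lebesgue. indicator ?P2 y *\<^sub>R u y = g y"
    using gu by (rule AE_completion)
  have intg: "integrable lborel g"
  proof -
    have "integrable lebesgue g"
      by (rule integrable_cong_AE_imp [OF intu _ gu']) (use g in \<open>intro measurable_completion\<close>)
    then show ?thesis using integrable_completion [of g lborel] g by simp
  qed
  define K where "K k y x = \<kappa> ((y - x) /\<^sub>R s k) / s k ^ ?n" for k y x
  have [measurable]: "(\<lambda>(x, y). K k y x) \<in> borel_measurable (lborel \<Otimes>\<^sub>M lborel)" for k
    unfolding K_def by measurable
  have [measurable]: "(\<lambda>x. K k y x) \<in> borel_measurable borel" "(\<lambda>y. K k y x) \<in> borel_measurable borel" for k x y
    unfolding K_def by measurable
  have K0: "K k y x \<ge> 0" for k y x using \<kappa>0 s(2) [of k] by (simp add: K_def)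
  have KB: "\<bar>K k y x\<bar> \<le> B / s k ^ ?n" for k y x
    using B s(2) [of k] by (simp add: K_def divide_right_mono)
  have intgK: "integrable lborel (\<lambda>y. g y * K k y x)" for k x
    by (rule integrable_mult_bounded [OF intg _ KB]) simp
  have U: "mollify \<kappa> \<Omega> u (s k) x = (LINT y|lborel. g y * K k y x)" if x: "x \<in> ?P" for k x
  proof -
    have "mollify \<kappa> \<Omega> u (s k) x = (LINT y|lebesgue. (indicator ?P2 y *\<^sub>R u y) * K k y x)"
      unfolding mollify_def set_lebesgue_integral_def
    proof (rule Bochner_Integration.integral_cong)
      fix y
      have "K k y x = 0" if "y \<notin> ?P2"
      proof -
        have "y \<notin> cball x (s k)"
        proof
          assume "y \<in> cball x (s k)"
          then have "dist x0 y \<le> R + s k" using x dist_triangle [of x0 y x] by auto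
          then show False using s(2) [of k] that by auto
        qed
        then show ?thesis
          using test_function_eq_0 [OF tf rescale_notin_unit_ball] s(2) [of k] by (fastforce simp: K_def)
      qed
      then show "indicator \<Omega> y *\<^sub>R (u y * (\<kappa> ((y - x) /\<^sub>R s k) / s k ^ ?n)) = (indicator ?P2 y *\<^sub>R u y) * K k y x"
        using R(1) by (auto simp: K_def indicator_def)
    qed simp
    also have "\<dots> = (LINT y|lebesgue. g y * K k y x)"
    proof (rule integral_cong_AE)
      show "(\<lambda>y. g y * K k y x) \<in> borel_measurable lebesgue"
        by (intro measurable_completion) measurable
      have "(\<lambda>y. K k y x) \<in> borel_measurable lebesgue"
        by (intro measurable_completion) measurable
      then show "(\<lambda>y. (indicator ?P2 y *\<^sub>R u y) * K k y x) \<in> borel_measurable lebesgue"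
        using intu by (intro borel_measurable_times) auto
      show "AE y in lebesgue. (indicator ?P2 y *\<^sub>R u y) * K k y x = g y * K k y x"
        using gu' by eventually_elim simp
    qed
    also have "\<dots> = (LINT y|lborel. g y * K k y x)"
      by (rule integral_completion) measurable
    finally show ?thesis .
  qed
  define V where "V k x = (LINT y|lborel. g y * K k y x)" for k x
  have [measurable]: "V k \<in> borel_measurable borel" for k
    unfolding V_def by measurable
  have VP: "(\<lambda>k. V k x) \<longlonglongrightarrow> G x" "\<bar>V k x\<bar> \<le> M" if "x \<in> ?P" for k x
    using lim [OF that] bound [OF that] U [OF that] by (simp_all add: V_def)
  define G' where "G' x = indicator ?P x * G x" for x
  have [measurable]: "G' \<in> borel_measurable borel"
  proof (rule borel_measurable_LIMSEQ_real)
    show "(\<lambda>k. indicator ?P x * V k x) \<longlonglongrightarrow> G' x" for x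
      using VP(1) by (auto simp: G'_def indicator_def)
    show "(\<lambda>x. indicator ?P x * V k x) \<in> borel_measurable borel" for k
      by (intro borel_measurable_times borel_measurable_indicator) auto
  qed
  have intP: "integrable lborel (indicat_real ?P)"
    by (intro integrable_real_indicator emeasure_bounded_finite) auto
  have G'M: "\<bar>G' x\<bar> \<le> M * indicator ?P x" for x
    using LIMSEQ_le_const2 [OF tendsto_rabs [OF VP(1)]] VP(2) by (auto simp: G'_def indicator_def)
  have intG': "integrable lborel G'"
    by (rule Bochner_Integration.integrable_bound [of _ "\<lambda>x. M * indicator ?P x"])
      (use intP G'M in \<open>auto intro: order_trans abs_ge_self\<close>)
  have "AE x in lborel. G' x - indicator ?P x * g x = 0"
  proof (rule AE_zero_of_box_integrals)
    have intPg: "integrable lborel (\<lambda>x. indicator ?P x * g x)"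
      using integrable_mult_indicator [OF _ intg, of ?P] by simp
    then show "integrable lborel (\<lambda>x. G' x - indicator ?P x * g x)" using intG' by simp
    fix a b :: 'a
    define D where "D = box a b \<inter> ?P"
    have [measurable]: "D \<in> sets borel" by (simp add: D_def)
    have bD: "bounded D" "convex D" by (auto simp: D_def convex_Int)
    have intD: "integrable lborel (indicat_real D)"
      by (intro integrable_real_indicator emeasure_bounded_finite bD) auto
    define k where "k j y = (LINT x|lborel. indicator D x * K j y x)" for j y
    have k_eq: "k j y = (LINT z|lborel. indicator D (y - s j *\<^sub>R z) * \<kappa> z)" for j y
      unfolding k_def K_def using s(2) [of j] by (intro integral_reflect_rescale) auto
    have int_shift: "integrable lborel (\<lambda>z. indicator D (y - s j *\<^sub>R z) * \<kappa> z)" for j y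
      by (rule Bochner_Integration.integrable_bound [OF int\<kappa>]) (auto simp: indicator_def)
    have k01: "\<bar>k j y\<bar> \<le> 1" for j y
    proof -
      have "0 \<le> k j y" unfolding k_eq by (intro integral_nonneg_AE) (auto simp: \<kappa>0)
      moreover have "k j y \<le> (LINT z|lborel. \<kappa> z)"
        unfolding k_eq using \<kappa>0 by (intro integral_mono int_shift int\<kappa>) (auto simp: indicator_def)
      ultimately show ?thesis using \<kappa>1 by simp
    qed
    have klim: "(\<lambda>j. k j y) \<longlonglongrightarrow> indicator D y" if "y \<notin> frontier D" for y
    proof -
      have "(\<lambda>j. LINT z|lborel. indicator D (y - s j *\<^sub>R z) * \<kappa> z) \<longlonglongrightarrow> (LINT z|lborel. indicator D y * \<kappa> z)"
      proof (rule integral_dominated_convergence [where w = \<kappa>])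
        show "AE z in lborel. (\<lambda>j. indicator D (y - s j *\<^sub>R z) * \<kappa> z) \<longlonglongrightarrow> indicator D y * \<kappa> z"
        proof (intro AE_I2 tendsto_mult tendsto_const)
          fix z
          have conv: "(\<lambda>j. y - s j *\<^sub>R z) \<longlonglongrightarrow> y"
            using tendsto_diff [OF tendsto_const tendsto_scaleR [OF s(1) tendsto_const], of y z] by simp
          have "isCont (indicat_real D) y"
            using that by (simp add: isCont_indicator)
          then show "(\<lambda>j. indicat_real D (y - s j *\<^sub>R z)) \<longlonglongrightarrow> indicator D y"
            using conv by (rule isCont_tendsto_compose)
        qed
      qed (use int\<kappa> \<kappa>0 in \<open>auto simp: indicator_def\<close>)
      then show ?thesis by (simp add: k_eq \<kappa>1)
    qed
    have Fub: "(LINT x|lborel. indicator D x * V j x) = (LINT y|lborel. g y * k j y)" for j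
    proof -
      have int2: "integrable (lborel \<Otimes>\<^sub>M lborel) (\<lambda>(x, y). indicator D x * (g y * K j y x))"
      proof (rule lborel_pair.Fubini_integrable)
        define c where "c = (LINT y|lborel. \<bar>g y\<bar>) * (B / s j ^ ?n)"
        have "integrable lborel (\<lambda>x. indicator D x * (LINT y|lborel. \<bar>g y * K j y x\<bar>))"
        proof (rule Bochner_Integration.integrable_bound)
          show "integrable lborel (\<lambda>x. c * indicat_real D x)"
            using intD by simp
          have "(LINT y|lborel. \<bar>g y * K j y x\<bar>) \<le> (LINT y|lborel. \<bar>g y\<bar> * (B / s j ^ ?n))" for x
          proof (rule integral_mono)
            show "integrable lborel (\<lambda>y. \<bar>g y * K j y x\<bar>)" using intgK by (rule integrable_abs)
            show "integrable lborel (\<lambda>y. \<bar>g y\<bar> * (B / s j ^ ?n))" using intg by simp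
            show "\<bar>g y * K j y x\<bar> \<le> \<bar>g y\<bar> * (B / s j ^ ?n)" for y
              unfolding abs_mult by (intro mult_left_mono KB) simp
          qed
          then have le: "(LINT y|lborel. \<bar>g y * K j y x\<bar>) \<le> c" for x
            by (simp add: c_def)
          have "0 \<le> (LINT y|lborel. \<bar>g y * K j y x\<bar>)" for x by (intro integral_nonneg_AE) auto
          then show "AE x in lborel. norm (indicator D x * (LINT y|lborel. \<bar>g y * K j y x\<bar>)) \<le>
              norm (c * indicat_real D x)"
            using le by (intro AE_I2) (auto simp: indicator_def intro: order_trans [OF _ abs_ge_self])
        qed measurable
        then show "integrable lborel (\<lambda>x. LINT y|lborel. norm (case (x, y) of (x, y) \<Rightarrow> indicator D x * (g y * K j y x)))"
          by (simp add: abs_mult)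
        show "AE x in lborel. integrable lborel (\<lambda>y. case (x, y) of (x, y) \<Rightarrow> indicator D x * (g y * K j y x))"
          using intgK by simp
      qed measurable
      have "(LINT x|lborel. indicator D x * V j x) = (LINT x|lborel. (LINT y|lborel. indicator D x * (g y * K j y x)))"
        by (simp add: V_def)
      also have "\<dots> = (LINT y|lborel. (LINT x|lborel. indicator D x * (g y * K j y x)))"
        by (rule lborel_pair.Fubini_integral [OF int2, symmetric])
      also have "\<dots> = (LINT y|lborel. g y * k j y)"
        by (simp add: k_def mult.left_commute)
      finally show ?thesis .
    qed
    have "(\<lambda>j. LINT x|lborel. indicator D x * V j x) \<longlonglongrightarrow> (LINT x|lborel. indicator D x * G' x)"
    proof (rule integral_dominated_convergence [where w = "\<lambda>x. M * indicator D x"])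
      show "AE x in lborel. (\<lambda>j. indicator D x * V j x) \<longlonglongrightarrow> indicator D x * G' x"
        using VP(1) by (intro AE_I2) (auto simp: G'_def D_def indicator_def)
      show "AE x in lborel. norm (indicator D x * V j x) \<le> M * indicator D x" for j
        using VP(2) by (intro AE_I2) (auto simp: D_def indicator_def)
    qed (use intD in auto)
    moreover have "(\<lambda>j. LINT y|lborel. g y * k j y) \<longlonglongrightarrow> (LINT y|lborel. g y * indicator D y)"
    proof (rule integral_dominated_convergence [where w = "\<lambda>y. \<bar>g y\<bar>"])
      have "negligible (frontier D)" by (rule negligible_convex_frontier [OF bD(2)])
      moreover have "frontier D \<in> sets lborel" by (simp add: borel_closed)
      ultimately have "frontier D \<in> null_sets lborel"
        by (simp add: negligible_iff_null_sets null_sets_completion_iff)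
      then have "AE y in lborel. y \<notin> frontier D" by (rule AE_not_in)
      then show "AE y in lborel. (\<lambda>j. g y * k j y) \<longlonglongrightarrow> g y * indicator D y"
        by eventually_elim (intro tendsto_mult tendsto_const klim)
      show "AE y in lborel. norm (g y * k j y) \<le> \<bar>g y\<bar>" for j
        using mult_left_mono [OF k01 abs_ge_zero] by (intro AE_I2) (simp add: abs_mult)
      show "(\<lambda>y. g y * k j y) \<in> borel_measurable lborel" for j
        unfolding k_def by measurable
    qed (use intg in auto)
    ultimately have "(LINT x|lborel. indicator D x * G' x) = (LINT y|lborel. g y * indicator D y)"
      unfolding Fub by (rule LIMSEQ_unique)
    moreover have "(LINT x:box a b|lborel. G' x - indicator ?P x * g x) =
        (LINT x|lborel. indicator D x * G' x - g x * indicator D x)"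
      unfolding set_lebesgue_integral_def
      by (intro Bochner_Integration.integral_cong) (auto simp: D_def G'_def indicator_def)
    moreover have "integrable lborel (\<lambda>x. indicator D x * G' x)" "integrable lborel (\<lambda>x. g x * indicator D x)"
      using integrable_mult_indicator [OF _ intG', of D] integrable_mult_indicator [OF _ intg, of D]
      by (simp_all add: mult.commute)
    ultimately show "(LINT x:box a b|lborel. G' x - indicator ?P x * g x) = 0" by simp
  qed
  then have "AE x in lebesgue. G' x - indicator ?P x * g x = 0" by (rule AE_completion)
  with gu' show ?thesis
  proof eventually_elim
    case (elim x)
    have "x \<in> ?P \<Longrightarrow> x \<in> ?P2" using R(2) by auto
    then show ?case using elim by (auto simp: G'_def)
  qed
qed

section \<open>Sobolev embedding\<close>

lemma L2_on_integral_mono: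
  assumes "L2_on \<Omega> u" "S \<subseteq> \<Omega>" "S \<in> lmeasurable"
  shows "(energy S u) \<le> (energy \<Omega> u)"
  unfolding set_lebesgue_integral_def
proof (rule integral_mono)
  show "integrable lebesgue (\<lambda>x. indicator S x *\<^sub>R (u x)\<^sup>2)"
    using L2_on_integrable(1) [OF assms] by (simp add: set_integrable_def)
  show "integrable lebesgue (\<lambda>x. indicator \<Omega> x *\<^sub>R (u x)\<^sup>2)"
    using assms(1) by (simp add: L2_on_def set_integrable_def)
  show "indicator S x *\<^sub>R (u x)\<^sup>2 \<le> indicator \<Omega> x *\<^sub>R (u x)\<^sup>2" for x
    using assms(2) by (auto simp: indicator_def)
qed

lemma sobolev_H_1D:
  assumes "sobolev_H 1 \<Omega> u"
  obtains v where "L2_on \<Omega> u" "\<And>b. b \<in> Basis \<Longrightarrow> weak_partial \<Omega> b u (v b)" "\<And>b. b \<in> Basis \<Longrightarrow> L2_on \<Omega> (v b)"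
proof -
  have "\<forall>b. \<exists>v. b \<in> Basis \<longrightarrow> weak_partial \<Omega> b u v \<and> L2_on \<Omega> v" using assms by simp
  from choice [OF this] show thesis using that assms by auto
qed

lemma sobolev_1_mollify_bound:
  fixes v :: "'a::euclidean_space \<Rightarrow> real"
  assumes \<kappa>: "test_function (ball 0 1) \<kappa>" and n: "DIM('a) \<le> 3" and v: "sobolev_H 1 \<Omega> v"
    and R: "0 < R" "R \<le> 1" "cball x0 (3 * R) \<subseteq> \<Omega>"
  obtains A where "A \<ge> 0"
    "\<And>x t. x \<in> cball x0 R \<Longrightarrow> 0 < t \<Longrightarrow> t \<le> R \<Longrightarrow> \<bar>mollify \<kappa> \<Omega> v t x\<bar> \<le> A * t powr (- 1 / 2)"
proof -
  obtain w where L2v: "L2_on \<Omega> v" and w: "\<And>b. b \<in> Basis \<Longrightarrow> weak_partial \<Omega> b v (w b)"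
    and L2w: "\<And>b. b \<in> Basis \<Longrightarrow> L2_on \<Omega> (w b)" using sobolev_H_1D [OF v] by blast
  obtain C where C: "C > 0" "\<And>\<Omega> u t x. L2_on \<Omega> u \<Longrightarrow> cball x t \<subseteq> \<Omega> \<Longrightarrow> t > 0 \<Longrightarrow>
        \<bar>mollify \<kappa> \<Omega> u t x\<bar> \<le> C * t powr (- real DIM('a) / 2) * sqrt (energy (cball x t) u)"
    using mollify_L2_bound [OF \<kappa>] by blast
  obtain C' where C': "C' > 0" "derivative_bound \<kappa> C'"
    using derivative_bound_exists [OF \<kappa>] by blast
  define W where "W = sqrt (\<Sum>b\<in>Basis. energy \<Omega> (w b))"
  define A0 where "A0 = C' * W"
  define A1 where "A1 = C * R powr (- real DIM('a) / 2) * sqrt (energy \<Omega> v)"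
  have int0: "0 \<le> (energy S u)" for S and u :: "'a \<Rightarrow> real"
    unfolding set_lebesgue_integral_def by (intro integral_nonneg_AE) auto
  have W0: "W \<ge> 0" unfolding W_def by (intro real_sqrt_ge_zero sum_nonneg int0)
  have A: "A0 \<ge> 0" "A1 \<ge> 0" using C C' W0 int0 by (auto simp: A0_def A1_def)
  show thesis
  proof
    show "A1 + 2 * A0 \<ge> 0" using A by simp
    fix x t assume x: "x \<in> cball x0 R" and t: "0 < t" "t \<le> R"
    have sub: "cball x (2 * R) \<subseteq> \<Omega>"
      using x by (intro order_trans [OF _ R(3)]) (simp add: cball_subset_cball_iff dist_commute)
    then have sub': "cball x s \<subseteq> \<Omega>" if "s \<le> R" for s
      using that R(1) by (intro order_trans [OF subset_cball sub]) simp
    have "\<exists>D. ((\<lambda>t. mollify \<kappa> \<Omega> v t x) has_real_derivative D) (at r) \<and> \<bar>D\<bar> \<le> A0 * r powr (- 3 / 2)"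
      if r: "0 < r" "r \<le> R" for r
    proof -
      have "C' * r powr (- real DIM('a) / 2) * sqrt (\<Sum>b\<in>Basis. energy (cball x r) (w b))
          \<le> C' * r powr (- 3 / 2) * W"
        unfolding W_def using C' r R n int0
        by (intro mult_mono mult_left_mono powr_mono' real_sqrt_le_mono sum_mono L2_on_integral_mono L2w sub')
          (auto intro!: sum_nonneg lmeasurable_cball)
      then show ?thesis
        using derivative_boundD [OF C'(2) w L2w sub, of r] r R(1) by (fastforce simp: A0_def mult_ac)
    qed
    then obtain D where D: "\<And>r. 0 < r \<Longrightarrow> r \<le> R \<Longrightarrow> ((\<lambda>t. mollify \<kappa> \<Omega> v t x) has_real_derivative D r) (at r)"
      "\<And>r. 0 < r \<Longrightarrow> r \<le> R \<Longrightarrow> \<bar>D r\<bar> \<le> A0 * r powr (- 3 / 2)" by metis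
    have "\<bar>mollify \<kappa> \<Omega> v R x - mollify \<kappa> \<Omega> v t x\<bar> \<le> (- 2 * A0) * R powr (- 1 / 2) - (- 2 * A0) * t powr (- 1 / 2)"
    proof (rule abs_diff_le_of_deriv_bound [OF t(2), where f' = D])
      show "((\<lambda>r. (- 2 * A0) * r powr (- 1 / 2)) has_real_derivative A0 * r powr (- 3 / 2)) (at r)"
        if "t \<le> r" for r
        using that t by (auto intro!: derivative_eq_intros)
    qed (use D t in auto)
    moreover have "A0 * R powr (- 1 / 2) \<ge> 0" using A by simp
    moreover have "\<bar>mollify \<kappa> \<Omega> v R x\<bar> \<le> A1"
    proof -
      have "\<bar>mollify \<kappa> \<Omega> v R x\<bar> \<le> C * R powr (- real DIM('a) / 2) * sqrt (energy (cball x R) v)"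
        by (rule C(2) [OF L2v sub' R(1)]) simp
      also have "\<dots> \<le> A1" unfolding A1_def using C
        by (intro mult_left_mono real_sqrt_le_mono L2_on_integral_mono L2v sub') (auto simp: lmeasurable_cball)
      finally show ?thesis .
    qed
    ultimately have "\<bar>mollify \<kappa> \<Omega> v t x\<bar> \<le> A1 + 2 * A0 * t powr (- 1 / 2)" by linarith
    \<comment> \<open>Scales are at most one, so the constant \<open>A1\<close> is absorbed by the
      power.\<close>
    moreover have "1 \<le> t powr (- 1 / 2)" using t R powr_mono' [of "- 1 / 2" 0 t] by simp
    then have "A1 * 1 \<le> A1 * t powr (- 1 / 2)" using A by (intro mult_left_mono)
    ultimately show "\<bar>mollify \<kappa> \<Omega> v t x\<bar> \<le> (A1 + 2 * A0) * t powr (- 1 / 2)"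
      by (simp add: algebra_simps)
  qed
qed

text \<open>The weak partials have one square integrable derivative left, so
  \<open>sobolev_1_mollify_bound\<close> applies to each of them with the kernel
  \<open>(z \<bullet> b) * \<kappa> z\<close>. The resulting \<open>r powr (- 1 / 2)\<close> is
  integrable at \<open>0\<close>, with antiderivative \<open>2 * r powr (1 / 2)\<close>.\<close>

lemma sobolev_2_mollify_diff:
  fixes u :: "'a::euclidean_space \<Rightarrow> real"
  assumes \<kappa>: "test_function (ball 0 1) \<kappa>" and n: "DIM('a) \<le> 3" and u: "sobolev_H 2 \<Omega> u"
    and R: "0 < R" "R \<le> 1" "cball x0 (3 * R) \<subseteq> \<Omega>"
  obtains A where "A \<ge> 0"
    "\<And>x s t. x \<in> cball x0 R \<Longrightarrow> 0 < s \<Longrightarrow> s \<le> t \<Longrightarrow> t \<le> R \<Longrightarrow>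
        \<bar>mollify \<kappa> \<Omega> u t x - mollify \<kappa> \<Omega> u s x\<bar> \<le> A * t powr (1 / 2)"
proof -
  have "\<forall>b. \<exists>v. b \<in> Basis \<longrightarrow> weak_partial \<Omega> b u v \<and> sobolev_H 1 \<Omega> v"
    using u by (simp add: numeral_2_eq_2)
  from choice [OF this] obtain v where v: "\<And>b. b \<in> Basis \<Longrightarrow> weak_partial \<Omega> b u (v b)"
    and Hv: "\<And>b. b \<in> Basis \<Longrightarrow> sobolev_H 1 \<Omega> (v b)" by blast
  have "\<forall>b. \<exists>A. b \<in> Basis \<longrightarrow> A \<ge> 0 \<and> (\<forall>x t. x \<in> cball x0 R \<longrightarrow> 0 < t \<longrightarrow> t \<le> R \<longrightarrow>
      \<bar>mollify (\<lambda>z. (z \<bullet> b) * \<kappa> z) \<Omega> (v b) t x\<bar> \<le> A * t powr (- 1 / 2))"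
  proof
    fix b :: 'a
    have tf: "test_function (ball 0 1) (\<lambda>z. (z \<bullet> b) * \<kappa> z)" by (intro test_function_mult \<kappa> C_k_inner)
    show "\<exists>A. b \<in> Basis \<longrightarrow> A \<ge> 0 \<and> (\<forall>x t. x \<in> cball x0 R \<longrightarrow> 0 < t \<longrightarrow> t \<le> R \<longrightarrow>
      \<bar>mollify (\<lambda>z. (z \<bullet> b) * \<kappa> z) \<Omega> (v b) t x\<bar> \<le> A * t powr (- 1 / 2))"
      using sobolev_1_mollify_bound [OF tf n Hv R] by metis
  qed
  from choice [OF this] obtain A where A: "\<And>b. b \<in> Basis \<Longrightarrow> A b \<ge> 0"
    "\<And>b x t. b \<in> Basis \<Longrightarrow> x \<in> cball x0 R \<Longrightarrow> 0 < t \<Longrightarrow> t \<le> R \<Longrightarrow>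
      \<bar>mollify (\<lambda>z. (z \<bullet> b) * \<kappa> z) \<Omega> (v b) t x\<bar> \<le> A b * t powr (- 1 / 2)" by blast
  have A0: "sum A Basis \<ge> 0" using A(1) by (rule sum_nonneg)
  show thesis
  proof
    show "2 * sum A Basis \<ge> 0" using A0 by simp
    fix x s t assume x: "x \<in> cball x0 R" and t: "0 < s" "s \<le> t" "t \<le> R"
    have sub: "cball x (2 * R) \<subseteq> \<Omega>"
      using x by (intro order_trans [OF _ R(3)]) (simp add: cball_subset_cball_iff dist_commute)
    have "\<bar>mollify \<kappa> \<Omega> u t x - mollify \<kappa> \<Omega> u s x\<bar> \<le> (2 * sum A Basis) * t powr (1 / 2) - (2 * sum A Basis) * s powr (1 / 2)"
    proof (rule abs_diff_le_of_deriv_bound [OF t(2)])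
      fix r assume r: "s \<le> r" "r \<le> t"
      show "((\<lambda>t. mollify \<kappa> \<Omega> u t x) has_real_derivative
          (\<Sum>b\<in>Basis. mollify (\<lambda>z. (z \<bullet> b) * \<kappa> z) \<Omega> (v b) r x)) (at r)"
        by (rule mollify_has_derivative [OF v \<kappa> sub]) (use r t R in auto)
      show "((\<lambda>r. (2 * sum A Basis) * r powr (1 / 2)) has_real_derivative sum A Basis * r powr (- 1 / 2)) (at r)"
        using r t by (auto intro!: derivative_eq_intros)
      have "\<bar>\<Sum>b\<in>Basis. mollify (\<lambda>z. (z \<bullet> b) * \<kappa> z) \<Omega> (v b) r x\<bar> \<le> (\<Sum>b\<in>Basis. A b * r powr (- 1 / 2))"
        by (rule order_trans [OF sum_abs sum_mono]) (use A(2) x r t in auto)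
      then show "\<bar>\<Sum>b\<in>Basis. mollify (\<lambda>z. (z \<bullet> b) * \<kappa> z) \<Omega> (v b) r x\<bar> \<le> sum A Basis * r powr (- 1 / 2)"
        by (simp add: sum_distrib_right)
    qed
    moreover have "(2 * sum A Basis) * s powr (1 / 2) \<ge> 0" using A0 by simp
    ultimately show "\<bar>mollify \<kappa> \<Omega> u t x - mollify \<kappa> \<Omega> u s x\<bar> \<le> (2 * sum A Basis) * t powr (1 / 2)"
      by linarith
  qed
qed

lemma test_function_Lipschitz:
  fixes \<kappa> :: "'a::euclidean_space \<Rightarrow> real"
  assumes \<kappa>: "test_function S \<kappa>"
  obtains L where "L \<ge> 0" "\<And>x y. \<bar>\<kappa> x - \<kappa> y\<bar> \<le> L * norm (x - y)"
proof -
  have "\<forall>b. \<exists>B. b \<in> Basis \<longrightarrow> B > 0 \<and> (\<forall>z. \<bar>partial_deriv b \<kappa> z\<bar> \<le> B)"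
    using test_function_bounded [OF test_function_partial_deriv [OF \<kappa>]] by metis
  from choice [OF this] obtain B where B: "\<And>b. b \<in> Basis \<Longrightarrow> B b > 0" "\<And>b z. b \<in> Basis \<Longrightarrow> \<bar>partial_deriv b \<kappa> z\<bar> \<le> B b"
    by blast
  have d: "\<kappa> differentiable (at z)" for z using \<kappa> unfolding test_function_def by (metis C_k.simps(2))
  have B0: "sum B Basis \<ge> 0" using B(1) by (intro sum_nonneg less_imp_le)
  show thesis
  proof
    show "sum B Basis \<ge> 0" by (rule B0)
    fix x y
    have "norm (\<kappa> x - \<kappa> y) \<le> sum B Basis * norm (x - y)"
    proof (rule differentiable_bound [where S = UNIV and f' = "\<lambda>z. frechet_derivative \<kappa> (at z)"])
      show "(\<kappa> has_derivative frechet_derivative \<kappa> (at z)) (at z within UNIV)" for z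
        using test_function_has_derivative [OF \<kappa>] by simp
      show "onorm (frechet_derivative \<kappa> (at z)) \<le> sum B Basis" for z
      proof (rule onorm_bound)
        show "norm (frechet_derivative \<kappa> (at z) h) \<le> sum B Basis * norm h" for h
        proof -
          have "\<bar>frechet_derivative \<kappa> (at z) h\<bar> \<le> (\<Sum>b\<in>Basis. norm h * B b)"
            unfolding frechet_derivative_eq_sum_partial_deriv [OF d]
            by (rule order_trans [OF sum_abs sum_mono])
              (auto simp: abs_mult intro!: mult_mono Basis_le_norm B(2))
          then show ?thesis unfolding sum_distrib_left [symmetric] by (simp only: mult.commute real_norm_def)
        qed
      qed (rule B0)
    qed auto
    then show "\<bar>\<kappa> x - \<kappa> y\<bar> \<le> sum B Basis * norm (x - y)" by simp
  qed
qed

text \<open>The power \<open>t ^ n\<close> is the normalization, and one more \<open>t\<close> comes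
  from rescaling a Lipschitz kernel. \<open>L\<close> is the Lipschitz constant of
  \<open>\<kappa>\<close> times the integral of \<open>\<bar>u y\<bar>\<close> over the double
  ball.\<close>

lemma mollify_Lipschitz:
  fixes u :: "'a::euclidean_space \<Rightarrow> real"
  assumes \<kappa>: "test_function (ball 0 1) \<kappa>" and u: "locally_integrable \<Omega> u"
    and R: "0 < R" "cball x0 (2 * R) \<subseteq> \<Omega>"
  obtains L where "L \<ge> 0"
    "\<And>x x' t. x \<in> cball x0 R \<Longrightarrow> x' \<in> cball x0 R \<Longrightarrow> 0 < t \<Longrightarrow> t \<le> R \<Longrightarrow>
        \<bar>mollify \<kappa> \<Omega> u t x - mollify \<kappa> \<Omega> u t x'\<bar> \<le> L * dist x x' / t ^ (DIM('a) + 1)"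
proof -
  obtain K where K: "K \<ge> 0" "\<And>x y. \<bar>\<kappa> x - \<kappa> y\<bar> \<le> K * norm (x - y)"
    using test_function_Lipschitz [OF \<kappa>] by blast
  let ?P2 = "cball x0 (2 * R)" and ?n = "DIM('a)"
  define I where "I = (LINT y:?P2|lebesgue. \<bar>u y\<bar>)"
  have intP: "integrable lebesgue (\<lambda>y. indicator ?P2 y *\<^sub>R \<bar>u y\<bar>)"
  proof -
    have "set_integrable lebesgue ?P2 u" using u R(2) by (auto simp: locally_integrable_def)
    from set_integrable_abs [OF this] show ?thesis by (simp add: set_integrable_def)
  qed
  have I0: "I \<ge> 0" unfolding I_def set_lebesgue_integral_def by (intro integral_nonneg_AE) auto
  show thesis
  proof
    show "K * I \<ge> 0" using K I0 by simp
    fix x x' t assume x: "x \<in> cball x0 R" "x' \<in> cball x0 R" and t: "0 < t" "t \<le> R"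
    have subP: "cball z t \<subseteq> ?P2" if "z \<in> cball x0 R" for z
      using that t by (simp add: cball_subset_cball_iff dist_commute)
    have int: "integrable lebesgue (\<lambda>y. indicator \<Omega> y *\<^sub>R (u y * (\<kappa> ((y - z) /\<^sub>R t) / t ^ ?n)))"
      if "z \<in> cball x0 R" for z
      using set_integrable_kernel [OF u \<kappa> order_trans [OF subP [OF that] R(2)] t(1)]
      by (simp add: set_integrable_def)
    have "mollify \<kappa> \<Omega> u t x - mollify \<kappa> \<Omega> u t x' =
        (LINT y|lebesgue. indicator \<Omega> y *\<^sub>R (u y * (\<kappa> ((y - x) /\<^sub>R t) / t ^ ?n)) -
            indicator \<Omega> y *\<^sub>R (u y * (\<kappa> ((y - x') /\<^sub>R t) / t ^ ?n)))"
      unfolding mollify_def set_lebesgue_integral_def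
      by (rule Bochner_Integration.integral_diff [symmetric]) (intro int x)+
    also have "norm \<dots> \<le> (LINT y|lebesgue. (K * dist x x' / t ^ (?n + 1)) * (indicator ?P2 y *\<^sub>R \<bar>u y\<bar>))"
    proof (rule order_trans [OF integral_norm_bound integral_mono])
      show "integrable lebesgue (\<lambda>y. norm (indicator \<Omega> y *\<^sub>R (u y * (\<kappa> ((y - x) /\<^sub>R t) / t ^ ?n)) -
            indicator \<Omega> y *\<^sub>R (u y * (\<kappa> ((y - x') /\<^sub>R t) / t ^ ?n))))"
        by (intro integrable_norm Bochner_Integration.integrable_diff int x)
      show "integrable lebesgue (\<lambda>y. (K * dist x x' / t ^ (?n + 1)) * (indicator ?P2 y *\<^sub>R \<bar>u y\<bar>))"
        using intP by simp
      fix y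
      show "norm (indicator \<Omega> y *\<^sub>R (u y * (\<kappa> ((y - x) /\<^sub>R t) / t ^ ?n)) -
            indicator \<Omega> y *\<^sub>R (u y * (\<kappa> ((y - x') /\<^sub>R t) / t ^ ?n))) \<le>
         (K * dist x x' / t ^ (?n + 1)) * (indicator ?P2 y *\<^sub>R \<bar>u y\<bar>)"
      proof (cases "y \<in> ?P2")
        case True
        then have y: "y \<in> \<Omega>" using R(2) by auto
        have "\<bar>\<kappa> ((y - x) /\<^sub>R t) - \<kappa> ((y - x') /\<^sub>R t)\<bar> \<le> K * norm ((y - x) /\<^sub>R t - (y - x') /\<^sub>R t)"
          by (rule K(2))
        also have "(y - x) /\<^sub>R t - (y - x') /\<^sub>R t = (x' - x) /\<^sub>R t" by (simp add: algebra_simps)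
        also have "K * norm ((x' - x) /\<^sub>R t) = K * dist x x' / t"
          using t by (simp add: dist_norm norm_minus_commute divide_inverse)
        finally have "\<bar>u y\<bar> * (\<bar>\<kappa> ((y - x) /\<^sub>R t) - \<kappa> ((y - x') /\<^sub>R t)\<bar> / t ^ ?n) \<le>
            \<bar>u y\<bar> * (K * dist x x' / t / t ^ ?n)"
          using t by (intro mult_left_mono divide_right_mono) auto
        moreover have "norm (indicator \<Omega> y *\<^sub>R (u y * (\<kappa> ((y - x) /\<^sub>R t) / t ^ ?n)) -
            indicator \<Omega> y *\<^sub>R (u y * (\<kappa> ((y - x') /\<^sub>R t) / t ^ ?n))) =
            \<bar>u y\<bar> * (\<bar>\<kappa> ((y - x) /\<^sub>R t) - \<kappa> ((y - x') /\<^sub>R t)\<bar> / t ^ ?n)"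
          using y t by (simp add: right_diff_distrib [symmetric] diff_divide_distrib [symmetric] abs_mult)
        ultimately show ?thesis using True by (simp add: mult.commute)
      next
        case False
        then have "\<kappa> ((y - z) /\<^sub>R t) = 0" if "z \<in> cball x0 R" for z
          using subP [OF that] t
          by (intro test_function_eq_0 [OF \<kappa>] rescale_notin_unit_ball [of y z t t]) auto
        then show ?thesis using x False by simp
      qed
    qed
    also have "\<dots> = K * I * dist x x' / t ^ (?n + 1)"
      by (simp add: I_def set_lebesgue_integral_def mult.commute)
    finally show "\<bar>mollify \<kappa> \<Omega> u t x - mollify \<kappa> \<Omega> u t x'\<bar> \<le> K * I * dist x x' / t ^ (?n + 1)" by simp
  qed
qed

text \<open>Mollifications approach \<open>G\<close> at the rate \<open>t powr (1 / 2)\<close>,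
  while at scale \<open>t\<close> their Lipschitz constant is of order
  \<open>1 / t ^ (n + 1)\<close>. Choosing the scale according to the distance of the two points
  yields the Hoelder bound.\<close>

lemma sobolev_2_continuous_representative:
  fixes u :: "'a::euclidean_space \<Rightarrow> real"
  assumes \<Omega>: "open \<Omega>" and n: "DIM('a) \<le> 3" and u: "sobolev_H 2 \<Omega> u"
  obtains G where "continuous_on \<Omega> G" "AE x in lebesgue. x \<in> \<Omega> \<longrightarrow> G x = u x"
    "\<And>x0. x0 \<in> \<Omega> \<Longrightarrow> \<exists>C r. C \<ge> 0 \<and> r > 0 \<and> (\<forall>x\<in>ball x0 r. \<bar>G x - G x0\<bar> \<le> C * dist x x0 powr (1 / 10))"
proof -
  obtain \<kappa> :: "'a \<Rightarrow> real" where mol: "mollifier \<kappa>" by (rule mollifier_exists)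
  then have \<kappa>: "test_function (ball 0 1) \<kappa>" by (simp add: mollifier_def)
  have L2u: "L2_on \<Omega> u" using u by (simp add: numeral_2_eq_2)
  have li: "locally_integrable \<Omega> u"
    using u SOME_Basis by (auto simp: numeral_2_eq_2 weak_partial_def)
  define U where "U t x = mollify \<kappa> \<Omega> u t x" for t x
  \<comment> \<open>One sequence of scales for all points makes \<open>G\<close> a single global
    function, so that the local almost everywhere identities can be glued.\<close>
  define G where "G x = lim (\<lambda>k. U (1 / real (Suc k)) x)" for x
  have "\<forall>x0. \<exists>R. x0 \<in> \<Omega> \<longrightarrow> 0 < R \<and> R \<le> 1 \<and> cball x0 (3 * R) \<subseteq> \<Omega>"
  proof
    fix x0
    show "\<exists>R. x0 \<in> \<Omega> \<longrightarrow> 0 < R \<and> R \<le> 1 \<and> cball x0 (3 * R) \<subseteq> \<Omega>"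
    proof (cases "x0 \<in> \<Omega>")
      case True
      then obtain e where e: "e > 0" "cball x0 e \<subseteq> \<Omega>" using \<Omega> open_contains_cball by blast
      then have "cball x0 (3 * min 1 (e / 3)) \<subseteq> \<Omega>"
        by (intro order_trans [OF subset_cball e(2)]) auto
      then show ?thesis using e(1) by (intro exI [of _ "min 1 (e / 3)"]) auto
    qed auto
  qed
  from choice [OF this] obtain R where R: "\<And>x0. x0 \<in> \<Omega> \<Longrightarrow> 0 < R x0" "\<And>x0. x0 \<in> \<Omega> \<Longrightarrow> R x0 \<le> 1"
    "\<And>x0. x0 \<in> \<Omega> \<Longrightarrow> cball x0 (3 * R x0) \<subseteq> \<Omega>" by blast
  have local: "(AE x in lebesgue. x \<in> cball x0 (R x0) \<longrightarrow> G x = u x) \<and>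
      (\<exists>C r. C \<ge> 0 \<and> r > 0 \<and> (\<forall>x\<in>ball x0 r. \<bar>G x - G x0\<bar> \<le> C * dist x x0 powr (1 / 10)))"
    if x0: "x0 \<in> \<Omega>" for x0
  proof -
    define \<rho> where "\<rho> = R x0"
    have \<rho>: "0 < \<rho>" "\<rho> \<le> 1" "cball x0 (3 * \<rho>) \<subseteq> \<Omega>" using R [OF x0] by (auto simp: \<rho>_def)
    have \<rho>2: "cball x0 (2 * \<rho>) \<subseteq> \<Omega>" using \<rho> by (intro order_trans [OF subset_cball \<rho>(3)]) simp
    obtain A where A: "A \<ge> 0" "\<And>x s t. x \<in> cball x0 \<rho> \<Longrightarrow> 0 < s \<Longrightarrow> s \<le> t \<Longrightarrow> t \<le> \<rho> \<Longrightarrow>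
        \<bar>U t x - U s x\<bar> \<le> A * t powr (1 / 2)"
      unfolding U_def using sobolev_2_mollify_diff [OF \<kappa> n u \<rho>] by blast
    obtain L where L: "L \<ge> 0" "\<And>x x' t. x \<in> cball x0 \<rho> \<Longrightarrow> x' \<in> cball x0 \<rho> \<Longrightarrow> 0 < t \<Longrightarrow> t \<le> \<rho> \<Longrightarrow>
        \<bar>U t x - U t x'\<bar> \<le> L * dist x x' / t ^ (DIM('a) + 1)"
      unfolding U_def using mollify_Lipschitz [OF \<kappa> li \<rho>(1) \<rho>2] by blast
    obtain N where N: "1 / real (Suc N) \<le> \<rho>"
      using reals_Archimedean [OF \<rho>(1)] by (auto simp: inverse_eq_divide intro: less_imp_le)
    have small: "1 / real (Suc k) \<le> \<rho>" if "k \<ge> N" for k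
    proof -
      have "1 / real (Suc k) \<le> 1 / real (Suc N)" using that by (intro divide_left_mono) auto
      then show ?thesis using N by linarith
    qed
    have Glim: "(\<lambda>k. U (1 / real (Suc k)) x) \<longlonglongrightarrow> G x" if x: "x \<in> cball x0 \<rho>" for x
    proof -
      have "Cauchy (\<lambda>k. U (1 / real (Suc k)) x)"
        unfolding Cauchy_altdef
      proof (intro allI impI)
        fix e :: real assume e: "e > 0"
        have "(\<lambda>k. A * (1 / real (Suc k)) powr (1 / 2)) \<longlonglongrightarrow> A * 0"
          by (intro tendsto_mult tendsto_const tendsto_zero_powrI [OF LIMSEQ_Suc [OF lim_1_over_n]]) auto
        then have "eventually (\<lambda>k. A * (1 / real (Suc k)) powr (1 / 2) < e) sequentially"
          using e by (intro order_tendstoD(2)) auto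
        then obtain M where M: "\<And>k. k \<ge> M \<Longrightarrow> A * (1 / real (Suc k)) powr (1 / 2) < e"
          by (auto simp: eventually_sequentially)
        show "\<exists>M. \<forall>m\<ge>M. \<forall>n>m. dist (U (1 / real (Suc m)) x) (U (1 / real (Suc n)) x) < e"
        proof (intro exI allI impI)
          fix m n assume mn: "m \<ge> max M N" "n > m"
          have "\<bar>U (1 / real (Suc m)) x - U (1 / real (Suc n)) x\<bar> \<le> A * (1 / real (Suc m)) powr (1 / 2)"
            using mn by (intro A(2) x small divide_left_mono) auto
          then show "dist (U (1 / real (Suc m)) x) (U (1 / real (Suc n)) x) < e"
            using M [of m] mn by (simp add: dist_real_def)
        qed
      qed
      then show ?thesis unfolding G_def using Cauchy_convergent_iff convergent_LIMSEQ_iff by blast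
    qed
    have UG: "\<bar>U t x - G x\<bar> \<le> A * t powr (1 / 2)" if x: "x \<in> cball x0 \<rho>" and t: "0 < t" "t \<le> \<rho>" for x t
    proof (rule LIMSEQ_le_const2)
      show "(\<lambda>k. \<bar>U t x - U (1 / real (Suc k)) x\<bar>) \<longlonglongrightarrow> \<bar>U t x - G x\<bar>"
        by (intro tendsto_intros Glim x)
      obtain M where M: "1 / real (Suc M) \<le> t"
        using reals_Archimedean [OF t(1)] by (auto simp: inverse_eq_divide intro: less_imp_le)
      have "\<bar>U t x - U (1 / real (Suc k)) x\<bar> \<le> A * t powr (1 / 2)" if "k \<ge> M" for k
      proof (rule A(2) [OF x])
        have "1 / real (Suc k) \<le> 1 / real (Suc M)" using that by (intro divide_left_mono) auto
        then show "1 / real (Suc k) \<le> t" using M by linarith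
      qed (use t in auto)
      then show "\<exists>M. \<forall>k\<ge>M. \<bar>U t x - U (1 / real (Suc k)) x\<bar> \<le> A * t powr (1 / 2)" by blast
    qed
    have "AE x in lebesgue. x \<in> cball x0 \<rho> \<longrightarrow> G x = u x"
    proof (rule mollify_limit_AE_eq [OF mol li \<rho>2 \<rho>(1)])
      show "(\<lambda>k. 1 / real (Suc (k + N))) \<longlonglongrightarrow> 0"
        by (rule LIMSEQ_ignore_initial_segment [OF LIMSEQ_Suc [OF lim_1_over_n]])
      show "0 < 1 / real (Suc (k + N)) \<and> 1 / real (Suc (k + N)) \<le> \<rho>" for k
        using small [of "k + N"] by simp
      show "(\<lambda>k. mollify \<kappa> \<Omega> u (1 / real (Suc (k + N))) x) \<longlonglongrightarrow> G x" if "x \<in> cball x0 \<rho>" for x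
        using LIMSEQ_ignore_initial_segment [OF Glim [OF that], of N] by (simp add: U_def)
      show "\<bar>mollify \<kappa> \<Omega> u (1 / real (Suc (k + N))) x\<bar> \<le>
          \<bar>U \<rho> x0\<bar> + L * \<rho> / \<rho> ^ (DIM('a) + 1) + A * \<rho> powr (1 / 2)" if x: "x \<in> cball x0 \<rho>" for x k
      proof -
        have "\<bar>U \<rho> x - U (1 / real (Suc (k + N))) x\<bar> \<le> A * \<rho> powr (1 / 2)"
          by (intro A(2) x small) auto
        moreover have "\<bar>U \<rho> x - U \<rho> x0\<bar> \<le> L * dist x x0 / \<rho> ^ (DIM('a) + 1)"
          using \<rho> by (intro L(2) x) auto
        moreover have "\<dots> \<le> L * \<rho> / \<rho> ^ (DIM('a) + 1)"
          using L x \<rho> by (intro divide_right_mono mult_left_mono) (auto simp: dist_commute)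
        ultimately show ?thesis unfolding U_def by linarith
      qed
    qed
    moreover have "\<bar>G x - G x0\<bar> \<le> (2 * A + L) * dist x x0 powr (1 / 10)" if x: "x \<in> ball x0 (\<rho> ^ 5)" for x
    proof (cases "x = x0")
      case False
      define d where "d = dist x x0"
      \<comment> \<open>With \<open>t ^ 5 = d\<close> and \<open>n + 1 \<le> 4\<close> the Lipschitz
        error is at most \<open>L * d / t ^ 4 = L * t\<close>, hence at most of the order
        \<open>t powr (1 / 2) = d powr (1 / 10)\<close> of the approximation error. The radius
        \<open>\<rho> ^ 5\<close> ensures \<open>t \<le> \<rho>\<close>.\<close>
      define t where "t = d powr (1 / 5)"
      have d: "0 < d" "d < \<rho> ^ 5" using x False by (auto simp: d_def dist_commute)
      have "\<rho> ^ 5 \<le> \<rho> ^ 1" using \<rho> by (intro power_decreasing) auto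
      then have xP: "x \<in> cball x0 \<rho>" using d by (simp add: d_def dist_commute)
      have t5: "t ^ 5 = d" using d by (simp add: t_def powr_power)
      have t0: "t > 0" using d by (simp add: t_def)
      have t\<rho>: "t \<le> \<rho>"
      proof (rule ccontr)
        assume "\<not> t \<le> \<rho>"
        then have "\<rho> ^ 5 \<le> t ^ 5" using \<rho> by (intro power_mono) auto
        then show False using t5 d by simp
      qed
      have "L * d / t ^ (DIM('a) + 1) \<le> L * d / t ^ 4"
        using L d t0 t\<rho> \<rho> n by (intro divide_left_mono power_decreasing) auto
      also have "\<dots> = L * t" using t0 by (simp add: t5 [symmetric] field_simps power_numeral_reduce)
      also have "\<dots> \<le> L * t powr (1 / 2)"
        using powr_mono' [of "1 / 2" 1 t] t0 t\<rho> \<rho> L by (intro mult_left_mono) auto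
      finally have Lt: "L * d / t ^ (DIM('a) + 1) \<le> L * t powr (1 / 2)" .
      have "\<bar>U t x - G x\<bar> \<le> A * t powr (1 / 2)" "\<bar>U t x0 - G x0\<bar> \<le> A * t powr (1 / 2)"
        using UG xP t0 t\<rho> \<rho> by auto
      moreover have "\<bar>U t x - U t x0\<bar> \<le> L * d / t ^ (DIM('a) + 1)"
        unfolding d_def using \<rho> t0 t\<rho> by (intro L(2) xP) auto
      ultimately have "\<bar>G x - G x0\<bar> \<le> (2 * A + L) * t powr (1 / 2)"
        using Lt by (simp add: algebra_simps)
      then show ?thesis by (simp add: t_def powr_powr d_def)
    qed simp
    ultimately show ?thesis
      using A(1) L(1) \<rho> unfolding \<rho>_def [symmetric]
      by (intro conjI exI [of _ "2 * A + L"] exI [of _ "\<rho> ^ 5"]) auto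
  qed
  show thesis
  proof
    show "\<exists>C r. C \<ge> 0 \<and> r > 0 \<and> (\<forall>x\<in>ball x0 r. \<bar>G x - G x0\<bar> \<le> C * dist x x0 powr (1 / 10))"
      if "x0 \<in> \<Omega>" for x0 using local [OF that] by blast
    show "continuous_on \<Omega> G"
      unfolding continuous_on_eq_continuous_at [OF \<Omega>]
    proof
      fix x0 assume "x0 \<in> \<Omega>"
      then obtain C r where C: "r > 0" "\<And>x. x \<in> ball x0 r \<Longrightarrow> \<bar>G x - G x0\<bar> \<le> C * dist x x0 powr (1 / 10)"
        using local by blast
      have "((\<lambda>x. G x - G x0) \<longlongrightarrow> 0) (at x0)"
      proof (rule Lim_null_comparison)
        show "\<forall>\<^sub>F x in at x0. norm (G x - G x0) \<le> C * dist x x0 powr (1 / 10)"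
          using C by (auto simp: eventually_at dist_commute intro!: exI [of _ r])
        have "((\<lambda>x. C * dist x x0 powr (1 / 10)) \<longlongrightarrow> C * 0) (at x0)"
          by (intro tendsto_mult tendsto_const tendsto_zero_powrI)
            (auto intro!: tendsto_eq_intros)
        then show "((\<lambda>x. C * dist x x0 powr (1 / 10)) \<longlongrightarrow> 0) (at x0)" by simp
      qed
      then show "isCont G x0" unfolding isCont_def by (simp add: LIM_zero_iff)
    qed
    show "AE x in lebesgue. x \<in> \<Omega> \<longrightarrow> G x = u x"
    proof -
      \<comment> \<open>Countably many of the balls cover the domain, so the union of their
        exceptional sets is still null.\<close>
      obtain F where F: "F \<subseteq> (\<lambda>x. ball x (R x)) ` \<Omega>" "countable F" "\<Union>F = \<Union>((\<lambda>x. ball x (R x)) ` \<Omega>)"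
        by (rule Lindelof [of "(\<lambda>x. ball x (R x)) ` \<Omega>"]) auto
      have "\<forall>B\<in>F. AE x in lebesgue. x \<in> B \<longrightarrow> G x = u x"
      proof
        fix B assume "B \<in> F"
        then obtain x0 where x0: "x0 \<in> \<Omega>" "B = ball x0 (R x0)" using F(1) by blast
        have "AE x in lebesgue. x \<in> cball x0 (R x0) \<longrightarrow> G x = u x" using local [OF x0(1)] by blast
        then show "AE x in lebesgue. x \<in> B \<longrightarrow> G x = u x" by eventually_elim (use x0(2) in auto)
      qed
      then have "AE x in lebesgue. \<forall>B\<in>F. x \<in> B \<longrightarrow> G x = u x"
        by (simp only: AE_ball_countable [OF F(2)])
      then show ?thesis
      proof eventually_elim
        case (elim x)
        have "x \<in> \<Union>F" if "x \<in> \<Omega>" using that R(1) unfolding F(3) by force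
        then show ?case using elim by auto
      qed
    qed
  qed
qed

section \<open>Singular sets of Sobolev functions\<close>

lemma set_integral_L2_sum:
  fixes v :: "'a::euclidean_space \<Rightarrow> 'a \<Rightarrow> real"
  assumes v: "\<And>b. b \<in> Basis \<Longrightarrow> L2_on \<Omega> (v b)" and S: "S \<subseteq> \<Omega>" "S \<in> lmeasurable"
  shows "set_integrable lebesgue S (\<lambda>y. \<Sum>b\<in>Basis. (v b y)\<^sup>2)"
    and "(LINT y:S|lebesgue. \<Sum>b\<in>Basis. (v b y)\<^sup>2) = (\<Sum>b\<in>Basis. energy S (v b))"
proof -
  have int: "integrable lebesgue (\<lambda>y. indicator S y *\<^sub>R (v b y)\<^sup>2)" if "b \<in> Basis" for b
    using L2_on_integrable(1) [OF v [OF that] S] by (simp add: set_integrable_def)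
  show "set_integrable lebesgue S (\<lambda>y. \<Sum>b\<in>Basis. (v b y)\<^sup>2)"
    unfolding set_integrable_def scaleR_sum_right by (intro Bochner_Integration.integrable_sum int)
  show "(LINT y:S|lebesgue. \<Sum>b\<in>Basis. (v b y)\<^sup>2) = (\<Sum>b\<in>Basis. energy S (v b))"
    unfolding set_lebesgue_integral_def scaleR_sum_right by (intro Bochner_Integration.integral_sum int)
qed

text \<open>The closed balls shrink to the null set \<open>{x}\<close>, and the integral is
  continuous along decreasing sequences; nonnegativity of \<open>f\<close> then passes from the
  radii \<open>R / (k + 1)\<close> to all smaller ones.\<close>

lemma set_integral_small_ball:
  fixes f :: "'a::euclidean_space \<Rightarrow> real"
  assumes f: "set_integrable lebesgue (cball x R) f" "\<And>y. f y \<ge> 0" and R: "R > 0" and \<epsilon>: "\<epsilon> > 0"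
  obtains \<delta> where "0 < \<delta>" "\<delta> \<le> R" "\<And>t. 0 < t \<Longrightarrow> t \<le> \<delta> \<Longrightarrow> (LINT y:cball x t|lebesgue. f y) < \<epsilon>"
proof -
  define B where "B k = cball x (R / real (Suc k))" for k
  have Int: "(\<Inter>k. B k) = {x}"
  proof -
    have "y = x" if "y \<in> (\<Inter>k. B k)" for y
    proof -
      have y: "dist x y \<le> R * (1 / real (Suc k))" for k
        using that by (auto simp: B_def simp del: of_nat_Suc)
      have "(\<lambda>k. R * (1 / real (Suc k))) \<longlonglongrightarrow> R * 0"
        by (intro tendsto_mult tendsto_const LIMSEQ_Suc [OF lim_1_over_n])
      then have "dist x y \<le> R * 0" by (rule LIMSEQ_le_const) (use y in blast)
      then show ?thesis by simp
    qed
    moreover have "x \<in> B k" for k using R by (simp add: B_def)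
    ultimately show ?thesis by blast
  qed
  have "(\<lambda>k. LINT y:B k|lebesgue. f y) \<longlonglongrightarrow> (LINT y:(\<Inter>k. B k)|lebesgue. f y)"
  proof (rule set_integral_cont_down)
    show "decseq B" unfolding decseq_def B_def using R
      by (intro allI impI subset_cball divide_left_mono) auto
  qed (use f(1) in \<open>auto simp: B_def\<close>)
  also have "(LINT y:(\<Inter>k. B k)|lebesgue. f y) = 0"
  proof -
    have "AE y in lebesgue. y \<noteq> x"
      using AE_not_in [of "{x}" lebesgue] by (simp add: negligible_iff_null_sets [symmetric])
    then have "AE y in lebesgue. indicator {x} y *\<^sub>R f y = 0" by eventually_elim simp
    then show ?thesis unfolding Int set_lebesgue_integral_def by (rule integral_eq_zero_AE)
  qed
  finally have "\<forall>\<^sub>F k in sequentially. (LINT y:B k|lebesgue. f y) < \<epsilon>"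
    using \<epsilon> by (rule order_tendstoD(2))
  then obtain k where k: "(LINT y:B k|lebesgue. f y) < \<epsilon>" by (auto simp: eventually_sequentially)
  have int: "integrable lebesgue (\<lambda>y. indicator (cball x t) y *\<^sub>R f y)" if "t \<le> R" for t
    using set_integrable_subset [OF f(1), of "cball x t"] that
    by (simp add: set_integrable_def subset_cball)
  show thesis
  proof (rule that [of "R / real (Suc k)"])
    show kR: "R / real (Suc k) \<le> R" using R by (simp add: divide_le_eq)
    fix t assume t: "0 < t" "t \<le> R / real (Suc k)"
    have "(LINT y:cball x t|lebesgue. f y) \<le> (LINT y:B k|lebesgue. f y)"
      unfolding set_lebesgue_integral_def B_def
    proof (rule integral_mono)
      show "indicator (cball x t) y *\<^sub>R f y \<le> indicator (cball x (R / real (Suc k))) y *\<^sub>R f y" for y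
        using t f(2) [of y] by (auto simp: indicator_def simp del: of_nat_Suc)
    qed (use t kR in \<open>intro int; linarith\<close>)+
    then show "(LINT y:cball x t|lebesgue. f y) < \<epsilon>" using k by simp
  qed (use R in simp)
qed

text \<open>In dimension two the derivative bound is \<open>C' / r\<close> times the root of the
  energy on \<open>cball x r\<close>, and this energy tends to \<open>0\<close>. Below the scale at
  which it is less than \<open>(\<epsilon> / C')\<^sup>2\<close> the derivative is at most
  \<open>\<epsilon> / r\<close>.\<close>

lemma mollify_log_growth:
  fixes u :: "'a::euclidean_space \<Rightarrow> real"
  assumes \<kappa>: "test_function (ball 0 1) \<kappa>" and n: "DIM('a) = 2"
    and v: "\<And>b. b \<in> Basis \<Longrightarrow> weak_partial \<Omega> b u (v b)" "\<And>b. b \<in> Basis \<Longrightarrow> L2_on \<Omega> (v b)"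
    and x: "cball x R \<subseteq> \<Omega>" "R > 0" and \<epsilon>: "\<epsilon> > 0"
  obtains C \<delta> where "\<delta> > 0" "\<And>t. 0 < t \<Longrightarrow> t \<le> \<delta> \<Longrightarrow> \<bar>mollify \<kappa> \<Omega> u t x\<bar> \<le> C + \<epsilon> * ln (1 / t)"
proof -
  obtain C' where C': "C' > 0" "derivative_bound \<kappa> C'"
    using derivative_bound_exists [OF \<kappa>] by blast
  have m: "cball x t \<in> lmeasurable" for t by (simp add: lmeasurable_cball)
  obtain \<delta>0 where \<delta>0: "0 < \<delta>0" "\<delta>0 \<le> R"
    "\<And>t. 0 < t \<Longrightarrow> t \<le> \<delta>0 \<Longrightarrow> (LINT y:cball x t|lebesgue. \<Sum>b\<in>Basis. (v b y)\<^sup>2) < (\<epsilon> / C')\<^sup>2"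
  proof (rule set_integral_small_ball)
    show "set_integrable lebesgue (cball x R) (\<lambda>y. \<Sum>b\<in>Basis. (v b y)\<^sup>2)"
      by (rule set_integral_L2_sum(1)) (use v(2) x(1) m in auto)
    show "(\<epsilon> / C')\<^sup>2 > 0" using \<epsilon> C' by simp
  qed (use x in \<open>auto intro: sum_nonneg\<close>)
  define \<delta> where "\<delta> = \<delta>0 / 2"
  have \<delta>: "0 < \<delta>" "\<delta> < R" using \<delta>0 by (auto simp: \<delta>_def)
  have "\<exists>D. ((\<lambda>t. mollify \<kappa> \<Omega> u t x) has_real_derivative D) (at r) \<and> \<bar>D\<bar> \<le> \<epsilon> * (1 / r)"
    if r: "0 < r" "r \<le> \<delta>" for r
  proof -
    have "cball x r \<subseteq> \<Omega>" using r \<delta> by (intro order_trans [OF subset_cball x(1)]) auto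
    then have "(LINT y:cball x r|lebesgue. \<Sum>b\<in>Basis. (v b y)\<^sup>2) = (\<Sum>b\<in>Basis. energy (cball x r) (v b))"
      by (intro set_integral_L2_sum(2) [where \<Omega> = \<Omega>] m) (use v(2) in auto)
    then have "(\<Sum>b\<in>Basis. energy (cball x r) (v b)) < (\<epsilon> / C')\<^sup>2"
      using \<delta>0(3) [of r] r by (simp add: \<delta>_def)
    then have "sqrt (\<Sum>b\<in>Basis. energy (cball x r) (v b)) \<le> sqrt ((\<epsilon> / C')\<^sup>2)"
      by (intro real_sqrt_le_mono less_imp_le)
    also have "\<dots> = \<epsilon> / C'" using \<epsilon> C' by simp
    finally have "C' * r powr (- real DIM('a) / 2) * sqrt (\<Sum>b\<in>Basis. energy (cball x r) (v b))
        \<le> C' * r powr (- real DIM('a) / 2) * (\<epsilon> / C')"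
      using C' by (intro mult_left_mono) auto
    also have "\<dots> = \<epsilon> * (1 / r)" using C' r by (simp add: n powr_minus_divide)
    finally show ?thesis using derivative_boundD [OF C'(2) v x(1), of r] r \<delta> by fastforce
  qed
  then obtain D where D: "\<And>r. 0 < r \<Longrightarrow> r \<le> \<delta> \<Longrightarrow> ((\<lambda>t. mollify \<kappa> \<Omega> u t x) has_real_derivative D r) (at r)"
    "\<And>r. 0 < r \<Longrightarrow> r \<le> \<delta> \<Longrightarrow> \<bar>D r\<bar> \<le> \<epsilon> * (1 / r)" by metis
  show thesis
  proof (rule that [OF \<delta>(1)])
    fix t assume t: "0 < t" "t \<le> \<delta>"
    have "\<bar>mollify \<kappa> \<Omega> u \<delta> x - mollify \<kappa> \<Omega> u t x\<bar> \<le> \<epsilon> * ln \<delta> - \<epsilon> * ln t"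
    proof (rule abs_diff_le_of_deriv_bound [OF t(2), where f' = D])
      show "((\<lambda>r. \<epsilon> * ln r) has_real_derivative \<epsilon> * (1 / r)) (at r)" if "t \<le> r" for r
        using that t by (auto intro!: derivative_eq_intros)
    qed (use D t in auto)
    moreover have "ln (1 / t) = - ln t" using t by (simp add: ln_div)
    ultimately show "\<bar>mollify \<kappa> \<Omega> u t x\<bar> \<le> (\<bar>mollify \<kappa> \<Omega> u \<delta> x\<bar> + \<epsilon> * ln \<delta>) + \<epsilon> * ln (1 / t)"
      by (simp add: algebra_simps)
  qed
qed

text \<open>If the energy stayed below \<open>A * t powr s\<close> at all small scales, the
  derivative bound would be \<open>B * r powr (p - 1)\<close> with
  \<open>2 * p = s - (n - 2) > 0\<close>. This is integrable at \<open>0\<close>, and the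
  mollifications at \<open>x\<close> would stay bounded.\<close>

lemma energy_concentrates:
  fixes u :: "'a::euclidean_space \<Rightarrow> real"
  assumes \<kappa>: "test_function (ball 0 1) \<kappa>"
    and v: "\<And>b. b \<in> Basis \<Longrightarrow> weak_partial \<Omega> b u (v b)" "\<And>b. b \<in> Basis \<Longrightarrow> L2_on \<Omega> (v b)"
    and x: "cball x R \<subseteq> \<Omega>" "R > 0" and s: "s > real DIM('a) - 2"
    and unbounded: "\<And>K \<delta>. \<delta> > 0 \<Longrightarrow> \<exists>t. 0 < t \<and> t < \<delta> \<and> \<bar>mollify \<kappa> \<Omega> u t x\<bar> > K"
    and \<delta>: "\<delta> > 0" and A: "A > 0"
  shows "\<exists>t. 0 < t \<and> t < \<delta> \<and> cball x t \<subseteq> \<Omega> \<and> A * t powr s < (LINT y:cball x t|lebesgue. \<Sum>b\<in>Basis. (v b y)\<^sup>2)"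
proof (rule ccontr)
  assume neg: "\<not> ?thesis"
  obtain C' where C': "C' > 0" "derivative_bound \<kappa> C'"
    using derivative_bound_exists [OF \<kappa>] by blast
  have m: "cball x t \<in> lmeasurable" for t by (simp add: lmeasurable_cball)
  define \<rho> where "\<rho> = min (\<delta> / 2) (R / 2)"
  have \<rho>: "0 < \<rho>" "\<rho> < \<delta>" "\<rho> < R" using \<delta> x(2) by (auto simp: \<rho>_def)
  define p where "p = (s - (real DIM('a) - 2)) / 2"
  have p: "p > 0" using s by (simp add: p_def)
  define B where "B = C' * sqrt A"
  have B: "B > 0" using C' A by (simp add: B_def)
  have "\<exists>D. ((\<lambda>t. mollify \<kappa> \<Omega> u t x) has_real_derivative D) (at r) \<and> \<bar>D\<bar> \<le> B * r powr (p - 1)"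
    if r: "0 < r" "r \<le> \<rho>" for r
  proof -
    have sub: "cball x r \<subseteq> \<Omega>" using r \<rho> by (intro order_trans [OF subset_cball x(1)]) auto
    then have "(LINT y:cball x r|lebesgue. \<Sum>b\<in>Basis. (v b y)\<^sup>2) \<le> A * r powr s"
      using neg r \<rho> by (meson dual_order.strict_trans1 linorder_not_le)
    moreover have "(LINT y:cball x r|lebesgue. \<Sum>b\<in>Basis. (v b y)\<^sup>2) = (\<Sum>b\<in>Basis. energy (cball x r) (v b))"
      by (intro set_integral_L2_sum(2) [where \<Omega> = \<Omega>] sub m) (use v(2) in auto)
    ultimately have "(\<Sum>b\<in>Basis. energy (cball x r) (v b)) \<le> A * r powr s"
      by simp
    then have "sqrt (\<Sum>b\<in>Basis. energy (cball x r) (v b)) \<le> sqrt (A * r powr s)"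
      by (rule real_sqrt_le_mono)
    also have "\<dots> = sqrt A * r powr (s / 2)"
      using r by (simp add: real_sqrt_mult powr_half_sqrt [symmetric] powr_powr)
    finally have "C' * r powr (- real DIM('a) / 2) * sqrt (\<Sum>b\<in>Basis. energy (cball x r) (v b))
        \<le> C' * r powr (- real DIM('a) / 2) * (sqrt A * r powr (s / 2))"
      using C' by (intro mult_left_mono) auto
    also have "\<dots> = B * (r powr (- real DIM('a) / 2) * r powr (s / 2))" by (simp add: B_def)
    also have "r powr (- real DIM('a) / 2) * r powr (s / 2) = r powr (p - 1)"
      unfolding powr_add [symmetric] p_def by (simp add: field_simps)
    finally show ?thesis using derivative_boundD [OF C'(2) v x(1), of r] r \<rho> by fastforce
  qed
  then obtain D where D: "\<And>r. 0 < r \<Longrightarrow> r \<le> \<rho> \<Longrightarrow> ((\<lambda>t. mollify \<kappa> \<Omega> u t x) has_real_derivative D r) (at r)"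
    "\<And>r. 0 < r \<Longrightarrow> r \<le> \<rho> \<Longrightarrow> \<bar>D r\<bar> \<le> B * r powr (p - 1)" by metis
  obtain t where t: "0 < t" "t < \<rho>" "\<bar>mollify \<kappa> \<Omega> u t x\<bar> > \<bar>mollify \<kappa> \<Omega> u \<rho> x\<bar> + B / p * \<rho> powr p"
    using unbounded [OF \<rho>(1)] by blast
  have "\<bar>mollify \<kappa> \<Omega> u \<rho> x - mollify \<kappa> \<Omega> u t x\<bar> \<le> B / p * \<rho> powr p - B / p * t powr p"
  proof (rule abs_diff_le_of_deriv_bound [where f' = D])
    show "((\<lambda>r. B / p * r powr p) has_real_derivative B * r powr (p - 1)) (at r)" if "t \<le> r" for r
      using that t p by (auto intro!: derivative_eq_intros)
  qed (use D t in auto)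
  moreover have "B / p * t powr p \<ge> 0" using B p by simp
  ultimately show False using t(3) by linarith
qed

text \<open>Over a disjoint Vitali subfamily the integrals of \<open>F\<close> add up to at most
  \<open>W\<close>, and each exceeds \<open>A * t powr s\<close>. The fivefold balls, which cover
  \<open>E\<close>, therefore have total weight at most \<open>c * W / A\<close>, and
  \<open>A\<close> is arbitrary.\<close>

lemma hausdorff_measure_zero_of_concentration:
  fixes E :: "'a::euclidean_space set"
  assumes F: "\<And>y. F y \<ge> 0" "set_integrable lebesgue \<Omega> F" and s: "s > 0"
    and conc: "\<And>x A \<delta>. x \<in> E \<Longrightarrow> A > 0 \<Longrightarrow> \<delta> > 0 \<Longrightarrow>
      \<exists>t. 0 < t \<and> t < \<delta> \<and> cball x t \<subseteq> \<Omega> \<and> A * t powr s < (LINT y:cball x t|lebesgue. F y)"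
  shows "hausdorff_measure s E = 0"
proof -
  define W where "W = (LINT y:\<Omega>|lebesgue. F y)"
  have W0: "W \<ge> 0" unfolding W_def set_lebesgue_integral_def by (intro integral_nonneg_AE) (auto simp: F)
  \<comment> \<open>The Hausdorff weight of a ball of radius \<open>5 * t\<close>, divided by
    \<open>t powr s\<close>.\<close>
  define c where "c = unit_ball_vol s * 5 powr s"
  have c0: "c \<ge> 0" using s by (simp add: c_def unit_ball_vol_nonneg)
  have pre: "hausdorff_pre s \<delta> E \<le> ennreal \<eta>" if \<delta>: "\<delta> > 0" and \<eta>: "\<eta> > 0" for \<delta> \<eta>
  proof -
    \<comment> \<open>Chosen for \<open>c * W / A \<le> \<eta>\<close>; the summand \<open>1\<close>
      keeps \<open>A\<close> positive when \<open>c * W = 0\<close>.\<close>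
    define A where "A = (c * W + 1) / \<eta>"
    have A: "A > 0" using c0 W0 \<eta> by (auto simp: A_def intro!: divide_pos_pos add_nonneg_pos)
    have cWA: "c * W / A \<le> \<eta>" using A \<eta> c0 W0 by (simp add: A_def field_simps)
    \<comment> \<open>The fivefold balls have diameter \<open>10 * t\<close>, which must not exceed
      \<open>\<delta>\<close>.\<close>
    have "\<forall>x. \<exists>t. x \<in> E \<longrightarrow> 0 < t \<and> t < \<delta> / 10 \<and> cball x t \<subseteq> \<Omega> \<and> A * t powr s < (LINT y:cball x t|lebesgue. F y)"
      using conc [OF _ A, of _ "\<delta> / 10"] \<delta> by (metis divide_pos_pos zero_less_numeral)
    from choice [OF this] obtain t where t: "\<And>x. x \<in> E \<Longrightarrow> 0 < t x" "\<And>x. x \<in> E \<Longrightarrow> t x < \<delta> / 10"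
      "\<And>x. x \<in> E \<Longrightarrow> cball x (t x) \<subseteq> \<Omega>" "\<And>x. x \<in> E \<Longrightarrow> A * t x powr s < (LINT y:cball x (t x)|lebesgue. F y)"
      by blast
    obtain C where C: "countable C" "C \<subseteq> E"
      "pairwise (\<lambda>i j. disjnt (cball i (t i)) (cball j (t j))) C"
      "E \<subseteq> (\<Union>i\<in>C. cball i (5 * t i))"
    proof (rule Vitali_covering_lemma_cballs [where S = E and K = E and a = "\<lambda>x. x" and r = t and B = "\<delta> / 10"])
      show "E \<subseteq> (\<Union>i\<in>E. cball i (t i))" using t(1) by (force intro: less_imp_le)
      show "0 < t i \<and> t i \<le> \<delta> / 10" if "i \<in> E" for i using t(1,2) [OF that] by simp
    qed blast
    \<comment> \<open>Covers are sequences, while \<open>C\<close> may be finite; spare indices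
      receive the empty set, of weight \<open>0\<close>.\<close>
    define U where "U k = (if k \<in> to_nat_on C ` C then cball (from_nat_into C k) (5 * t (from_nat_into C k)) else {})" for k
    have enum: "from_nat_into C k \<in> C" "from_nat_into C k \<in> E" if "k \<in> to_nat_on C ` C" for k
      using that C(1,2) by auto
    have dU: "diameter (U k) = 10 * t (from_nat_into C k)" if "k \<in> to_nat_on C ` C" for k
      using that t(1) [OF enum(2) [OF that]] by (simp add: U_def)
    have "hausdorff_pre s \<delta> E \<le> (\<Sum>k. ennreal (hausdorff_weight s (U k)))"
      unfolding hausdorff_pre_def
    proof (rule INF_lower, intro CollectI conjI allI)
      show "E \<subseteq> (\<Union>k. U k)"
      proof
        fix x assume "x \<in> E"
        then obtain i where i: "i \<in> C" "x \<in> cball i (5 * t i)" using C(4) by blast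
        then have "x \<in> U (to_nat_on C i)" using C(1) by (simp add: U_def)
        then show "x \<in> (\<Union>k. U k)" by blast
      qed
      show "bounded (U k)" for k by (simp add: U_def)
      show "diameter (U k) \<le> \<delta>" for k
      proof (cases "k \<in> to_nat_on C ` C")
        case True
        then show ?thesis using dU [OF True] t(2) [OF enum(2) [OF True]] by simp
      next
        case False
        then have "U k = {}" by (simp add: U_def)
        then show ?thesis using \<delta> by simp
      qed
    qed
    also have "\<dots> \<le> ennreal \<eta>"
    proof (rule suminf_le_const)
      fix N :: nat
      define J where "J = from_nat_into C ` ({..<N} \<inter> to_nat_on C ` C)"
      have J: "finite J" "J \<subseteq> C" using enum by (auto simp: J_def)
      have JE: "J \<subseteq> E" using J C(2) by blast
      have inj: "inj_on (from_nat_into C) ({..<N} \<inter> to_nat_on C ` C)"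
        using C(1) by (auto intro!: inj_onI)
      have weight: "hausdorff_weight s (U k) = c * t (from_nat_into C k) powr s" if k: "k \<in> to_nat_on C ` C" for k
      proof -
        have "t (from_nat_into C k) > 0" using t(1) enum(2) [OF k] by blast
        moreover have "U k \<noteq> {}" using k calculation by (simp add: U_def)
        ultimately show ?thesis using s dU [OF k]
          by (simp add: hausdorff_weight_def c_def powr_mult)
      qed
      have "(\<Sum>k<N. hausdorff_weight s (U k)) = (\<Sum>k\<in>{..<N} \<inter> to_nat_on C ` C. hausdorff_weight s (U k))"
        by (rule sum.mono_neutral_right) (auto simp: U_def hausdorff_weight_def)
      also have "\<dots> = (\<Sum>k\<in>{..<N} \<inter> to_nat_on C ` C. c * t (from_nat_into C k) powr s)"
        by (rule sum.cong) (auto simp: weight)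
      also have "\<dots> = (\<Sum>i\<in>J. c * t i powr s)"
        unfolding J_def using inj by (simp add: sum.reindex)
      also have "\<dots> \<le> (\<Sum>i\<in>J. c / A * (LINT y:cball i (t i)|lebesgue. F y))"
      proof (rule sum_mono)
        fix i assume "i \<in> J"
        then have "A * t i powr s \<le> (LINT y:cball i (t i)|lebesgue. F y)" using t(4) JE by (force intro: less_imp_le)
        then have "c / A * (A * t i powr s) \<le> c / A * (LINT y:cball i (t i)|lebesgue. F y)"
          using c0 A by (intro mult_left_mono) auto
        then show "c * t i powr s \<le> c / A * (LINT y:cball i (t i)|lebesgue. F y)" using A by simp
      qed
      also have "\<dots> = c / A * (\<Sum>i\<in>J. LINT y:cball i (t i)|lebesgue. F y)" by (simp add: sum_distrib_left)
      also have "\<dots> \<le> c / A * W"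
      proof (rule mult_left_mono)
        have si: "set_integrable lebesgue S F" if "S \<subseteq> \<Omega>" "S \<in> sets lebesgue" for S
        proof -
          have "indicator S y *\<^sub>R F y = indicator S y *\<^sub>R (indicator \<Omega> y *\<^sub>R F y)" for y
            using that(1) by (auto simp: indicator_def)
          then show ?thesis unfolding set_integrable_def
            by (simp only:) (rule integrable_mult_indicator [OF that(2)], use F(2) in \<open>simp add: set_integrable_def\<close>)
        qed
        have mU: "(\<Union>i\<in>J. cball i (t i)) \<in> sets lebesgue" using J by (intro sets.finite_UN) auto
        have sU: "(\<Union>i\<in>J. cball i (t i)) \<subseteq> \<Omega>" using t(3) JE by blast
        have "(\<Sum>i\<in>J. LINT y:cball i (t i)|lebesgue. F y) = (LINT y:(\<Union>i\<in>J. cball i (t i))|lebesgue. F y)"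
        proof (rule set_integral_finite_Union [symmetric])
          show "disjoint_family_on (\<lambda>i. cball i (t i)) J"
            using C(3) J(2) by (auto simp: disjoint_family_on_def pairwise_def disjnt_def)
          show "set_integrable lebesgue (cball i (t i)) F" if "i \<in> J" for i
            using that t(3) JE by (intro si) auto
        qed (use J in auto)
        also have "\<dots> \<le> W"
          unfolding W_def set_lebesgue_integral_def
        proof (rule integral_mono)
          show "integrable lebesgue (\<lambda>y. indicator (\<Union>i\<in>J. cball i (t i)) y *\<^sub>R F y)"
            using si [OF sU mU] by (simp add: set_integrable_def)
          show "integrable lebesgue (\<lambda>y. indicator \<Omega> y *\<^sub>R F y)" using F(2) by (simp add: set_integrable_def)
          show "indicator (\<Union>i\<in>J. cball i (t i)) y *\<^sub>R F y \<le> indicator \<Omega> y *\<^sub>R F y" for y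
            using subsetD [OF sU, of y] F(1) [of y] by (auto simp: indicator_def)
        qed
        finally show "(\<Sum>i\<in>J. LINT y:cball i (t i)|lebesgue. F y) \<le> W" .
      qed (use c0 A in auto)
      also have "\<dots> \<le> \<eta>" using cWA by simp
      finally have le: "(\<Sum>k<N. hausdorff_weight s (U k)) \<le> \<eta>" .
      have "hausdorff_weight s (U k) \<ge> 0" for k
        using weight [of k] c0 by (cases "k \<in> to_nat_on C ` C") (auto simp: U_def hausdorff_weight_def)
      then have "(\<Sum>k<N. ennreal (hausdorff_weight s (U k))) = ennreal (\<Sum>k<N. hausdorff_weight s (U k))"
        by (intro sum_ennreal) auto
      also have "\<dots> \<le> ennreal \<eta>" using le by (rule ennreal_leI)
      finally show "(\<Sum>k<N. ennreal (hausdorff_weight s (U k))) \<le> ennreal \<eta>" .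
    qed simp
    finally show ?thesis .
  qed
  have "hausdorff_pre s \<delta> E = 0" if "\<delta> > 0" for \<delta>
  proof -
    have "hausdorff_pre s \<delta> E \<le> 0"
      by (rule ennreal_le_epsilon) (use pre [OF that] in simp)
    then show ?thesis by simp
  qed
  then show ?thesis by (simp add: hausdorff_measure_def)
qed

section \<open>Eigenvalues of symmetric matrices\<close>

lemma symmetric_matrix_inner:
  fixes M :: "real^'n^'n"
  assumes "transpose M = M"
  shows "x \<bullet> (M *v y) = y \<bullet> (M *v x)"
proof -
  have "x \<bullet> (M *v y) = (x v* M) \<bullet> y" by (simp add: dot_lmul_matrix)
  also have "x v* M = M *v x" using transpose_matrix_vector [of M x] assms by simp
  finally show ?thesis by (simp add: inner_commute)
qed

text \<open>First variation at a minimizer of the quadratic form on the unit sphere of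
  \<open>S\<close>: a perturbation in an orthogonal direction \<open>w\<close> yields a quadratic in
  \<open>t\<close> that is nonnegative and vanishes at \<open>0\<close>, so its linear coefficient
  is zero.\<close>

lemma Rayleigh_minimizer:
  fixes M :: "real^'n^'n"
  assumes sym: "transpose M = M" and S: "subspace S" "S \<noteq> {0}"
  obtains v where "v \<in> S" "norm v = 1" "\<And>w. w \<in> S \<Longrightarrow> w \<bullet> v = 0 \<Longrightarrow> w \<bullet> (M *v v) = 0"
proof -
  define q where "q w = w \<bullet> (M *v w)" for w
  obtain w0 where w0: "w0 \<in> S" "w0 \<noteq> 0" using S subspace_0 by blast
  have "compact (sphere 0 1 \<inter> S)" using S by (intro compact_Int_closed closed_subspace) auto
  moreover have "w0 /\<^sub>R norm w0 \<in> sphere 0 1 \<inter> S" using w0 S by (auto intro: subspace_scale)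
  moreover have "continuous_on (sphere 0 1 \<inter> S) q"
    unfolding q_def by (intro continuous_intros continuous_on_id)
  ultimately obtain v where v: "v \<in> S" "norm v = 1" and min: "\<And>w. w \<in> S \<Longrightarrow> norm w = 1 \<Longrightarrow> q v \<le> q w"
    using continuous_attains_inf [of "sphere 0 1 \<inter> S" q] by fastforce
  have hom: "q v * (norm w)\<^sup>2 \<le> q w" if "w \<in> S" for w
  proof (cases "w = 0")
    case False
    have "q v \<le> q (w /\<^sub>R norm w)" using that False S by (intro min subspace_scale) auto
    also have "\<dots> = q w / (norm w)\<^sup>2"
      by (simp add: q_def matrix_vector_mult_scaleR power2_eq_square divide_inverse)
    finally show ?thesis using False by (simp add: field_simps)
  qed (simp add: q_def)
  show thesis
  proof (rule that [OF v])
    fix w assume w: "w \<in> S" "w \<bullet> v = 0"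
    define a where "a = w \<bullet> (M *v v)"
    define b where "b = q w - q v * (norm w)\<^sup>2"
    have b0: "b \<ge> 0" using hom [OF w(1)] by (simp add: b_def)
    have key: "0 \<le> 2 * t * a + t\<^sup>2 * b" for t
    proof -
      have "q v * (norm (v + t *\<^sub>R w))\<^sup>2 \<le> q (v + t *\<^sub>R w)"
        using v w S by (intro hom subspace_add subspace_scale)
      moreover have "q (v + t *\<^sub>R w) = q v + 2 * t * a + t\<^sup>2 * q w"
        unfolding q_def a_def using symmetric_matrix_inner [OF sym, of v w]
        by (simp add: matrix_vector_right_distrib matrix_vector_mult_scaleR inner_add_left inner_add_right power2_eq_square algebra_simps)
      moreover have "(norm (v + t *\<^sub>R w))\<^sup>2 = 1 + t\<^sup>2 * (norm w)\<^sup>2"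
        using v w unfolding power2_norm_eq_inner
        by (simp add: inner_add_left inner_add_right inner_commute norm_eq_1 power2_eq_square)
      ultimately show ?thesis by (simp add: b_def algebra_simps)
    qed
    have c: "b + 1 \<noteq> 0" using b0 by simp
    \<comment> \<open>For \<open>b > 0\<close> the minimizing \<open>t\<close> is
      \<open>- a / b\<close>; the denominator \<open>b + 1\<close> covers \<open>b = 0\<close> as
      well.\<close>
    have "0 \<le> 2 * (- a / (b + 1)) * a + (- a / (b + 1))\<^sup>2 * b" by (rule key)
    also have "\<dots> = - (a\<^sup>2 * (b + 2)) / (b + 1)\<^sup>2"
      using c by (simp add: divide_simps power2_eq_square) (simp add: algebra_simps)
    finally have "a\<^sup>2 * (b + 2) \<le> 0" using b0 by (simp add: divide_le_0_iff zero_le_divide_iff)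
    then have "a\<^sup>2 \<le> 0" using b0 by (simp add: mult_le_0_iff)
    then show "w \<bullet> (M *v v) = 0" by (simp add: a_def)
  qed
qed

text \<open>Minimize over the whole space, then over the orthogonal complement of \<open>e1\<close>,
  and complete to an orthonormal basis; the two minimality conditions annihilate the entries on one
  side of the diagonal and symmetry those on the other.\<close>

lemma symmetric_diagonalizable_3:
  fixes M :: "real^3^3"
  assumes sym: "transpose M = M"
  obtains e :: "3 \<Rightarrow> real^3" and l :: "3 \<Rightarrow> real"
  where "\<And>i j. e i \<bullet> e j = (if i = j then 1 else 0)"
    "\<And>i j. e i \<bullet> (M *v e j) = (if i = j then l i else 0)"
proof -
  obtain e1 where e1: "norm e1 = 1" "\<And>w. w \<bullet> e1 = 0 \<Longrightarrow> w \<bullet> (M *v e1) = 0"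
    using Rayleigh_minimizer [OF sym, of UNIV] by (metis UNIV_I UNIV_not_singleton subspace_UNIV)
  define S where "S = {x. orthogonal e1 x}"
  have "subspace S" unfolding S_def by (rule subspace_orthogonal_to_vector)
  moreover have "S \<noteq> {0}"
  proof -
    have "dim (span {e1}) < DIM(real^3)" using dim_le_card [of "span {e1}" "{e1}"] by simp
    then obtain x where "x \<noteq> 0" "orthogonal x e1"
      using orthogonal_to_subspace_exists [of "{e1}"] by (metis dim_span insertI1 span_base)
    then show ?thesis unfolding S_def using orthogonal_commute by blast
  qed
  ultimately obtain e2 where e2: "e2 \<in> S" "norm e2 = 1" "\<And>w. w \<in> S \<Longrightarrow> w \<bullet> e2 = 0 \<Longrightarrow> w \<bullet> (M *v e2) = 0"
    using Rayleigh_minimizer [OF sym] by metis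
  have "dim {e1, e2} < DIM(real^3)"
    using dim_le_card' [of "{e1, e2}"] card_insert_le_m1 [of 2 "{e2}" e1] by simp
  then obtain x where x: "x \<noteq> 0" "\<And>y. y \<in> span {e1, e2} \<Longrightarrow> orthogonal x y"
    using orthogonal_to_subspace_exists [of "{e1, e2}"] by auto
  define e3 where "e3 = x /\<^sub>R norm x"
  have e3: "norm e3 = 1" "e3 \<bullet> e1 = 0" "e3 \<bullet> e2 = 0"
    using x(1) x(2) [OF span_base, of e1] x(2) [OF span_base, of e2] by (auto simp: e3_def orthogonal_def)
  have e21: "e2 \<bullet> e1 = 0" using e2(1) by (simp add: S_def orthogonal_def inner_commute)
  define e where "e i = (if i = (1::3) then e1 else if i = 2 then e2 else e3)" for i
  have M: "e2 \<bullet> (M *v e1) = 0" "e3 \<bullet> (M *v e1) = 0" "e3 \<bullet> (M *v e2) = 0"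
    using e1(2) e2(3) [of e3] e3 e21 by (auto simp: S_def orthogonal_def inner_commute)
  have M': "e1 \<bullet> (M *v e2) = 0" "e1 \<bullet> (M *v e3) = 0" "e2 \<bullet> (M *v e3) = 0"
    using M symmetric_matrix_inner [OF sym] by metis+
  show thesis
  proof (rule that [of e "\<lambda>i. e i \<bullet> (M *v e i)"])
    have "\<forall>i j. e i \<bullet> e j = (if i = j then 1 else 0)"
      unfolding forall_3 e_def using e1(1) e2(2) e3 e21 by (simp add: norm_eq_1 inner_commute)
    then show "e i \<bullet> e j = (if i = j then 1 else 0)" for i j by blast
    have "\<forall>i j. e i \<bullet> (M *v e j) = (if i = j then e i \<bullet> (M *v e i) else 0)"
      unfolding forall_3 e_def using M M' by simp
    then show "e i \<bullet> (M *v e j) = (if i = j then e i \<bullet> (M *v e i) else 0)" for i j by blast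
  qed
qed

definition tensor_square :: "real^'n \<Rightarrow> real^'n^'n" where
  "tensor_square u = (\<chi> i j. u $ i * u $ j)"

lemma inner_tensor_square: "A \<bullet> tensor_square u = u \<bullet> (A *v u)"
  by (simp add: tensor_square_def inner_vec_def matrix_vector_mult_def sum_distrib_left mult_ac)

lemma inner_mat_1: "A \<bullet> mat 1 = trace (A :: real^'n^'n)"
proof -
  have "A \<bullet> mat 1 = (\<Sum>i\<in>UNIV. \<Sum>j\<in>UNIV. if i = j then A $ i $ j else 0)"
    by (simp add: inner_vec_def mat_def if_distrib cong: if_cong)
  then show ?thesis by (simp add: trace_def)
qed

lemma trace_tensor_square: "trace (tensor_square u) = (norm u)\<^sup>2"
  by (simp add: trace_def tensor_square_def power2_norm_eq_inner inner_vec_def)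

context
  fixes e :: "'n::finite \<Rightarrow> real^'n"
  assumes e: "\<And>i j. e i \<bullet> e j = (if i = j then 1 else 0)"
begin

definition basis_matrix :: "real^'n^'n" where "basis_matrix = (\<chi> i j. e j $ i)"

lemma conj_basis_matrix:
  "(transpose basis_matrix ** A ** basis_matrix) $ i $ j = e i \<bullet> (A *v e j)"
proof -
  have "(transpose basis_matrix ** (A ** basis_matrix)) $ i $ j = e i \<bullet> (A *v e j)"
    by (simp add: matrix_matrix_mult_def transpose_def basis_matrix_def matrix_vector_mult_def inner_vec_def)
  then show ?thesis by (simp add: matrix_mul_assoc)
qed

lemma orthogonal_basis_matrix: "orthogonal_matrix basis_matrix"
proof -
  have "N = mat 1" if "\<And>i j. N $ i $ j = (if i = j then 1 else 0)" for N :: "real^'n^'n"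
    using that by (simp add: vec_eq_iff mat_def)
  then have "transpose basis_matrix ** mat 1 ** basis_matrix = mat 1"
    by (simp only: conj_basis_matrix matrix_vector_mul_lid e)
  then show ?thesis by (simp add: orthogonal_matrix)
qed

lemma basis_matrix_conj_conj:
  "basis_matrix ** (transpose basis_matrix ** A ** basis_matrix) ** transpose basis_matrix = A"
proof -
  have "basis_matrix ** transpose basis_matrix = mat 1"
    using orthogonal_basis_matrix by (simp add: orthogonal_matrix_def)
  then show ?thesis by (metis matrix_mul_assoc matrix_mul_lid matrix_mul_rid)
qed

lemma det_eq_prod_of_diagonal:
  assumes "\<And>i j. e i \<bullet> (A *v e j) = (if i = j then l i else 0)"
  shows "det A = prod l UNIV"
proof -
  have "det basis_matrix * det basis_matrix = 1"
    using det_orthogonal_matrix [OF orthogonal_basis_matrix] by auto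
  then have "det A = det (transpose basis_matrix ** A ** basis_matrix)"
    by (simp add: det_mul det_transpose)
  also have "\<dots> = (\<Prod>i\<in>UNIV. (transpose basis_matrix ** A ** basis_matrix) $ i $ i)"
    by (rule det_diagonal) (simp add: conj_basis_matrix assms)
  finally show ?thesis by (simp add: conj_basis_matrix assms)
qed

text \<open>The spectral decomposition, obtained by undoing the orthogonal conjugation that makes
  \<open>A\<close> diagonal.\<close>

lemma eq_sum_tensor_square:
  assumes "\<And>i j. e i \<bullet> (A *v e j) = (if i = j then l i else 0)"
  shows "A = (\<Sum>k\<in>UNIV. l k *\<^sub>R tensor_square (e k))"
proof -
  have "transpose basis_matrix ** A ** basis_matrix = (\<chi> i j. if i = j then l i else 0)"
    by (simp add: vec_eq_iff conj_basis_matrix assms)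
  then have "A = basis_matrix ** (\<chi> i j. if i = j then l i else 0) ** transpose basis_matrix"
    by (metis basis_matrix_conj_conj)
  also have "\<dots> = (\<Sum>k\<in>UNIV. l k *\<^sub>R tensor_square (e k))"
    by (simp add: vec_eq_iff matrix_matrix_mult_def transpose_def basis_matrix_def tensor_square_def
        if_distrib sum.delta mult_ac cong: if_cong)
  finally show ?thesis .
qed

text \<open>The resolution of the identity, \<open>eq_sum_tensor_square\<close> for
  \<open>mat 1\<close>, paired with \<open>A\<close>.\<close>

lemma sum_inner_basis_eq_trace: "(\<Sum>k\<in>UNIV. e k \<bullet> (A *v e k)) = trace A"
proof -
  have "(mat 1 :: real^'n^'n) = (\<Sum>k\<in>UNIV. 1 *\<^sub>R tensor_square (e k))"
    by (rule eq_sum_tensor_square) (simp add: e)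
  then have "trace A = A \<bullet> (\<Sum>k\<in>UNIV. tensor_square (e k))" by (metis (no_types, lifting) inner_mat_1 scaleR_one sum.cong)
  then show ?thesis by (simp add: inner_sum_right inner_tensor_square)
qed

lemma matrix_eq_0_if_basis_entries_0:
  assumes "\<And>i j. e i \<bullet> (A *v e j) = 0"
  shows "A = 0"
proof -
  have "A = (\<Sum>k\<in>UNIV. 0 *\<^sub>R tensor_square (e k))"
    by (rule eq_sum_tensor_square) (simp add: assms)
  then show ?thesis by simp
qed

end

text \<open>Equal values make the two polynomials equal, hence also their multisets of roots, and
  sorting removes the remaining freedom. This is the uniqueness behind the definite description in
  \<open>eigenvalues\<close>.\<close>

lemma sorted_eq_if_root_products_eq:
  fixes ls ls' :: "real list"
  assumes "sorted ls" "sorted ls'" "\<And>x. (\<Prod>l\<leftarrow>ls. x - l) = (\<Prod>l\<leftarrow>ls'. x - l)"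
  shows "ls = ls'"
proof -
  define p where "p ls = (\<Prod>l\<leftarrow>ls. [:- l, 1:] :: real poly)" for ls
  have poly: "poly (p ls) x = (\<Prod>l\<leftarrow>ls. x - l)" for ls x
    by (induction ls) (auto simp: p_def algebra_simps)
  have ne: "p ls \<noteq> 0" for ls by (auto simp: p_def prod_list_zero_iff)
  have "proots (p ls) = mset ls" for ls
  proof (induction ls)
    case (Cons l ls)
    have "p (l # ls) = [:- l, 1:] * p ls" by (simp add: p_def)
    then have "proots (p (l # ls)) = proots [:- l, 1:] + proots (p ls)"
      using ne [of ls] by (simp only: proots_mult pCons_eq_0_iff one_neq_zero simp_thms not_False_eq_True)
    then show ?case using Cons by simp
  qed (simp add: p_def)
  moreover have "p ls = p ls'"
    using assms(3) poly by (intro poly_eq_poly_eq_iff [THEN iffD1]) (simp add: fun_eq_iff)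
  ultimately have "mset ls = mset ls'" by metis
  then show ?thesis using assms(1,2) properties_for_sort by metis
qed

lemma eigenvalues_eqI:
  assumes "sorted ls" "\<And>x. det (mat x - M) = (\<Prod>l\<leftarrow>ls. x - l)"
  shows "eigenvalues M = ls"
  unfolding eigenvalues_def
proof (rule the_equality)
  show "sorted ls \<and> (\<forall>x. det (mat x - M) = (\<Prod>l\<leftarrow>ls. x - l))" using assms by blast
  fix ls' assume ls': "sorted ls' \<and> (\<forall>x. det (mat x - M) = (\<Prod>l\<leftarrow>ls'. x - l))"
  show "ls' = ls"
    by (rule sorted_eq_if_root_products_eq) (use assms ls' in auto)
qed

lemma Q_tensors_iff: "M \<in> Q_tensors \<longleftrightarrow> trace M = 0 \<and> transpose M = M"
  unfolding Q_tensors_def mem_Collect_eq by (intro conj_cong refl eq_commute)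

lemma Q_tensors_iff_entries:
  "M \<in> Q_tensors \<longleftrightarrow> M \<bullet> mat 1 = 0 \<and> (\<forall>i j. M $ i $ j = M $ j $ i)"
  unfolding Q_tensors_iff inner_mat_1 by (auto simp: vec_eq_iff transpose_def)

text \<open>By zero trace the largest eigenvalue is minus the sum of the other two, so the strict
  lower bound \<open>- 1/3\<close> for all of them yields the upper bound \<open>2/3\<close>. Later
  arguments can then work with diagonal entries in an eigenbasis instead of sorted lists.\<close>

lemma Q_phy_iff:
  assumes M: "M \<in> Q_tensors"
    and e: "\<And>i j. e i \<bullet> e j = (if i = j then 1 else 0)"
    and l: "\<And>i j. e i \<bullet> (M *v e j) = (if i = j then l i else 0)"
  shows "M \<in> Q_phy \<longleftrightarrow> (\<forall>i :: 3. l i > - 1 / 3)"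
proof -
  define ls where "ls = sort [l 1, l 2, l 3]"
  have ms: "mset ls = {#l 1, l 2, l 3#}" unfolding ls_def mset_sort by simp
  have srt: "sorted ls" unfolding ls_def by (rule sorted_sort)
  have det_eq: "det (mat x - M) = (\<Prod>i\<in>UNIV. x - l i)" for x
  proof (rule det_eq_prod_of_diagonal [OF e])
    fix i j
    have "(mat x :: real^3^3) *v e j = x *\<^sub>R e j"
    proof -
      have "(mat x :: real^3^3) = x *\<^sub>R mat 1" by (simp add: vec_eq_iff mat_def)
      then show ?thesis by (simp add: scaleR_matrix_vector_assoc [symmetric])
    qed
    then show "e i \<bullet> ((mat x - M) *v e j) = (if i = j then x - l i else 0)"
      by (simp add: matrix_vector_mult_diff_rdistrib inner_diff_right l e)
  qed
  have prod_eq: "(\<Prod>i\<in>UNIV. x - l i) = (\<Prod>l\<leftarrow>ls. x - l)" for x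
  proof -
    have "(\<Prod>l\<leftarrow>ls. x - l) = prod_mset (image_mset (\<lambda>l. x - l) (mset ls))"
      by (simp only: prod_mset_prod_list mset_map [symmetric])
    also have "\<dots> = (\<Prod>i\<in>UNIV. x - l i)" unfolding ms UNIV_3 by simp
    finally show ?thesis by simp
  qed
  have ev: "eigenvalues M = ls" by (rule eigenvalues_eqI [OF srt]) (simp only: det_eq prod_eq)
  have "size (mset ls) = 3" unfolding ms by simp
  then have "length ls = 3" by simp
  then obtain a b c where abc: "ls = [a, b, c]" by (auto simp: length_Suc_conv numeral_3_eq_3)
  have le: "a \<le> b" "b \<le> c" using srt abc by auto
  have set: "{a, b, c} = {l 1, l 2, l 3}" using arg_cong [OF ms, of set_mset] by (simp add: abc)
  have "sum_list ls = l 1 + l 2 + l 3"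
  proof -
    have "sum_list ls = sum_mset (mset ls)" by (rule sum_mset_sum_list [symmetric])
    then show ?thesis by (simp add: ms)
  qed
  moreover have "l 1 + l 2 + l 3 = 0"
  proof -
    have "(\<Sum>k\<in>UNIV. l k) = (\<Sum>k\<in>UNIV. e k \<bullet> (M *v e k))" by (intro sum.cong) (simp_all only: l refl if_True)
    also have "\<dots> = trace M" by (rule sum_inner_basis_eq_trace [OF e])
    also have "\<dots> = 0" using M by (simp only: Q_tensors_iff)
    finally show ?thesis by (simp add: sum_3)
  qed
  ultimately have sum0: "a + b + c = 0" by (simp add: abc)
  have "(\<forall>i. l i > - 1 / 3) \<longleftrightarrow> (\<forall>z\<in>{a, b, c}. z > - 1 / 3)" unfolding set by (simp add: forall_3)
  also have "\<dots> \<longleftrightarrow> a > - 1 / 3" using le by auto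
  also have "\<dots> \<longleftrightarrow> M \<in> Q_phy"
    using M le sum0 by (auto simp: Q_phy_def eigenvalue1_def eigenvalue2_def eigenvalue3_def ev abc)
  finally show ?thesis by blast
qed

lemma Q_tensor_not_Q_phyE:
  assumes "M \<in> Q_tensors" "M \<notin> Q_phy"
  obtains w where "norm w = 1" "w \<bullet> (M *v w) \<le> - 1 / 3"
proof -
  have "transpose M = M" using assms(1) by (simp add: Q_tensors_iff)
  then obtain e :: "3 \<Rightarrow> real^3" and l where e: "\<And>i j. e i \<bullet> e j = (if i = j then 1 else 0)"
    and l: "\<And>i j. e i \<bullet> (M *v e j) = (if i = j then l i else 0)"
    using symmetric_diagonalizable_3 by blast
  obtain i where "l i \<le> - 1 / 3" using Q_phy_iff [OF assms(1) e l] assms(2) by (auto simp: not_less)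
  then show thesis using that [of "e i"] e [of i i] l [of i i] by (simp add: norm_eq_1)
qed

section \<open>The entropy near the boundary of the physical tensors\<close>

abbreviation S2 :: "(real^3) measure" where "S2 \<equiv> sphere_measure"

section \<open>The surface measure of the sphere\<close>

lemma space_sphere_measure: "space (sphere_measure :: 'a::euclidean_space measure) = sphere 0 1"
  by (simp add: sphere_measure_def space_scale_measure space_restrict_space)

lemma sets_sphere_measure:
  "sets (sphere_measure :: 'a::euclidean_space measure) = sets (restrict_space borel (sphere 0 1))"
  by (simp add: sphere_measure_def)

lemma sphere_measure_measurableI:
  fixes f :: "'a::euclidean_space \<Rightarrow> 'b::topological_space"
  assumes "f \<in> borel_measurable borel"
  shows "f \<in> borel_measurable sphere_measure"
  using measurable_restrict_space1 [OF assms, of "sphere 0 1"]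
  by (simp only: measurable_cong_sets [OF sets_sphere_measure refl])

lemma in_sets_sphere_measure:
  "A \<in> sets borel \<Longrightarrow> sphere 0 1 \<inter> A \<in> sets (sphere_measure :: 'a::euclidean_space measure)"
  unfolding sets_sphere_measure sets_restrict_space by (rule imageI)

lemma emeasure_sphere_measure:
  fixes A :: "'a::euclidean_space set"
  assumes "A \<in> sets sphere_measure"
  shows "emeasure sphere_measure A = of_nat DIM('a) * emeasure lborel {x \<in> ball 0 1 - {0}. x /\<^sub>R norm x \<in> A}"
proof -
  let ?N = "restrict_space lborel (ball (0::'a) 1 - {0})"
  have m: "(\<lambda>x. x /\<^sub>R norm x) \<in> ?N \<rightarrow>\<^sub>M restrict_space borel (sphere 0 1)"
    by (rule measurable_restrict_space3) auto
  have "emeasure sphere_measure A = of_nat DIM('a) * emeasure ?N ((\<lambda>x. x /\<^sub>R norm x) -` A \<inter> space ?N)"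
    using assms m by (simp add: sphere_measure_def emeasure_distr)
  also have "(\<lambda>x. x /\<^sub>R norm x) -` A \<inter> space ?N = {x \<in> ball 0 1 - {0}. x /\<^sub>R norm x \<in> A}"
    by (auto simp: space_restrict_space)
  also have "emeasure ?N \<dots> = emeasure lborel \<dots>"
    by (rule emeasure_restrict_space) auto
  finally show ?thesis .
qed

lemma finite_measure_sphere_measure: "finite_measure (sphere_measure :: 'a::euclidean_space measure)"
proof
  have "emeasure lborel {x \<in> ball 0 1 - {0 :: 'a}. x /\<^sub>R norm x \<in> sphere 0 1} \<le> emeasure lborel (ball (0 :: 'a) 1)"
    by (rule emeasure_mono) auto
  also have "\<dots> < \<infinity>" by (rule emeasure_lborel_ball_finite)
  finally have "of_nat DIM('a) * emeasure lborel {x \<in> ball 0 1 - {0 :: 'a}. x /\<^sub>R norm x \<in> sphere 0 1} < \<infinity>"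
    by (simp only: ennreal_mult_less_top infinity_ennreal_def of_nat_less_top simp_thms)
  moreover have "sphere 0 1 \<in> sets (sphere_measure :: 'a measure)"
    using sets.top [of "sphere_measure :: 'a measure"] by (simp add: space_sphere_measure)
  ultimately have "emeasure (sphere_measure :: 'a measure) (sphere 0 1) \<noteq> \<infinity>"
    by (simp only: emeasure_sphere_measure less_irrefl)
  then show "emeasure (sphere_measure :: 'a measure) (space sphere_measure) \<noteq> \<infinity>"
    by (simp add: space_sphere_measure)
qed

interpretation sphere: finite_measure "sphere_measure :: 'a::euclidean_space measure"
  by (rule finite_measure_sphere_measure)

text \<open>The part of the punctured ball lying over \<open>U\<close> is open and contains
  \<open>n /\<^sub>R 2\<close>, hence has positive volume.\<close>

lemma sphere_measure_open_pos:
  fixes U :: "'a::euclidean_space set"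
  assumes U: "open U" and n: "n \<in> U" "norm n = 1"
  shows "measure sphere_measure (sphere 0 1 \<inter> U) > 0"
proof -
  let ?V = "{x \<in> ball 0 1 - {0}. x /\<^sub>R norm x \<in> sphere 0 1 \<inter> U}"
  have V: "?V = (ball 0 1 - {0}) \<inter> (\<lambda>x. x /\<^sub>R norm x) -` U" by auto
  have "open ?V"
    unfolding V using U by (intro continuous_open_preimage continuous_intros) auto
  moreover have "n /\<^sub>R 2 \<in> ?V" using n by auto
  ultimately have nn: "\<not> negligible ?V" using open_not_negligible [of ?V] by blast
  have "emeasure lborel ?V \<noteq> 0"
  proof
    assume "emeasure lborel ?V = 0"
    then have "?V \<in> null_sets lborel" using \<open>open ?V\<close> by (intro null_setsI) simp_all
    then have "negligible ?V" unfolding negligible_iff_null_sets by (rule null_sets_completionI)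
    then show False using nn by contradiction
  qed
  moreover have "sphere 0 1 \<inter> U \<in> sets sphere_measure" using U by (intro in_sets_sphere_measure) auto
  ultimately have "emeasure sphere_measure (sphere 0 1 \<inter> U) \<noteq> 0"
    by (simp add: emeasure_sphere_measure)
  then show ?thesis using sphere.emeasure_eq_measure measure_nonneg
    by (metis ennreal_0 order_le_less)
qed

text \<open>The cone over the spherical slab lies in the solid slab of the unit ball, because its
  points are only shortened. With \<open>e\<close> rotated to an axis this fits into a box of volume
  \<open>2 * \<epsilon> * 2 * 2\<close>, and the factor \<open>3\<close> in the surface measure
  makes \<open>24\<close>.\<close>

lemma sphere_measure_slab:
  fixes e :: "real^3"
  assumes e: "norm e = 1" and \<epsilon>: "\<epsilon> \<ge> 0"
  shows "measure S2 (sphere 0 1 \<inter> {n. \<bar>n \<bullet> e\<bar> \<le> \<epsilon>}) \<le> 24 * \<epsilon>"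
proof -
  define S where "S = {x \<in> cball 0 1. \<bar>x \<bullet> e\<bar> \<le> \<epsilon>}"
  have closedS: "closed {n :: real^3. \<bar>n \<bullet> e\<bar> \<le> \<epsilon>}"
    by (intro closed_Collect_le continuous_intros)
  have "S = cball 0 1 \<inter> {n. \<bar>n \<bullet> e\<bar> \<le> \<epsilon>}" by (auto simp: S_def)
  then have compS: "compact S" using closedS by (simp add: compact_Int_closed)
  then have S: "S \<in> lmeasurable" by (rule lmeasurable_compact)
  have "norm e = norm (axis 1 1 :: real^3)" using e by simp
  from orthogonal_transformation_exists [OF this]
  obtain f :: "real^3 \<Rightarrow> real^3" where f: "orthogonal_transformation f" "f e = axis 1 1" by blast
  define a :: "real^3" where "a = (\<chi> i. if i = (1::3) then - \<epsilon> else - 1)"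
  have "f ` S \<subseteq> cbox a (- a)"
  proof
    fix y assume "y \<in> f ` S"
    then obtain x where x: "x \<in> S" "y = f x" by blast
    have "y $ 1 = f x \<bullet> f e" using x f(2) by (simp add: inner_axis)
    also have "\<dots> = x \<bullet> e" using f(1) by (simp add: orthogonal_transformation_def)
    finally have y1: "\<bar>y $ 1\<bar> \<le> \<epsilon>" using x by (simp add: S_def)
    have "norm y \<le> 1" using x f(1) by (simp add: S_def orthogonal_transformation_norm)
    then have "- 1 \<le> y $ i \<and> y $ i \<le> 1" for i using component_le_norm_cart [of y i] by linarith
    moreover have "- \<epsilon> \<le> y $ 1 \<and> y $ 1 \<le> \<epsilon>" using y1 by linarith
    ultimately show "y \<in> cbox a (- a)" by (simp add: mem_box_cart a_def)
  qed
  then have "measure lebesgue (f ` S) \<le> measure lebesgue (cbox a (- a))"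
    by (rule measure_mono_fmeasurable [OF _ fmeasurableD [OF measurable_orthogonal_image [OF f(1) S]] lmeasurable_cbox])
  also have "measure lebesgue (cbox a (- a)) = 8 * \<epsilon>"
  proof -
    have "cbox a (- a) \<noteq> {}" unfolding interval_ne_empty_cart(1) using \<epsilon> by (simp add: a_def)
    then have "measure lborel (cbox a (- a)) = (\<Prod>i\<in>UNIV. (- a) $ i - a $ i)" by (rule content_cbox_cart)
    then show ?thesis unfolding UNIV_3 by (simp add: a_def)
  qed
  finally have "measure lebesgue S \<le> 8 * \<epsilon>" using measure_orthogonal_image [OF f(1) S] by simp
  moreover have "measure lebesgue S = measure lborel S"
    by (rule measure_completion) (use compS in \<open>simp add: borel_compact\<close>)
  ultimately have mS: "measure lborel S \<le> 8 * \<epsilon>" by simp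
  let ?A = "sphere 0 1 \<inter> {n. \<bar>n \<bullet> e\<bar> \<le> \<epsilon>}"
  have "{x \<in> ball 0 1 - {0}. x /\<^sub>R norm x \<in> ?A} \<subseteq> S"
  proof
    fix x assume "x \<in> {x \<in> ball 0 1 - {0}. x /\<^sub>R norm x \<in> ?A}"
    then have x: "norm x < 1" "x \<noteq> 0" and "\<bar>(x /\<^sub>R norm x) \<bullet> e\<bar> \<le> \<epsilon>" by auto
    then have "\<bar>x \<bullet> e\<bar> / norm x \<le> \<epsilon>" by (simp add: abs_mult divide_inverse_commute)
    then have "\<bar>x \<bullet> e\<bar> \<le> \<epsilon> * norm x" using x by (simp add: divide_le_eq)
    also have "\<dots> \<le> \<epsilon> * 1" using x \<epsilon> by (intro mult_left_mono) auto
    finally show "x \<in> S" using x by (simp add: S_def)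
  qed
  then have "emeasure lborel {x \<in> ball 0 1 - {0}. x /\<^sub>R norm x \<in> ?A} \<le> emeasure lborel S"
    by (rule emeasure_mono) (use compS in \<open>simp add: borel_compact\<close>)
  also have "\<dots> = ennreal (measure lborel S)"
    using emeasure_bounded_finite [OF compact_imp_bounded [OF compS]]
    by (intro emeasure_eq_ennreal_measure) simp
  also have "\<dots> \<le> ennreal (8 * \<epsilon>)" using mS by (rule ennreal_leI)
  finally have le: "emeasure lborel {x \<in> ball 0 1 - {0}. x /\<^sub>R norm x \<in> ?A} \<le> ennreal (8 * \<epsilon>)" .
  have "emeasure S2 ?A = of_nat DIM(real^3) * emeasure lborel {x \<in> ball 0 1 - {0}. x /\<^sub>R norm x \<in> ?A}"
    by (rule emeasure_sphere_measure [OF in_sets_sphere_measure [OF borel_closed [OF closedS]]])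
  also have "\<dots> \<le> of_nat DIM(real^3) * ennreal (8 * \<epsilon>)" by (rule mult_left_mono [OF le]) simp
  also have "of_nat DIM(real^3) = ennreal 3" by simp
  also have "ennreal 3 * ennreal (8 * \<epsilon>) = ennreal (3 * (8 * \<epsilon>))" by (rule ennreal_mult' [symmetric]) simp
  finally have "ennreal (measure S2 ?A) \<le> ennreal (3 * (8 * \<epsilon>))"
    by (simp only: sphere.emeasure_eq_measure)
  then have "measure S2 ?A \<le> 3 * (8 * \<epsilon>)" using \<epsilon> by (simp only: ennreal_le_iff mult_nonneg_nonneg zero_le_numeral)
  then show ?thesis by simp
qed

section \<open>Admissible densities, their moments and their entropy\<close>

lemma continuous_tensor_square: "continuous_on S (tensor_square :: real^'n \<Rightarrow> real^'n^'n)"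
  unfolding tensor_square_def [abs_def] by (intro continuous_intros)

lemma integrable_scaleR_tensor_square:
  fixes \<rho> :: "real^3 \<Rightarrow> real" and N :: "real^3^3"
  assumes \<rho>: "integrable S2 \<rho>"
  shows "integrable S2 (\<lambda>n. \<rho> n *\<^sub>R (tensor_square n - N))"
proof -
  have cont: "continuous_on S (\<lambda>n. tensor_square n - N)" for S
    by (intro continuous_intros continuous_tensor_square)
  have "bounded ((\<lambda>n. tensor_square n - N) ` sphere 0 1)"
    by (intro compact_imp_bounded compact_continuous_image cont) simp
  then obtain B where B: "B > 0" "\<And>n. norm n = 1 \<Longrightarrow> norm (tensor_square n - N) \<le> B"
    unfolding bounded_pos by auto
  show ?thesis
  proof (rule Bochner_Integration.integrable_bound)
    show "integrable S2 (\<lambda>n. B * \<rho> n)" using \<rho> by simp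
    show "(\<lambda>n. \<rho> n *\<^sub>R (tensor_square n - N)) \<in> borel_measurable S2"
      by (rule borel_measurable_scaleR [OF borel_measurable_integrable [OF \<rho>]
            sphere_measure_measurableI [OF borel_measurable_continuous_onI [OF cont]]])
    show "AE n in S2. norm (\<rho> n *\<^sub>R (tensor_square n - N)) \<le> norm (B * \<rho> n)"
      using B by (intro AE_I2) (auto simp: space_sphere_measure abs_mult mult.commute [of B] intro!: mult_left_mono)
  qed
qed

lemma admissible_iff:
  "\<rho> \<in> admissible M \<longleftrightarrow> (\<forall>n\<in>sphere 0 1. 0 \<le> \<rho> n \<and> \<rho> n = \<rho> (- n)) \<and> integrable S2 \<rho> \<and>
     (LINT n|S2. \<rho> n) = 1 \<and> (LINT n|S2. \<rho> n *\<^sub>R (tensor_square n - (1 / 3) *\<^sub>R mat 1)) = M"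
proof -
  have *: "(LINT n|S2. \<bar>\<rho> n\<bar>) = (LINT n|S2. \<rho> n)" if "\<forall>n\<in>sphere 0 1. 0 \<le> \<rho> n \<and> \<rho> n = \<rho> (- n)"
  proof -
    have "\<And>n. norm n = 1 \<Longrightarrow> 0 \<le> \<rho> n" using that unfolding mem_sphere_0 [symmetric] by blast
    then show ?thesis by (intro Bochner_Integration.integral_cong) (auto simp: space_sphere_measure)
  qed
  show ?thesis
    unfolding admissible_def mem_Collect_eq tensor_square_def
    by (rule conj_cong [OF refl], subst *, assumption, rule refl)
qed

text \<open>Pairing the tensor constraint with \<open>A\<close> makes it a scalar identity for the
  quadratic form of \<open>A\<close>; the unit mass of \<open>\<rho>\<close> turns the isotropic
  part into \<open>trace A / 3\<close>.\<close>

lemma inner_admissible: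
  assumes \<rho>: "\<rho> \<in> admissible M"
  shows "A \<bullet> M = (LINT n|S2. \<rho> n * (n \<bullet> (A *v n))) - trace A / 3"
    and "integrable S2 (\<lambda>n. \<rho> n * (n \<bullet> (A *v n)))"
proof -
  let ?F = "\<lambda>n. \<rho> n *\<^sub>R (tensor_square n - (1 / 3) *\<^sub>R mat 1)"
  have int\<rho>: "integrable S2 \<rho>" and one: "(LINT n|S2. \<rho> n) = 1" and M: "integral\<^sup>L S2 ?F = M"
    using \<rho> unfolding admissible_iff by blast+
  note int = integrable_scaleR_tensor_square [OF int\<rho>, of "(1 / 3) *\<^sub>R mat 1"]
  have eq: "A \<bullet> ?F n = \<rho> n * (n \<bullet> (A *v n)) - trace A / 3 * \<rho> n" for n
    by (simp add: inner_diff_right inner_tensor_square inner_mat_1 algebra_simps)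
  have int2: "integrable S2 (\<lambda>n. A \<bullet> ?F n)" using int by (rule integrable_inner_right)
  then have "integrable S2 (\<lambda>n. A \<bullet> ?F n + trace A / 3 * \<rho> n)"
    by (intro Bochner_Integration.integrable_add integrable_mult_right int\<rho>)
  then show int3: "integrable S2 (\<lambda>n. \<rho> n * (n \<bullet> (A *v n)))" by (simp only: eq diff_add_cancel)
  have "A \<bullet> M = (LINT n|S2. A \<bullet> ?F n)"
    using integral_inner_right [of A S2 ?F] int M by simp
  also have "\<dots> = (LINT n|S2. \<rho> n * (n \<bullet> (A *v n))) - trace A / 3"
    unfolding eq using int3 int\<rho> one by simp
  finally show "A \<bullet> M = (LINT n|S2. \<rho> n * (n \<bullet> (A *v n))) - trace A / 3" .
qed

text \<open>Convex duality for \<open>t * ln t\<close>, from \<open>ln x \<le> x - 1\<close> at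
  \<open>x = exp g / t\<close>.\<close>

lemma Young_entropy: "t \<ge> 0 \<Longrightarrow> t * ln t \<ge> t * g - exp g" for t g :: real
proof (cases "t = 0")
  case False
  assume "t \<ge> 0"
  with False have t: "t > 0" by simp
  have "ln (exp g / t) \<le> exp g / t - 1" using t by (intro ln_le_minus_one) simp
  then have "g - ln t \<le> exp g / t - 1" using t by (simp add: ln_div)
  then have "t * (g - ln t) \<le> t * (exp g / t - 1)" using t by (intro mult_left_mono) auto
  then show ?thesis using t by (simp add: algebra_simps)
qed simp

lemma tensor_square_mult: "n \<bullet> (tensor_square e *v n) = (n \<bullet> e)\<^sup>2" for n e :: "real^'n"
proof -
  have "n \<bullet> (tensor_square e *v n) = tensor_square e \<bullet> tensor_square n" by (simp add: inner_tensor_square)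
  also have "\<dots> = (\<Sum>i\<in>UNIV. \<Sum>j\<in>UNIV. (n $ i * e $ i) * (n $ j * e $ j))"
    by (simp add: tensor_square_def inner_vec_def mult_ac)
  also have "\<dots> = (n \<bullet> e)\<^sup>2" by (simp add: inner_vec_def power2_eq_square sum_product)
  finally show ?thesis .
qed

text \<open>With the slab \<open>S = {n. \<bar>n \<bullet> e\<bar> \<le> \<surd>(2\<delta>)}\<close>, Chebyshev's inequality gives \<open>\<rho>\<close> mass at
  least \<open>1/2\<close> on \<open>S\<close>, whereas \<open>S\<close> has surface measure \<open>O(\<surd>\<delta>)\<close>. Young's inequality with
  \<open>g = ln (1 / \<surd>(2\<delta>))\<close> on \<open>S\<close> and \<open>g = 0\<close> elsewhere turns this into a lower bound.\<close>

lemma entropy_lower_bound: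
  assumes e: "norm e = 1" and \<delta>: "0 < \<delta>" "\<delta> \<le> 1 / 2" and \<rho>: "\<rho> \<in> admissible M"
    and M: "e \<bullet> (M *v e) + 1 / 3 \<le> \<delta>"
  shows "ereal (ln (1 / (2 * \<delta>)) / 4 - (24 + measure S2 (sphere 0 1))) \<le> entropy \<rho>"
proof (cases "integrable S2 (\<lambda>n. \<rho> n * ln (\<rho> n))")
  case False
  then show ?thesis by (simp add: entropy_def)
next
  case True
  have int\<rho>: "integrable S2 \<rho>" and one: "(LINT n|S2. \<rho> n) = 1" and pos: "\<And>n. norm n = 1 \<Longrightarrow> \<rho> n \<ge> 0"
    using \<rho> unfolding admissible_iff mem_sphere_0 [symmetric] by blast+
  define \<epsilon> where "\<epsilon> = sqrt (2 * \<delta>)"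
  have \<epsilon>: "0 < \<epsilon>" "\<epsilon> \<le> 1" "\<epsilon>\<^sup>2 = 2 * \<delta>" using \<delta> by (auto simp: \<epsilon>_def)
  define L where "L = ln (1 / \<epsilon>)"
  have L0: "L \<ge> 0" using \<epsilon> by (simp add: L_def)
  \<comment> \<open>The root in \<open>\<epsilon>\<close> costs a factor \<open>1/2\<close>, and the
    mass \<open>1/2\<close> on the slab costs another; hence the \<open>1/4\<close> in the
    statement.\<close>
  have L: "L = ln (1 / (2 * \<delta>)) / 2" using \<delta> by (simp add: L_def \<epsilon>_def ln_div ln_sqrt)
  have expL: "exp L = 1 / \<epsilon>" using \<epsilon> by (simp add: L_def)
  define S where "S = sphere 0 1 \<inter> {n. \<bar>n \<bullet> e\<bar> \<le> \<epsilon>}"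
  have S: "S \<in> sets S2" unfolding S_def
    by (intro in_sets_sphere_measure borel_closed closed_Collect_le continuous_intros)
  have int1S: "integrable S2 (indicat_real S)"
    using S by (intro integrable_real_indicator) (auto simp: sphere.emeasure_eq_measure)
  have int\<rho>S: "integrable S2 (\<lambda>n. \<rho> n * indicator S n)"
    using integrable_mult_indicator [OF S int\<rho>] by (simp add: mult.commute)
  have int2: "integrable S2 (\<lambda>n. \<rho> n * (n \<bullet> e)\<^sup>2)"
    using inner_admissible(2) [OF \<rho>, of "tensor_square e"] by (simp add: tensor_square_mult)
  have "(LINT n|S2. \<rho> n * (n \<bullet> e)\<^sup>2) = tensor_square e \<bullet> M + 1 / 3"
    using inner_admissible(1) [OF \<rho>, of "tensor_square e"] e by (simp add: tensor_square_mult trace_tensor_square)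
  also have "\<dots> \<le> \<delta>" using M by (simp add: inner_tensor_square inner_commute [of "tensor_square e"])
  finally have second: "(LINT n|S2. \<rho> n * (n \<bullet> e)\<^sup>2) \<le> \<delta>" .
  have half: "(LINT n|S2. \<rho> n * indicator S n) \<ge> 1 / 2"
  proof -
    have "(LINT n|S2. \<rho> n - \<rho> n * indicator S n) \<le> (LINT n|S2. (\<rho> n * (n \<bullet> e)\<^sup>2) / (2 * \<delta>))"
    proof (rule integral_mono)
      fix n assume "n \<in> space S2"
      then have n: "norm n = 1" by (simp add: space_sphere_measure)
      show "\<rho> n - \<rho> n * indicator S n \<le> (\<rho> n * (n \<bullet> e)\<^sup>2) / (2 * \<delta>)"
      proof (cases "n \<in> S")
        case True
        then show ?thesis using pos [OF n] \<delta> by simp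
      next
        case False
        then have "\<epsilon> < \<bar>n \<bullet> e\<bar>" using n by (simp add: S_def)
        then have "\<epsilon>\<^sup>2 \<le> \<bar>n \<bullet> e\<bar>\<^sup>2" using \<epsilon> by (intro power_mono) auto
        then have "\<rho> n * (2 * \<delta>) \<le> \<rho> n * (n \<bullet> e)\<^sup>2" using \<epsilon>(3) pos [OF n] by (intro mult_left_mono) auto
        then show ?thesis using False \<delta> by (simp add: field_simps)
      qed
    qed (use int\<rho> int\<rho>S int2 in auto)
    also have "\<dots> = (LINT n|S2. \<rho> n * (n \<bullet> e)\<^sup>2) / (2 * \<delta>)" by simp
    also have "\<dots> \<le> \<delta> / (2 * \<delta>)" using second \<delta> by (intro divide_right_mono) auto
    finally show ?thesis using int\<rho> int\<rho>S one \<delta> by simp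
  qed
  have intL: "integrable S2 (\<lambda>n. L * (\<rho> n * indicator S n) - (indicator S n / \<epsilon> + 1))"
    using int\<rho>S int1S by simp
  have "(LINT n|S2. L * (\<rho> n * indicator S n) - (indicator S n / \<epsilon> + 1)) \<le> (LINT n|S2. \<rho> n * ln (\<rho> n))"
  proof (rule integral_mono [OF intL True])
    fix n assume "n \<in> space S2"
    then have n: "norm n = 1" by (simp add: space_sphere_measure)
    have "\<rho> n * (L * indicator S n) - exp (L * indicator S n) \<le> \<rho> n * ln (\<rho> n)"
      by (rule Young_entropy [OF pos [OF n]])
    \<comment> \<open>The first summand integrates to at most \<open>24\<close>, since the slab has
      measure at most \<open>24 * \<epsilon>\<close>; the second contributes the area of the sphere.
      Together they form the constant in the bound.\<close>
    moreover have "exp (L * indicator S n) \<le> indicator S n / \<epsilon> + 1"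
      using expL by (auto simp: indicator_def)
    ultimately show "L * (\<rho> n * indicator S n) - (indicator S n / \<epsilon> + 1) \<le> \<rho> n * ln (\<rho> n)"
      by (simp add: mult_ac)
  qed
  also have "(LINT n|S2. L * (\<rho> n * indicator S n) - (indicator S n / \<epsilon> + 1)) =
      L * (LINT n|S2. \<rho> n * indicator S n) - (measure S2 S / \<epsilon> + measure S2 (sphere 0 1))"
  proof -
    have "measure S2 (S \<inter> space S2) = measure S2 S" by (simp add: S_def space_sphere_measure Int_commute Int_left_commute)
    then show ?thesis using int\<rho>S int1S by (simp add: space_sphere_measure)
  qed
  finally have "L * (LINT n|S2. \<rho> n * indicator S n) - (measure S2 S / \<epsilon> + measure S2 (sphere 0 1)) \<le>
      (LINT n|S2. \<rho> n * ln (\<rho> n))" .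
  moreover have "L * (1 / 2) \<le> L * (LINT n|S2. \<rho> n * indicator S n)" using half L0 by (rule mult_left_mono)
  moreover have "measure S2 S / \<epsilon> \<le> 24"
    using sphere_measure_slab [OF e, of \<epsilon>] \<epsilon> by (simp add: S_def field_simps)
  ultimately have "ln (1 / (2 * \<delta>)) / 4 - (24 + measure S2 (sphere 0 1)) \<le> (LINT n|S2. \<rho> n * ln (\<rho> n))"
    unfolding L by simp
  then show ?thesis using True by (simp add: entropy_def)
qed

text \<open>Off \<open>Q_phy\<close> the value is infinite; on it, the entropy bound is uniform in
  \<open>\<rho>\<close> and passes to the infimum.\<close>

lemma singular_potential_lower_bound:
  assumes "norm e = 1" "0 < \<delta>" "\<delta> \<le> 1 / 2" "e \<bullet> (M *v e) + 1 / 3 \<le> \<delta>"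
  shows "ereal (ln (1 / (2 * \<delta>)) / 4 - (24 + measure S2 (sphere 0 1))) \<le> singular_potential M"
  unfolding singular_potential_def using entropy_lower_bound [OF assms(1-3) _ assms(4)] by (auto intro!: INF_greatest)

section \<open>Finiteness of the potential\<close>

text \<open>Boundedness of the density guarantees finite entropy and survives convex combinations,
  so this set can be compared with \<open>Q_phy\<close> by separation.\<close>

definition bounded_moments :: "(real^3^3) set" where
  "bounded_moments = {X. \<exists>\<rho> B. \<rho> \<in> admissible X \<and> (\<forall>n\<in>sphere 0 1. \<rho> n \<le> B)}"

lemma bounded_moments_entropy_finite:
  assumes "X \<in> bounded_moments"
  obtains \<rho> where "\<rho> \<in> admissible X" "entropy \<rho> < \<infinity>"
proof -
  obtain \<rho> B where \<rho>: "\<rho> \<in> admissible X" and B: "\<And>n. norm n = 1 \<Longrightarrow> \<rho> n \<le> B"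
    using assms unfolding bounded_moments_def mem_sphere_0 [symmetric] by blast
  have pos: "\<And>n. norm n = 1 \<Longrightarrow> 0 \<le> \<rho> n" and int: "integrable S2 \<rho>"
    using \<rho> unfolding admissible_iff mem_sphere_0 [symmetric] by blast+
  have [measurable]: "\<rho> \<in> borel_measurable S2" using int by simp
  have "\<bar>t * ln t\<bar> \<le> B\<^sup>2 + 1" if t: "0 \<le> t" "t \<le> B" for t
  proof (cases "t = 0")
    case False
    with t have t0: "t > 0" by simp
    have "t * ln t \<le> t * (t - 1)" using t0 by (intro mult_left_mono ln_le_minus_one) auto
    also have "\<dots> \<le> t\<^sup>2" using t0 by (simp add: power2_eq_square algebra_simps)
    also have "\<dots> \<le> B\<^sup>2" using t by (intro power_mono) auto
    finally have "t * ln t \<le> B\<^sup>2 + 1" by simp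
    moreover have "- 1 \<le> t * ln t" using Young_entropy [of t 0] t by simp
    ultimately show ?thesis using zero_le_power2 [of B] by (intro abs_leI) linarith+
  qed simp
  then have "AE n in S2. norm (\<rho> n * ln (\<rho> n)) \<le> B\<^sup>2 + 1"
    using pos B by (intro AE_I2) (simp add: space_sphere_measure)
  then have "integrable S2 (\<lambda>n. \<rho> n * ln (\<rho> n))"
    by (rule sphere.integrable_const_bound) measurable
  then show thesis using that [OF \<rho>] by (simp add: entropy_def)
qed

lemma convex_bounded_moments: "convex bounded_moments"
proof (rule convexI)
  fix X Y and a b :: real assume X: "X \<in> bounded_moments" and Y: "Y \<in> bounded_moments"
    and ab: "0 \<le> a" "0 \<le> b" "a + b = 1"
  obtain \<rho> B where \<rho>: "\<rho> \<in> admissible X" and B: "\<And>n. n \<in> sphere 0 1 \<Longrightarrow> \<rho> n \<le> B"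
    using X unfolding bounded_moments_def by blast
  obtain \<rho>' B' where \<rho>': "\<rho>' \<in> admissible Y" and B': "\<And>n. n \<in> sphere 0 1 \<Longrightarrow> \<rho>' n \<le> B'"
    using Y unfolding bounded_moments_def by blast
  let ?N = "(1 / 3) *\<^sub>R mat 1 :: real^3^3"
  have \<rho>_props: "\<And>n. n \<in> sphere 0 1 \<Longrightarrow> 0 \<le> \<rho> n" "\<And>n. n \<in> sphere 0 1 \<Longrightarrow> \<rho> (- n) = \<rho> n" "integrable S2 \<rho>"
    "(LINT n|S2. \<rho> n) = 1" "(LINT n|S2. \<rho> n *\<^sub>R (tensor_square n - ?N)) = X"
    using \<rho> unfolding admissible_iff by (blast intro: sym)+
  have \<rho>'_props: "\<And>n. n \<in> sphere 0 1 \<Longrightarrow> 0 \<le> \<rho>' n" "\<And>n. n \<in> sphere 0 1 \<Longrightarrow> \<rho>' (- n) = \<rho>' n" "integrable S2 \<rho>'"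
    "(LINT n|S2. \<rho>' n) = 1" "(LINT n|S2. \<rho>' n *\<^sub>R (tensor_square n - ?N)) = Y"
    using \<rho>' unfolding admissible_iff by (blast intro: sym)+
  define \<sigma> where "\<sigma> n = a * \<rho> n + b * \<rho>' n" for n
  have int: "integrable S2 (\<lambda>n. a *\<^sub>R (\<rho> n *\<^sub>R (tensor_square n - ?N)))" "integrable S2 (\<lambda>n. b *\<^sub>R (\<rho>' n *\<^sub>R (tensor_square n - ?N)))"
    by (rule integrable_scaleR_right [OF integrable_scaleR_tensor_square [OF \<rho>_props(3)]])
      (rule integrable_scaleR_right [OF integrable_scaleR_tensor_square [OF \<rho>'_props(3)]])
  have "(LINT n|S2. \<sigma> n *\<^sub>R (tensor_square n - ?N)) =
      (LINT n|S2. a *\<^sub>R (\<rho> n *\<^sub>R (tensor_square n - ?N)) + b *\<^sub>R (\<rho>' n *\<^sub>R (tensor_square n - ?N)))"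
    by (simp only: \<sigma>_def scaleR_add_left scaleR_scaleR)
  also have "\<dots> = a *\<^sub>R X + b *\<^sub>R Y"
    unfolding Bochner_Integration.integral_add [OF int] integral_scaleR_right \<rho>_props(5) \<rho>'_props(5) ..
  finally have M: "(LINT n|S2. \<sigma> n *\<^sub>R (tensor_square n - ?N)) = a *\<^sub>R X + b *\<^sub>R Y" .
  have one: "(LINT n|S2. \<sigma> n) = 1" "integrable S2 \<sigma>"
    using \<rho>_props(3,4) \<rho>'_props(3,4) ab by (simp_all add: \<sigma>_def [abs_def])
  have "0 \<le> \<sigma> n \<and> \<sigma> n = \<sigma> (- n)" if "n \<in> sphere 0 1" for n
    using \<rho>_props(1,2) [OF that] \<rho>'_props(1,2) [OF that] ab by (simp add: \<sigma>_def)
  then have adm: "\<sigma> \<in> admissible (a *\<^sub>R X + b *\<^sub>R Y)"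
    unfolding admissible_iff using M one by blast
  have "\<sigma> n \<le> a * B + b * B'" if "n \<in> sphere 0 1" for n
    unfolding \<sigma>_def using B [OF that] B' [OF that] ab by (intro add_mono mult_left_mono) auto
  with adm show "a *\<^sub>R X + b *\<^sub>R Y \<in> bounded_moments"
    unfolding bounded_moments_def by blast
qed

text \<open>Uniform densities on small pairs of antipodal caps around \<open>\<plusminus>n\<close>.\<close>

lemma bounded_moments_approx:
  fixes A :: "real^3^3"
  assumes n: "norm n = 1" and \<epsilon>: "\<epsilon> > 0"
  obtains X where "X \<in> bounded_moments" "A \<bullet> X \<le> n \<bullet> (A *v n) - trace A / 3 + \<epsilon>"
proof -
  define q where "q m = m \<bullet> (A *v m)" for m
  have q: "continuous_on UNIV q" unfolding q_def by (intro continuous_intros)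
  \<comment> \<open>A sublevel set of the form serves as the pair of caps: it is open, contains
    \<open>n\<close>, and is symmetric because a quadratic form is even.\<close>
  define U where "U = {m. q m < q n + \<epsilon>}"
  have U: "open U" unfolding U_def by (intro open_Collect_less continuous_intros q)
  have even: "- m \<in> U \<longleftrightarrow> m \<in> U" for m
    using matrix_vector_mult_scaleR [of A "- 1" m] by (simp add: U_def q_def)
  define C where "C = sphere 0 1 \<inter> U"
  have C: "C \<in> sets S2" unfolding C_def using U by (intro in_sets_sphere_measure) auto
  define c where "c = measure S2 C"
  have c: "c > 0" unfolding c_def C_def by (rule sphere_measure_open_pos [OF U _ n]) (simp add: U_def \<epsilon>)
  define \<rho> where "\<rho> m = indicator C m / c" for m
  have intC: "integrable S2 (indicat_real C)"
    using C by (intro integrable_real_indicator) (auto simp: sphere.emeasure_eq_measure)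
  have int: "integrable S2 \<rho>" unfolding \<rho>_def [abs_def] using intC by simp
  have "measure S2 (C \<inter> space S2) = c" unfolding space_sphere_measure c_def C_def by (simp add: Int_commute Int_left_commute)
  then have one: "(LINT m|S2. \<rho> m) = 1" using c by (simp add: \<rho>_def)
  define X where "X = (LINT m|S2. \<rho> m *\<^sub>R (tensor_square m - (1 / 3) *\<^sub>R mat 1))"
  have "0 \<le> \<rho> m \<and> \<rho> m = \<rho> (- m)" if "m \<in> sphere 0 1" for m
    using c that even [of m] by (auto simp: \<rho>_def C_def indicator_def)
  then have adm: "\<rho> \<in> admissible X" unfolding admissible_iff using int one X_def by blast
  have "\<rho> m \<le> 1 / c" for m using c by (auto simp: \<rho>_def indicator_def)
  with adm have X: "X \<in> bounded_moments" unfolding bounded_moments_def by blast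
  have "(LINT m|S2. \<rho> m * q m) \<le> (LINT m|S2. \<rho> m * (q n + \<epsilon>))"
  proof (rule integral_mono)
    show "integrable S2 (\<lambda>m. \<rho> m * q m)" unfolding q_def by (rule inner_admissible(2) [OF adm])
    show "\<rho> m * q m \<le> \<rho> m * (q n + \<epsilon>)" for m
      using c by (auto simp: \<rho>_def C_def U_def indicator_def intro!: divide_right_mono)
  qed (use int in simp)
  then have "(LINT m|S2. \<rho> m * q m) \<le> q n + \<epsilon>" using one int by simp
  then have "A \<bullet> X \<le> n \<bullet> (A *v n) - trace A / 3 + \<epsilon>"
    using inner_admissible(1) [OF adm, of A] by (simp add: q_def)
  with X show thesis by (rule that)
qed

lemma subspace_Q_tensors: "subspace Q_tensors"
  by (auto simp: subspace_def Q_tensors_iff_entries inner_add_left)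

lemma Q_tensors_decomposition:
  obtains B N where "A = B + N" "B \<in> Q_tensors" "\<And>C. C \<in> Q_tensors \<Longrightarrow> N \<bullet> C = 0"
proof -
  have span: "span Q_tensors = Q_tensors" by (simp only: span_eq_iff subspace_Q_tensors)
  obtain B N where "A = B + N" "B \<in> Q_tensors" "\<And>C. C \<in> Q_tensors \<Longrightarrow> orthogonal N C"
    using orthogonal_subspace_decomp_exists [of Q_tensors A] unfolding span by blast
  then show thesis by (intro that) (simp_all add: orthogonal_def)
qed

text \<open>The component of \<open>X\<close> orthogonal to \<open>Q_tensors\<close> annihilates the
  integrand at every point of the sphere, hence annihilates \<open>X\<close> and therefore
  itself.\<close>

lemma bounded_moments_subset: "bounded_moments \<subseteq> Q_tensors"
proof
  fix X assume "X \<in> bounded_moments"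
  then obtain \<rho> where "\<rho> \<in> admissible X" unfolding bounded_moments_def by blast
  then have int: "integrable S2 \<rho>" and X: "(LINT n|S2. \<rho> n *\<^sub>R (tensor_square n - (1 / 3) *\<^sub>R mat 1)) = X"
    unfolding admissible_iff by blast+
  obtain B N where BN: "X = B + N" "B \<in> Q_tensors" "\<And>C. C \<in> Q_tensors \<Longrightarrow> N \<bullet> C = 0"
    by (rule Q_tensors_decomposition [of X]) blast
  have Q: "tensor_square n - (1 / 3) *\<^sub>R mat 1 \<in> Q_tensors" if "norm n = 1" for n :: "real^3"
  proof -
    have "trace (tensor_square n - (1 / 3) *\<^sub>R mat 1) = 0"
      using that by (simp add: inner_mat_1 [symmetric] inner_diff_left)
        (simp add: inner_mat_1 trace_tensor_square trace_I)
    moreover have "transpose (tensor_square n - (1 / 3) *\<^sub>R mat 1) = tensor_square n - (1 / 3) *\<^sub>R mat 1"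
      by (simp add: vec_eq_iff transpose_def tensor_square_def mat_def mult.commute)
    ultimately show ?thesis by (simp add: Q_tensors_iff)
  qed
  have "N \<bullet> X = (LINT n|S2. N \<bullet> (\<rho> n *\<^sub>R (tensor_square n - (1 / 3) *\<^sub>R mat 1)))"
    using integral_inner_right [OF integrable_scaleR_tensor_square [OF int]] X by simp
  also have "\<dots> = (LINT n|S2. 0)"
    by (rule Bochner_Integration.integral_cong) (auto simp: space_sphere_measure BN(3) Q)
  finally have "N \<bullet> N = 0" using BN(3) [OF BN(2)] by (simp add: BN(1) inner_add_right)
  then show "X \<in> Q_tensors" using BN by simp
qed

text \<open>A functional \<open>a\<close> separating \<open>M\<close> from the moments would, tested
  on near point masses, satisfy \<open>a \<bullet> M \<le> n \<bullet> (a *v n)\<close> for every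
  unit \<open>n\<close>. But \<open>M\<close> is itself an average of the traceless tensors at its
  eigenvectors, with weights \<open>l k + 1/3\<close> that are positive on \<open>Q_phy\<close> and
  sum to one. So equality holds at each eigenvector, and this forces \<open>a = 0\<close>.\<close>

lemma Q_phy_subset_bounded_moments: "Q_phy \<subseteq> bounded_moments"
proof
  fix M assume M: "M \<in> Q_phy"
  then have MQ: "M \<in> Q_tensors" by (simp add: Q_phy_def)
  define V where "V = {N :: real^3^3. \<forall>B\<in>Q_tensors. N \<bullet> B = 0}"
  have V: "subspace V" by (auto simp: subspace_def V_def inner_add_left)
  \<comment> \<open>In the full matrix space a separating functional might be orthogonal to
    \<open>Q_tensors\<close> and carry no information about \<open>M\<close>. Thickening by the
    orthogonal complement \<open>V\<close> forces it into \<open>Q_tensors\<close>.\<close>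
  define T where "T = {X + N | X N. X \<in> bounded_moments \<and> N \<in> V}"
  have "convex T"
  proof -
    have "convex (\<Union>x\<in>bounded_moments. \<Union>y\<in>V. {x + y})"
      by (intro convex_sums convex_bounded_moments subspace_imp_convex V)
    moreover have "(\<Union>x\<in>bounded_moments. \<Union>y\<in>V. {x + y}) = T" by (auto simp: T_def)
    ultimately show ?thesis by simp
  qed
  show "M \<in> bounded_moments"
  proof (rule ccontr)
    assume "M \<notin> bounded_moments"
    have "M \<notin> T"
    proof
      assume "M \<in> T"
      then obtain X N where X: "X \<in> bounded_moments" "N \<in> V" "M = X + N" unfolding T_def by blast
      have XQ: "X \<in> Q_tensors" using X(1) bounded_moments_subset by blast
      have "N \<bullet> M = 0" "N \<bullet> X = 0" using X(2) MQ XQ by (auto simp: V_def)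
      then have "N \<bullet> N = 0" using X(3) by (simp add: inner_add_right)
      then have "M = X" using X(3) by simp
      then show False using X(1) \<open>M \<notin> bounded_moments\<close> by simp
    qed
    obtain X0 where X0: "X0 \<in> bounded_moments" using bounded_moments_approx [of "axis 1 1" 1 0] by auto
    have "0 \<in> V" by (simp add: V_def)
    then have sub: "bounded_moments \<subseteq> T" unfolding T_def by force
    then have "T \<noteq> {}" using X0 by blast
    then obtain a b where a: "a \<noteq> 0" and aM: "a \<bullet> M \<le> b" and aT: "\<And>t. t \<in> T \<Longrightarrow> b \<le> a \<bullet> t"
      using separating_hyperplane_sets [of "{M}" T] \<open>convex T\<close> \<open>M \<notin> T\<close> sub X0 by auto
    have aV: "a \<bullet> N = 0" if N: "N \<in> V" for N
    proof (rule ccontr)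
      assume nz: "a \<bullet> N \<noteq> 0"
      \<comment> \<open>With this \<open>c\<close> the functional takes the value
        \<open>b - 1\<close> at \<open>X0 + c *\<^sub>R N\<close>, below its lower bound
        \<open>b\<close> on \<open>T\<close>.\<close>
      define c where "c = (b - a \<bullet> X0 - 1) / (a \<bullet> N)"
      have "X0 + c *\<^sub>R N \<in> T" unfolding T_def using X0 subspace_scale [OF V N] by blast
      from aT [OF this] show False using nz by (simp add: inner_add_right c_def)
    qed
    obtain B N where BN: "a = B + N" "B \<in> Q_tensors" "\<And>C. C \<in> Q_tensors \<Longrightarrow> N \<bullet> C = 0"
      by (rule Q_tensors_decomposition [of a]) blast
    then have "a \<bullet> N = 0" by (intro aV) (simp add: V_def)
    then have "N \<bullet> N = 0" using BN(3) [OF BN(2)] by (simp add: BN(1) inner_add_left inner_commute [of B])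
    then have "a \<in> Q_tensors" using BN by simp
    then have tra: "trace a = 0" and syma: "transpose a = a" by (simp_all add: Q_tensors_iff)
    have ge: "a \<bullet> M \<le> n \<bullet> (a *v n)" if n: "norm n = 1" for n
    proof (rule field_le_epsilon)
      fix \<epsilon> :: real assume "\<epsilon> > 0"
      from bounded_moments_approx [OF n this, of a]
      obtain X where X: "X \<in> bounded_moments" "a \<bullet> X \<le> n \<bullet> (a *v n) - trace a / 3 + \<epsilon>" by blast
      have "b \<le> a \<bullet> X" using X(1) sub by (intro aT) auto
      then show "a \<bullet> M \<le> n \<bullet> (a *v n) + \<epsilon>" using X(2) aM tra by simp
    qed
    have "transpose M = M" using MQ by (simp add: Q_tensors_iff)
    then obtain e :: "3 \<Rightarrow> real^3" and l where e: "\<And>i j. e i \<bullet> e j = (if i = j then 1 else 0)"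
      and l: "\<And>i j. e i \<bullet> (M *v e j) = (if i = j then l i else 0)"
      using symmetric_diagonalizable_3 by blast
    have "\<forall>i. - 1 / 3 < l i" using Q_phy_iff [OF MQ e l] M by blast
    then have l_pos: "l i + 1 / 3 > 0" for i by (auto dest: spec [of _ i])
    have ne: "norm (e i) = 1" for i using e [of i i] by (simp add: norm_eq_1)
    have aM_eq: "a \<bullet> M = (\<Sum>k\<in>UNIV. l k * (e k \<bullet> (a *v e k)))"
      by (subst eq_sum_tensor_square [OF e l]) (simp add: inner_sum_right inner_tensor_square)
    have tr_eq: "(\<Sum>k\<in>UNIV. e k \<bullet> (a *v e k)) = 0" using sum_inner_basis_eq_trace [OF e, of a] tra by simp
    have l_sum: "(\<Sum>k\<in>UNIV. l k) = 0"
    proof -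
      have "(\<Sum>k\<in>UNIV. l k) = (\<Sum>k\<in>UNIV. e k \<bullet> (M *v e k))" by (intro sum.cong) (simp_all only: l refl if_True)
      then show ?thesis using sum_inner_basis_eq_trace [OF e, of M] MQ by (simp add: Q_tensors_iff)
    qed
    \<comment> \<open>The weighted slacks of the inequality \<open>ge\<close> at the eigenvectors
      sum to zero; as none is negative, all of them vanish.\<close>
    have "(\<Sum>k\<in>UNIV. (l k + 1 / 3) * (e k \<bullet> (a *v e k) - a \<bullet> M)) =
        (\<Sum>k\<in>UNIV. l k * (e k \<bullet> (a *v e k))) + (1 / 3) * (\<Sum>k\<in>UNIV. e k \<bullet> (a *v e k)) -
        (a \<bullet> M) * (\<Sum>k\<in>UNIV. l k) - (\<Sum>k\<in>(UNIV :: 3 set). (a \<bullet> M) / 3)"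
      unfolding sum_distrib_left sum_subtractf [symmetric] sum.distrib [symmetric]
      by (intro sum.cong) (simp_all add: algebra_simps)
    also have "\<dots> = 0" using aM_eq tr_eq l_sum by simp
    finally have "(\<Sum>k\<in>UNIV. (l k + 1 / 3) * (e k \<bullet> (a *v e k) - a \<bullet> M)) = 0" .
    moreover have "0 \<le> (l k + 1 / 3) * (e k \<bullet> (a *v e k) - a \<bullet> M)" for k
      using l_pos [of k] ge [OF ne [of k]] by (intro mult_nonneg_nonneg) auto
    ultimately have zero: "(l k + 1 / 3) * (e k \<bullet> (a *v e k) - a \<bullet> M) = 0" for k
      by (simp add: sum_nonneg_eq_0_iff)
    have diag: "e k \<bullet> (a *v e k) = a \<bullet> M" for k
      using zero [of k] l_pos [of k] unfolding mult_eq_0_iff by (elim disjE) linarith+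
    then have "(\<Sum>k\<in>(UNIV :: 3 set). a \<bullet> M) = 0" using tr_eq by simp
    then have aM0: "a \<bullet> M = 0" by simp
    have psd: "0 \<le> w \<bullet> (a *v w)" for w
    proof (cases "w = 0")
      case False
      then have "0 \<le> (w /\<^sub>R norm w) \<bullet> (a *v (w /\<^sub>R norm w))" using ge [of "w /\<^sub>R norm w"] aM0 by simp
      then have "0 \<le> inverse (norm w) * (inverse (norm w) * (w \<bullet> (a *v w)))"
        by (simp only: matrix_vector_mult_scaleR inner_scaleR_left inner_scaleR_right)
      then show ?thesis using False by (simp add: zero_le_mult_iff)
    qed simp
    \<comment> \<open>A positive semidefinite form with zero diagonal vanishes: at
      \<open>e i + t *\<^sub>R e j\<close> it is linear in \<open>t\<close>, and both signs of
      \<open>t\<close> are allowed.\<close>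
    have "e i \<bullet> (a *v e j) = 0" for i j
    proof -
      have d: "e k \<bullet> (a *v e k) = 0" for k using diag aM0 by simp
      have *: "(e i + t *\<^sub>R e j) \<bullet> (a *v (e i + t *\<^sub>R e j)) = 2 * t * (e i \<bullet> (a *v e j))" for t
        using symmetric_matrix_inner [OF syma, of "e i" "e j"]
        by (simp add: matrix_vector_right_distrib matrix_vector_mult_scaleR inner_add_left inner_add_right d)
      show ?thesis using psd [of "e i + 1 *\<^sub>R e j"] psd [of "e i + (- 1) *\<^sub>R e j"] unfolding * by linarith
    qed
    then have "a = 0" by (rule matrix_eq_0_if_basis_entries_0 [OF e])
    with a show False by contradiction
  qed
qed

text \<open>Used contrapositively: a tensor at which the potential is infinite lies outside
  \<open>Q_phy\<close>, so it has an eigenvalue of at most \<open>- 1/3\<close>.\<close>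

lemma singular_potential_finite:
  assumes "M \<in> Q_phy"
  shows "singular_potential M < \<infinity>"
proof -
  obtain \<rho> where "\<rho> \<in> admissible M" "entropy \<rho> < \<infinity>"
    using bounded_moments_entropy_finite Q_phy_subset_bounded_moments assms by blast
  moreover from this have "singular_potential M \<le> entropy \<rho>"
    using assms by (simp add: singular_potential_def INF_lower)
  ultimately show ?thesis by (blast intro: le_less_trans)
qed

section \<open>The contact set\<close>

lemma continuous_representative_props:
  assumes "continuous_on \<Omega> G" "AE x in lebesgue. x \<in> \<Omega> \<longrightarrow> G x = F x"
  shows "continuous_on \<Omega> (continuous_representative \<Omega> F)"
    and "AE x in lebesgue. x \<in> \<Omega> \<longrightarrow> continuous_representative \<Omega> F x = F x"
  unfolding continuous_representative_def
  using someI [of "\<lambda>G. continuous_on \<Omega> G \<and> (AE x in lebesgue. x \<in> \<Omega> \<longrightarrow> G x = F x)" G] assms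
  by simp_all

text \<open>The points of the domain where \<open>G\<close> leaves \<open>K\<close> form an open
  set; being null, it is empty.\<close>

lemma AE_closed_imp_all:
  fixes G :: "'a::euclidean_space \<Rightarrow> 'b::metric_space"
  assumes \<Omega>: "open \<Omega>" and G: "continuous_on \<Omega> G" and K: "closed K"
    and ae: "AE x in lebesgue. x \<in> \<Omega> \<longrightarrow> G x \<in> K" and x: "x \<in> \<Omega>"
  shows "G x \<in> K"
proof (rule ccontr)
  assume "G x \<notin> K"
  define U where "U = \<Omega> \<inter> G -` (- K)"
  have "open U" unfolding U_def using \<Omega> G K by (intro continuous_open_preimage) auto
  moreover have "x \<in> U" using x \<open>G x \<notin> K\<close> by (simp add: U_def)
  ultimately have "\<not> negligible U" using open_not_negligible by blast
  moreover have "AE x in lebesgue. x \<notin> U" using ae by eventually_elim (auto simp: U_def)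
  then have "negligible U"
    using \<open>open U\<close> by (simp add: AE_iff_null_sets negligible_iff_null_sets)
  ultimately show False by contradiction
qed

lemma closed_Q_tensors: "closed Q_tensors"
proof -
  have eq: "Q_tensors = {M. M \<bullet> mat 1 = 0} \<inter> {M. \<forall>i j. M $ i $ j = M $ j $ i}"
    by (auto simp: Q_tensors_iff_entries)
  show ?thesis
    unfolding eq by (intro closed_Int closed_Collect_all closed_Collect_eq continuous_intros)
qed

lemma mollify_lower_bound:
  fixes x :: "'a::euclidean_space"
  assumes \<kappa>: "mollifier \<kappa>" and u: "locally_integrable \<Omega> u" and t: "cball x t \<subseteq> \<Omega>" "t > 0"
    and K: "AE y in lebesgue. y \<in> cball x t \<longrightarrow> K \<le> u y"
  shows "K \<le> mollify \<kappa> \<Omega> u t x"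
proof -
  have tf: "test_function (ball 0 1) \<kappa>" and \<kappa>0: "\<And>z. \<kappa> z \<ge> 0" and \<kappa>1: "(LINT z|lborel. \<kappa> z) = 1"
    using \<kappa> by (auto simp: mollifier_def)
  have \<kappa>m: "\<kappa> \<in> borel_measurable borel"
    using test_function_continuous [OF tf] by (rule borel_measurable_continuous_onI)
  define k where "k y = \<kappa> ((y - x) /\<^sub>R t) / t ^ DIM('a)" for y
  have k_tf: "test_function \<Omega> k" using test_function_kernel [OF tf t] by (simp add: k_def [abs_def])
  have km: "k \<in> borel_measurable borel"
    using test_function_continuous [OF k_tf] by (rule borel_measurable_continuous_onI)
  have "(LINT y|lborel. k y) = (LINT z|lborel. \<kappa> (- z))"
  proof -
    have "(\<lambda>z. \<kappa> (- z)) \<in> borel_measurable borel" by (rule measurable_compose [OF _ \<kappa>m]) simp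
    from integral_reflect_rescale [of "\<lambda>_. 1", OF _ this t(2), of x]
    show ?thesis by (simp add: k_def flip: scaleR_minus_right)
  qed
  \<comment> \<open>The first substitution leaves the reflected kernel; the same rule with scale
    \<open>1\<close> and centre \<open>0\<close> undoes the reflection.\<close>
  also have "\<dots> = 1" using integral_reflect_rescale [of "\<lambda>_. 1" \<kappa> 1 0] \<kappa>m \<kappa>1 by simp
  finally have k1: "(LINT y|lborel. k y) = 1" .
  have kint: "integrable lborel k"
  proof (rule ccontr)
    assume "\<not> ?thesis"
    \<comment> \<open>A nonintegrable function has integral \<open>0\<close> by default, so an
      integral equal to \<open>1\<close> already proves integrability.\<close>
    then show False using k1 not_integrable_integral_eq by fastforce
  qed
  have kl: "integrable lebesgue k" "(LINT y|lebesgue. k y) = 1"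
    using integrable_completion [of k lborel] integral_completion [of k lborel] km kint k1 by simp_all
  have "(LINT y|lebesgue. K * k y) \<le> (LINT y|lebesgue. indicator \<Omega> y *\<^sub>R (u y * k y))"
  proof (rule integral_mono_AE)
    show "integrable lebesgue (\<lambda>y. indicator \<Omega> y *\<^sub>R (u y * k y))"
      using set_integrable_mult_test_function [OF u k_tf] by (simp add: set_integrable_def)
    show "AE y in lebesgue. K * k y \<le> indicator \<Omega> y *\<^sub>R (u y * k y)"
      using K
    proof eventually_elim
      case (elim y)
      show ?case
      proof (cases "y \<in> cball x t")
        case True
        then have "y \<in> \<Omega>" "K \<le> u y" using elim t(1) by blast+
        moreover have "k y \<ge> 0" using \<kappa>0 t(2) by (simp add: k_def)
        ultimately show ?thesis by (simp add: mult_right_mono)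
      next
        case False
        then have "k y = 0"
          unfolding k_def using test_function_eq_0 [OF tf rescale_notin_unit_ball [OF False t(2) order_refl]] by simp
        then show ?thesis by simp
      qed
    qed
  qed (use kl in simp)
  moreover have "(LINT y|lebesgue. K * k y) = K"
    unfolding integral_mult_right_zero kl(2) by simp
  moreover have "mollify \<kappa> \<Omega> u t x = (LINT y|lebesgue. indicator \<Omega> y *\<^sub>R (u y * k y))"
    by (simp only: mollify_def set_lebesgue_integral_def k_def)
  ultimately show ?thesis by (simp only:)
qed

text \<open>Evaluated at the unit vector \<open>e\<close> with \<open>e \<bullet> G(x0) e \<le> -1/3\<close>, Hoelder continuity bounds
  \<open>e \<bullet> G(x) e + 1/3\<close> by a multiple of \<open>dist x x0 powr (1/10)\<close>.\<close>

lemma potential_log_blowup: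
  fixes G :: "'a::metric_space \<Rightarrow> real^3^3"
  assumes G: "\<And>i j. \<exists>C r. C \<ge> 0 \<and> r > 0 \<and> (\<forall>x\<in>ball x0 r. \<bar>G x $ i $ j - G x0 $ i $ j\<bar> \<le> C * dist x x0 powr (1 / 10))"
    and Q: "G x0 \<in> Q_tensors" and inf: "singular_potential (G x0) = \<infinity>"
  obtains K r where "r > 0" "\<And>x. x \<in> ball x0 r \<Longrightarrow> x \<noteq> x0 \<Longrightarrow> ereal (ln (1 / dist x x0) / 40 - K) \<le> singular_potential (G x)"
proof -
  have "G x0 \<notin> Q_phy" using singular_potential_finite [of "G x0"] inf by auto
  then obtain e where e: "norm e = 1" "e \<bullet> (G x0 *v e) \<le> - 1 / 3" using Q_tensor_not_Q_phyE [OF Q] by blast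
  have "\<forall>p. \<exists>C r. C \<ge> 0 \<and> r > 0 \<and> (\<forall>x\<in>ball x0 r. \<bar>G x $ fst p $ snd p - G x0 $ fst p $ snd p\<bar> \<le> C * dist x x0 powr (1 / 10))"
    using G by blast
  then obtain C r where C: "\<And>p. C p \<ge> (0::real)" and r: "\<And>p. r p > (0::real)"
    and Hol: "\<And>p x. x \<in> ball x0 (r p) \<Longrightarrow> \<bar>G x $ fst p $ snd p - G x0 $ fst p $ snd p\<bar> \<le> C p * dist x x0 powr (1 / 10)"
    by metis
  \<comment> \<open>The sum runs over the nine entries, whose coefficients
    \<open>e $ i * e $ j\<close> have modulus at most one; the summand \<open>1\<close> keeps
    \<open>A\<close> positive for the divisions below.\<close>
  define A where "A = 1 + (\<Sum>p\<in>UNIV. C p)"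
  have A: "A \<ge> 1" using C by (simp add: A_def sum_nonneg)
  \<comment> \<open>The second bound on the radius gives
    \<open>A * d powr (1 / 10) \<le> 1 / 2\<close>, the range of \<open>\<delta>\<close> in the
    entropy estimate.\<close>
  define r0 where "r0 = min (Min (range r)) ((1 / (2 * A)) powr 10)"
  have "Min (range r) > 0" using r by (subst Min_gr_iff) auto
  then have r0: "r0 > 0" using A by (simp add: r0_def)
  show thesis
  proof (rule that [OF r0])
    fix x assume x: "x \<in> ball x0 r0" "x \<noteq> x0"
    define d where "d = dist x x0"
    have d: "0 < d" "d < r0" using x by (auto simp: d_def dist_commute)
    have xr: "x \<in> ball x0 (r p)" for p
    proof -
      have "Min (range r) \<le> r p" by (intro Min_le) auto
      moreover have "r0 \<le> Min (range r)" unfolding r0_def by (rule min.cobounded1)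
      ultimately have "d < r p" using d(2) by linarith
      then show ?thesis by (simp add: d_def dist_commute)
    qed
    define \<delta> where "\<delta> = A * d powr (1 / 10)"
    have \<delta>0: "\<delta> > 0" using A d by (simp add: \<delta>_def)
    have "d powr (1 / 10) \<le> ((1 / (2 * A)) powr 10) powr (1 / 10)"
      using d by (intro powr_mono2) (auto simp: r0_def)
    also have "\<dots> = 1 / (2 * A)" unfolding powr_powr using A by simp
    finally have "\<delta> \<le> A * (1 / (2 * A))" unfolding \<delta>_def using A by (intro mult_left_mono) auto
    then have \<delta>12: "\<delta> \<le> 1 / 2" using A by simp
    have "e \<bullet> (G x *v e) - e \<bullet> (G x0 *v e) = (\<Sum>i\<in>UNIV. \<Sum>j\<in>UNIV. (G x $ i $ j - G x0 $ i $ j) * (e $ i * e $ j))"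
      by (simp add: inner_vec_def matrix_vector_mult_def sum_distrib_left sum_subtractf [symmetric] algebra_simps)
    also have "\<dots> \<le> (\<Sum>i\<in>UNIV. \<Sum>j\<in>UNIV. C (i, j) * d powr (1 / 10))"
    proof (intro sum_mono)
      fix i j
      have "(G x $ i $ j - G x0 $ i $ j) * (e $ i * e $ j) \<le> \<bar>G x $ i $ j - G x0 $ i $ j\<bar> * (\<bar>e $ i\<bar> * \<bar>e $ j\<bar>)"
        by (simp add: abs_mult [symmetric])
      also have "\<dots> \<le> (C (i, j) * d powr (1 / 10)) * (1 * 1)"
        using Hol [OF xr, of "(i, j)"] component_le_norm_cart [of e] e(1) C [of "(i, j)"]
        by (intro mult_mono) (auto simp: d_def)
      finally show "(G x $ i $ j - G x0 $ i $ j) * (e $ i * e $ j) \<le> C (i, j) * d powr (1 / 10)" by simp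
    qed
    also have "\<dots> = (\<Sum>p\<in>UNIV. C p) * d powr (1 / 10)"
      by (simp add: sum.cartesian_product sum_distrib_right)
    also have "\<dots> \<le> \<delta>" unfolding \<delta>_def A_def by (intro mult_right_mono) auto
    finally have "e \<bullet> (G x *v e) + 1 / 3 \<le> \<delta>" using e(2) by simp
    from singular_potential_lower_bound [OF e(1) \<delta>0 \<delta>12 this]
    have bound: "ereal (ln (1 / (2 * \<delta>)) / 4 - (24 + measure S2 (sphere 0 1))) \<le> singular_potential (G x)" .
    \<comment> \<open>The Hoelder exponent \<open>1/10\<close> and the entropy factor
      \<open>1/4\<close> multiply to \<open>1/40\<close>.\<close>
    have "ln (1 / (2 * \<delta>)) / 4 = ln (1 / d) / 40 - ln (2 * A) / 4"
      using A d by (simp add: \<delta>_def ln_div ln_mult ln_powr field_simps)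
    then have "ln (1 / dist x x0) / 40 - (ln (2 * A) / 4 + 24 + measure S2 (sphere 0 1)) =
        ln (1 / (2 * \<delta>)) / 4 - (24 + measure S2 (sphere 0 1))"
      unfolding d_def by linarith
    with bound show "ereal (ln (1 / dist x x0) / 40 - (ln (2 * A) / 4 + 24 + measure S2 (sphere 0 1))) \<le> singular_potential (G x)"
      by (simp only:)
  qed
qed

lemma hausdorff_dim_le:
  assumes "\<And>\<epsilon>. \<epsilon> > 0 \<Longrightarrow> hausdorff_measure (1 + \<epsilon>) A = 0"
  shows "hausdorff_dim A \<le> 1"
proof (rule ereal_le_epsilon2)
  fix \<epsilon> :: real assume "\<epsilon> > 0"
  then have "hausdorff_dim A \<le> ereal (1 + \<epsilon>)"
    unfolding hausdorff_dim_def using assms by (intro INF_lower) auto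
  then show "hausdorff_dim A \<le> 1 + ereal \<epsilon>" by (simp add: one_ereal_def)
qed

theorem theorem1p2:
  fixes \<Omega> :: "(real^'n) set" and Q :: "real^'n \<Rightarrow> real^3^3"
  assumes "CARD('n) = 2 \<or> CARD('n) = 3"
    and "bounded_domain \<Omega>"
    and "sobolev_H_into 2 \<Omega> Q_phy_closure Q"
    and "sobolev_H_ereal 1 \<Omega> (\<lambda>x. singular_potential (Q x))"
  shows "(CARD('n) = 2 \<longrightarrow> contact_set \<Omega> Q = {}) \<and>
         (CARD('n) = 3 \<longrightarrow> hausdorff_dim (contact_set \<Omega> Q) \<le> 1 \<and>
            (\<forall>\<epsilon>::real. \<epsilon> > 0 \<longrightarrow> hausdorff_measure (1 + \<epsilon>) (contact_set \<Omega> Q) = 0))"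
proof -
  have \<Omega>: "open \<Omega>" using assms(2) by (simp add: bounded_domain_def)
  have dim: "DIM(real^'n) \<le> 3" "DIM(real^'n) = CARD('n)" using assms(1) by auto
  have H2: "sobolev_H 2 \<Omega> (\<lambda>x. Q x $ i $ j)" for i j using assms(3) by (simp add: sobolev_H_into_def)
  have "\<forall>p. \<exists>g. continuous_on \<Omega> g \<and> (AE x in lebesgue. x \<in> \<Omega> \<longrightarrow> g x = Q x $ fst p $ snd p) \<and>
      (\<forall>x0\<in>\<Omega>. \<exists>C r. C \<ge> 0 \<and> r > 0 \<and> (\<forall>x\<in>ball x0 r. \<bar>g x - g x0\<bar> \<le> C * dist x x0 powr (1 / 10)))"
  proof
    fix p :: "3 \<times> 3"
    show "\<exists>g. continuous_on \<Omega> g \<and> (AE x in lebesgue. x \<in> \<Omega> \<longrightarrow> g x = Q x $ fst p $ snd p) \<and>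
      (\<forall>x0\<in>\<Omega>. \<exists>C r. C \<ge> 0 \<and> r > 0 \<and> (\<forall>x\<in>ball x0 r. \<bar>g x - g x0\<bar> \<le> C * dist x x0 powr (1 / 10)))"
      by (rule sobolev_2_continuous_representative [OF \<Omega> dim(1) H2 [of "fst p" "snd p"]]) blast
  qed
  from choice [OF this] obtain g where g: "\<And>p. continuous_on \<Omega> (g p)"
    "\<And>p. AE x in lebesgue. x \<in> \<Omega> \<longrightarrow> g p x = Q x $ fst p $ snd p"
    "\<And>p x0. x0 \<in> \<Omega> \<Longrightarrow> \<exists>C r. C \<ge> 0 \<and> r > 0 \<and> (\<forall>x\<in>ball x0 r. \<bar>g p x - g p x0\<bar> \<le> C * dist x x0 powr (1 / 10))"
    by blast
  define G where "G x = (\<chi> i j. g (i, j) x)" for x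
  have Gc: "continuous_on \<Omega> G" unfolding G_def by (intro continuous_intros g(1))
  have "AE x in lebesgue. \<forall>p\<in>UNIV. x \<in> \<Omega> \<longrightarrow> g p x = Q x $ fst p $ snd p"
    using g(2) by (subst AE_ball_countable) auto
  then have GQ: "AE x in lebesgue. x \<in> \<Omega> \<longrightarrow> G x = Q x"
    by eventually_elim (auto simp: G_def vec_eq_iff)
  define R where "R = continuous_representative \<Omega> Q"
  have Rc: "continuous_on \<Omega> R" and RQ: "AE x in lebesgue. x \<in> \<Omega> \<longrightarrow> R x = Q x"
    unfolding R_def by (rule continuous_representative_props [OF Gc GQ])+
  \<comment> \<open>\<open>R\<close> comes from a choice operator and is known only to be continuous
    and almost everywhere equal to \<open>Q\<close>. Agreement with \<open>G\<close> on the open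
    domain transfers the Hoelder bounds to it.\<close>
  have RG: "R x = G x" if "x \<in> \<Omega>" for x
  proof -
    have "AE x in lebesgue. x \<in> \<Omega> \<longrightarrow> R x - G x \<in> {0}"
      using RQ GQ by eventually_elim auto
    then have "R x - G x \<in> {0}"
      by (rule AE_closed_imp_all [OF \<Omega> continuous_on_diff [OF Rc Gc] closed_singleton _ that])
    then show ?thesis by simp
  qed
  have GT: "G x \<in> Q_tensors" if "x \<in> \<Omega>" for x
  proof -
    have "Q_phy_closure \<subseteq> Q_tensors"
      unfolding Q_phy_closure_def using closure_of_subset_topspace [of "top_of_set Q_tensors"] by auto
    then have "AE x in lebesgue. x \<in> \<Omega> \<longrightarrow> Q x \<in> Q_tensors"
      using assms(3) unfolding sobolev_H_into_def by (auto elim!: eventually_mono)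
    with GQ have "AE x in lebesgue. x \<in> \<Omega> \<longrightarrow> G x \<in> Q_tensors" by eventually_elim auto
    then show ?thesis by (rule AE_closed_imp_all [OF \<Omega> Gc closed_Q_tensors _ that])
  qed
  obtain u where u: "sobolev_H 1 \<Omega> u" and uQ: "AE x in lebesgue. x \<in> \<Omega> \<longrightarrow> singular_potential (Q x) = ereal (u x)"
    using assms(4) unfolding sobolev_H_ereal_def by blast
  have uG: "AE x in lebesgue. x \<in> \<Omega> \<longrightarrow> singular_potential (G x) = ereal (u x)"
    using uQ GQ by eventually_elim auto
  obtain v where v: "\<And>b. b \<in> Basis \<Longrightarrow> weak_partial \<Omega> b u (v b)" "\<And>b. b \<in> Basis \<Longrightarrow> L2_on \<Omega> (v b)"
    using sobolev_H_1D [OF u] by blast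
  have li: "locally_integrable \<Omega> u" using v(1) [OF SOME_Basis] by (simp add: weak_partial_def)
  obtain \<kappa> :: "real^'n \<Rightarrow> real" where mol: "mollifier \<kappa>" by (rule mollifier_exists)
  then have \<kappa>: "test_function (ball 0 1) \<kappa>" by (simp add: mollifier_def)
  \<comment> \<open>The bound on the potential holds off \<open>x0\<close>, hence for
    \<open>u\<close> almost everywhere nearby. On \<open>cball x0 t\<close> it is smallest at the
    rim, with the value \<open>ln (1 / t) / 40 - K\<close>, and averaging preserves it.\<close>
  have blowup: "\<exists>K r. r > 0 \<and> cball x0 r \<subseteq> \<Omega> \<and> (\<forall>t. 0 < t \<and> t \<le> r \<longrightarrow> ln (1 / t) / 40 - K \<le> mollify \<kappa> \<Omega> u t x0)"
    if x0: "x0 \<in> contact_set \<Omega> Q" for x0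
  proof -
    have x0\<Omega>: "x0 \<in> \<Omega>" and inf: "singular_potential (G x0) = \<infinity>"
      using x0 RG by (auto simp: contact_set_def R_def)
    have "\<exists>C r. C \<ge> 0 \<and> r > 0 \<and> (\<forall>x\<in>ball x0 r. \<bar>G x $ i $ j - G x0 $ i $ j\<bar> \<le> C * dist x x0 powr (1 / 10))" for i j
      using g(3) [OF x0\<Omega>, of "(i, j)"] by (simp add: G_def)
    from potential_log_blowup [OF this GT [OF x0\<Omega>] inf]
    obtain K r where r: "r > 0"
      and K: "\<And>x. x \<in> ball x0 r \<Longrightarrow> x \<noteq> x0 \<Longrightarrow> ereal (ln (1 / dist x x0) / 40 - K) \<le> singular_potential (G x)"
      by blast
    obtain r1 where r1: "r1 > 0" "cball x0 r1 \<subseteq> \<Omega>" using \<Omega> x0\<Omega> open_contains_cball by blast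
    define s where "s = min (r / 2) r1"
    have s: "s > 0" "s < r" "s \<le> r1" using r r1 by (auto simp: s_def)
    have "ln (1 / t) / 40 - K \<le> mollify \<kappa> \<Omega> u t x0" if t: "0 < t" "t \<le> s" for t
    proof (rule mollify_lower_bound [OF mol li])
      show sub: "cball x0 t \<subseteq> \<Omega>" using t s by (intro order_trans [OF subset_cball r1(2)]) simp
      have "AE x in lebesgue. x \<noteq> x0"
        using AE_not_in [of "{x0}" lebesgue] by (simp add: negligible_iff_null_sets [symmetric])
      with uG show "AE y in lebesgue. y \<in> cball x0 t \<longrightarrow> ln (1 / t) / 40 - K \<le> u y"
      proof eventually_elim
        case (elim y)
        show ?case
        proof
          assume y: "y \<in> cball x0 t"
          then have d: "0 < dist y x0" "dist y x0 \<le> t" using elim by (auto simp: dist_commute)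
          have "y \<in> \<Omega>" using y sub by blast
          then have "ereal (ln (1 / dist y x0) / 40 - K) \<le> ereal (u y)"
            using K [of y] elim d t s by (simp add: dist_commute)
          moreover have "ln (1 / t) \<le> ln (1 / dist y x0)" using d t by (simp add: ln_div)
          ultimately show "ln (1 / t) / 40 - K \<le> u y" by simp
        qed
      qed
    qed (use t in auto)
    moreover have "cball x0 s \<subseteq> \<Omega>" using s by (intro order_trans [OF subset_cball r1(2)]) simp
    ultimately show ?thesis using s(1) by blast
  qed
  have "contact_set \<Omega> Q = {}" if n: "CARD('n) = 2"
  proof (rule ccontr)
    assume "contact_set \<Omega> Q \<noteq> {}"
    then obtain x0 where "x0 \<in> contact_set \<Omega> Q" by blast
    from blowup [OF this] obtain K r where r: "r > 0" "cball x0 r \<subseteq> \<Omega>"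
      and K: "\<And>t. 0 < t \<Longrightarrow> t \<le> r \<Longrightarrow> ln (1 / t) / 40 - K \<le> mollify \<kappa> \<Omega> u t x0" by blast
    have n2: "DIM(real^'n) = 2" using n by simp
    \<comment> \<open>Half the rate \<open>1/40\<close> of \<open>blowup\<close>, so that a positive
      multiple of the logarithm remains after subtraction.\<close>
    obtain C \<delta> where \<delta>: "\<delta> > 0" and C: "\<And>t. 0 < t \<Longrightarrow> t \<le> \<delta> \<Longrightarrow> \<bar>mollify \<kappa> \<Omega> u t x0\<bar> \<le> C + 1 / 80 * ln (1 / t)"
    proof (rule mollify_log_growth [OF \<kappa> n2 _ _ r(2) r(1)])
      show "(1 / 80 :: real) > 0" by simp
    qed (use v in blast)+
    \<comment> \<open>The two bounds together give \<open>ln (1 / t) / 80 \<le> C + K\<close>, which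
      fails for every \<open>t\<close> up to \<open>exp (- L)\<close>.\<close>
    define L where "L = 80 * (C + K) + 1"
    define t where "t = min (min r \<delta>) (exp (- L))"
    have t: "0 < t" "t \<le> r" "t \<le> \<delta>" using r \<delta> by (auto simp: t_def)
    have "ln t \<le> ln (exp (- L))" using t(1) by (subst ln_le_cancel_iff) (auto simp: t_def)
    then have "L \<le> ln (1 / t)" using t(1) by (simp add: ln_div)
    moreover have "ln (1 / t) / 40 - K \<le> C + 1 / 80 * ln (1 / t)"
      using K [OF t(1,2)] C [OF t(1,3)] by linarith
    ultimately show False by (simp add: L_def)
  qed
  moreover have "hausdorff_measure (1 + \<epsilon>) (contact_set \<Omega> Q) = 0" if n: "CARD('n) = 3" and \<epsilon>: "\<epsilon> > 0" for \<epsilon>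
  proof (rule hausdorff_measure_zero_of_concentration [where F = "\<lambda>y. \<Sum>b\<in>Basis. (v b y)\<^sup>2" and \<Omega> = \<Omega>])
    show "0 \<le> (\<Sum>b\<in>Basis. (v b y)\<^sup>2)" for y by (simp add: sum_nonneg)
    show "set_integrable lebesgue \<Omega> (\<lambda>y. \<Sum>b\<in>Basis. (v b y)\<^sup>2)"
    proof (rule set_integral_L2_sum(1))
      show "\<Omega> \<in> lmeasurable" using assms(2) by (auto simp: bounded_domain_def intro: lmeasurable_open)
    qed (use v in auto)
    show "1 + \<epsilon> > 0" using \<epsilon> by simp
    fix x0 and A \<delta> :: real assume x0: "x0 \<in> contact_set \<Omega> Q" and A: "A > 0" and \<delta>: "\<delta> > 0"
    from blowup [OF x0] obtain K r where r: "r > 0" "cball x0 r \<subseteq> \<Omega>"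
      and K: "\<And>t. 0 < t \<Longrightarrow> t \<le> r \<Longrightarrow> ln (1 / t) / 40 - K \<le> mollify \<kappa> \<Omega> u t x0" by blast
    show "\<exists>t. 0 < t \<and> t < \<delta> \<and> cball x0 t \<subseteq> \<Omega> \<and> A * t powr (1 + \<epsilon>) < (LINT y:cball x0 t|lebesgue. \<Sum>b\<in>Basis. (v b y)\<^sup>2)"
    proof (rule energy_concentrates [OF \<kappa> _ _ r(2) r(1) _ _ \<delta> A])
      \<comment> \<open>Here \<open>n - 2 = 1\<close>, the critical exponent of
        \<open>energy_concentrates\<close> and the reason for \<open>1 + \<epsilon>\<close>.\<close>
      show "real DIM(real^'n) - 2 < 1 + \<epsilon>" using n \<epsilon> by simp
      fix B \<eta> :: real assume \<eta>: "\<eta> > 0"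
      \<comment> \<open>At this scale the lower bound \<open>ln (1 / t) / 40 - K\<close> exceeds the
        prescribed \<open>B\<close>.\<close>
      define t where "t = min (min r (\<eta> / 2)) (exp (- (40 * (B + K) + 1)))"
      have t: "0 < t" "t \<le> r" "t < \<eta>" using r \<eta> by (auto simp: t_def)
      have "ln t \<le> ln (exp (- (40 * (B + K) + 1)))" using t(1) by (subst ln_le_cancel_iff) (auto simp: t_def)
      then have "40 * (B + K) + 1 \<le> ln (1 / t)" using t(1) by (simp add: ln_div)
      then have "B < ln (1 / t) / 40 - K" by simp
      then have "B < \<bar>mollify \<kappa> \<Omega> u t x0\<bar>" using K [OF t(1,2)] by linarith
      then show "\<exists>t. 0 < t \<and> t < \<eta> \<and> B < \<bar>mollify \<kappa> \<Omega> u t x0\<bar>" using t by blast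
    qed (use v in blast)+
  qed
  ultimately show ?thesis using hausdorff_dim_le by blast
qed

end
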